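(* Let $\mathcal B$ and $\mathcal C$ be $C^*$-algebras where $\mathcal B$ is unital. Let $E$ and $F$ be Hilbert $C^*$-modules over $\mathcal B$ and $\mathcal C$ respectively, and let $S$ be a set. For each $\sigma\in S$ let $\mathcal K^{\sigma}$ be a map from $E$ to $F$. Then the following conditions are equivalent: (i) There is a CPD-kernel $\mathfrak K:S\times S\to B(\mathcal B,\mathcal C)$ such that $\{\mathcal K^{\sigma}\}_{\sigma\in S}$ is a $\mathfrak K$-family. (ii) There exist a pair $(\mathcal F,\mathfrak i)$ consisting of a $C^*$-correspondence $\mathcal F$ from $\mathcal B$ to $\mathcal C$ and a map $\mathfrak i:S\to\mathcal F$, and an isometry $\nu:E\bigodot\mathcal F\to F$ such that $$\nu(x\odot\mathfrak i(\sigma))=\mathcal K^{\sigma}(x)\quad\text{for all }x\in E,\ \sigma\in S.$$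
   Context: Inner products on Hilbert $C^*$-modules are linear in the second variable. $B(\mathcal B,\mathcal C)$ is the set of bounded linear maps from $\mathcal B$ to $\mathcal C$. A map $\mathfrak K:S\times S\to B(\mathcal B,\mathcal C)$, written $(\sigma,\sigma')\mapsto\mathfrak K^{\sigma,\sigma'}$, is called a kernel; it is a completely positive definite kernel (CPD-kernel) over $S$ from $\mathcal B$ to $\mathcal C$ if $\sum_{i,j}c_i^*\mathfrak K^{\sigma_i,\sigma_j}(b_i^*b_j)c_j\ge 0$ for all finite choices of $\sigma_i\in S$, $b_i\in\mathcal B$, $c_i\in\mathcal C$. For a kernel $\mathfrak K$, a family $\{\mathcal K^\sigma\}_{\sigma\in S}$ of maps from $E$ to $F$ is a $\mathfrak K$-family if $\langle\mathcal K^\sigma(x),\mathcal K^{\sigma'}(x')\rangle=\mathfrak K^{\sigma,\sigma'}(\langle x,x'\rangle)$ for all $x,x'\in E$, $\sigma,\sigma'\in S$. A $C^*$-correspondence from $\mathcal A$ to $\mathcal B$ is a right Hilbert $\mathcal B$-module $M$ together with a $*$-homomorphism $\phi:\mathcal A\to B^a(M)$ into the algebra of adjointable operators; one writes $ay:=\phi(a)y$. $E\bigodot\mathcal F$ denotes the interior tensor product over $\mathcal B$, a Hilbert $\mathcal C$-module with $\langle x\odot f,x'\odot f'\rangle=\langle f,\langle x,x'\rangle f'\rangle$. An isometry between Hilbert $\mathcal C$-modules is a linear map preserving the $\mathcal C$-valued inner products. *)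

theory Defs
  imports Complex_Main "HOL-Library.FuncSet"
begin

section \<open>C*-algebras\<close>

text \<open>Not necessarily unital, and possibly zero. A unital C*-algebra is a type of sort
  \<open>{cstar_algebra, monoid_mult}\<close>; this sort does not exclude the zero algebra.\<close>

class cstar_algebra = banach + real_normed_algebra +
  fixes scaleC :: "complex \<Rightarrow> 'a \<Rightarrow> 'a"
    and star :: "'a \<Rightarrow> 'a"
  assumes scaleC_add_right: "scaleC c (x + y) = scaleC c x + scaleC c y"
    and scaleC_add_left: "scaleC (c + d) x = scaleC c x + scaleC d x"
    and scaleC_scaleC: "scaleC c (scaleC d x) = scaleC (c * d) x"
    and scaleC_of_real: "scaleC (complex_of_real r) x = scaleR r x"
    and mult_scaleC_left: "scaleC c x * y = scaleC c (x * y)"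
    and mult_scaleC_right: "x * scaleC c y = scaleC c (x * y)"
    and norm_scaleC: "norm (scaleC c x) = cmod c * norm x"
    and star_star: "star (star x) = x"
    and star_add: "star (x + y) = star x + star y"
    and star_scaleC: "star (scaleC c x) = scaleC (cnj c) (star x)"
    and star_mult: "star (x * y) = star y * star x"
    and cstar_identity: "norm (star x * x) = (norm x)\<^sup>2"

definition cstar_nonneg :: "'a::cstar_algebra \<Rightarrow> bool" where
  "cstar_nonneg a \<longleftrightarrow> (\<exists>b. a = star b * b)"

definition bounded_clinear :: "('a::cstar_algebra \<Rightarrow> 'b::cstar_algebra) \<Rightarrow> bool" where
  "bounded_clinear f \<longleftrightarrow> bounded_linear f \<and> (\<forall>c x. f (scaleC c x) = scaleC c (f x))"


section \<open>Hilbert C*-modules\<close>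

text \<open>Structures with explicit carriers: operations are only constrained on the carrier.\<close>

record ('e, 'b) hmod =
  car :: "'e set"
  mzero :: 'e
  madd :: "'e \<Rightarrow> 'e \<Rightarrow> 'e"
  mscale :: "complex \<Rightarrow> 'e \<Rightarrow> 'e"
  mact :: "'e \<Rightarrow> 'b \<Rightarrow> 'e"
  inn :: "'e \<Rightarrow> 'e \<Rightarrow> 'b"

definition mdiff :: "('e, 'b) hmod \<Rightarrow> 'e \<Rightarrow> 'e \<Rightarrow> 'e" where
  "mdiff M x y = madd M x (mscale M (- 1) y)"

definition mnorm :: "('e, 'b::cstar_algebra) hmod \<Rightarrow> 'e \<Rightarrow> real" where
  "mnorm M x = sqrt (norm (inn M x x))"

locale hilbert_module =
  fixes M :: "('e, 'b::cstar_algebra) hmod"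
  assumes zero_closed: "mzero M \<in> car M"
    and add_closed: "\<lbrakk>x \<in> car M; y \<in> car M\<rbrakk> \<Longrightarrow> madd M x y \<in> car M"
    and scale_closed: "x \<in> car M \<Longrightarrow> mscale M c x \<in> car M"
    and act_closed: "x \<in> car M \<Longrightarrow> mact M x b \<in> car M"
    and add_assoc: "\<lbrakk>x \<in> car M; y \<in> car M; z \<in> car M\<rbrakk>
      \<Longrightarrow> madd M (madd M x y) z = madd M x (madd M y z)"
    and add_commute: "\<lbrakk>x \<in> car M; y \<in> car M\<rbrakk> \<Longrightarrow> madd M x y = madd M y x"
    and add_zero: "x \<in> car M \<Longrightarrow> madd M (mzero M) x = x"
    and add_inverse: "x \<in> car M \<Longrightarrow> \<exists>y\<in>car M. madd M x y = mzero M"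
    and scale_one: "x \<in> car M \<Longrightarrow> mscale M 1 x = x"
    and scale_scale: "x \<in> car M \<Longrightarrow> mscale M c (mscale M d x) = mscale M (c * d) x"
    and scale_add_left: "x \<in> car M \<Longrightarrow> mscale M (c + d) x = madd M (mscale M c x) (mscale M d x)"
    and scale_add_right: "\<lbrakk>x \<in> car M; y \<in> car M\<rbrakk>
      \<Longrightarrow> mscale M c (madd M x y) = madd M (mscale M c x) (mscale M c y)"
    and act_mult: "x \<in> car M \<Longrightarrow> mact M x (a * b) = mact M (mact M x a) b"
    and act_add_left: "\<lbrakk>x \<in> car M; y \<in> car M\<rbrakk>
      \<Longrightarrow> mact M (madd M x y) b = madd M (mact M x b) (mact M y b)"
    and act_add_right: "x \<in> car M \<Longrightarrow> mact M x (a + b) = madd M (mact M x a) (mact M x b)"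
    and act_scale_left: "x \<in> car M \<Longrightarrow> mact M (mscale M c x) b = mscale M c (mact M x b)"
    and act_scale_right: "x \<in> car M \<Longrightarrow> mact M x (scaleC c b) = mscale M c (mact M x b)"
    and inn_add: "\<lbrakk>x \<in> car M; y \<in> car M; z \<in> car M\<rbrakk>
      \<Longrightarrow> inn M x (madd M y z) = inn M x y + inn M x z"
    and inn_scale: "\<lbrakk>x \<in> car M; y \<in> car M\<rbrakk> \<Longrightarrow> inn M x (mscale M c y) = scaleC c (inn M x y)"
    and inn_act: "\<lbrakk>x \<in> car M; y \<in> car M\<rbrakk> \<Longrightarrow> inn M x (mact M y b) = inn M x y * b"
    and inn_star: "\<lbrakk>x \<in> car M; y \<in> car M\<rbrakk> \<Longrightarrow> star (inn M x y) = inn M y x"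
    and inn_nonneg: "x \<in> car M \<Longrightarrow> cstar_nonneg (inn M x x)"
    and inn_definite: "\<lbrakk>x \<in> car M; inn M x x = 0\<rbrakk> \<Longrightarrow> x = mzero M"
    and complete: "\<lbrakk>\<And>n. s n \<in> car M;
        \<forall>\<epsilon>>0. \<exists>N. \<forall>m\<ge>N. \<forall>n\<ge>N. mnorm M (mdiff M (s m) (s n)) < \<epsilon>\<rbrakk>
      \<Longrightarrow> \<exists>l\<in>car M. (\<lambda>n. mnorm M (mdiff M (s n) l)) \<longlonglongrightarrow> 0"

definition hmod_isometry ::
    "('e, 'b::cstar_algebra) hmod \<Rightarrow> ('f, 'b) hmod \<Rightarrow> ('e \<Rightarrow> 'f) \<Rightarrow> bool" where
  "hmod_isometry M N \<nu> \<longleftrightarrow> \<nu> \<in> car M \<rightarrow> car N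
     \<and> (\<forall>x\<in>car M. \<forall>y\<in>car M. \<nu> (madd M x y) = madd N (\<nu> x) (\<nu> y))
     \<and> (\<forall>c. \<forall>x\<in>car M. \<nu> (mscale M c x) = mscale N c (\<nu> x))
     \<and> (\<forall>x\<in>car M. \<forall>y\<in>car M. inn N (\<nu> x) (\<nu> y) = inn M x y)"

definition is_adjoint :: "('e, 'b) hmod \<Rightarrow> ('e \<Rightarrow> 'e) \<Rightarrow> ('e \<Rightarrow> 'e) \<Rightarrow> bool" where
  "is_adjoint M T T' \<longleftrightarrow> T \<in> car M \<rightarrow> car M \<and> T' \<in> car M \<rightarrow> car M
     \<and> (\<forall>x\<in>car M. \<forall>y\<in>car M. inn M (T x) y = inn M x (T' y))"

text \<open>\<open>\<phi>_star\<close> says at once that each \<open>\<phi> a\<close> is adjointable (hence automatically linear and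
  bounded) and that \<open>\<phi>\<close> preserves adjoints. No unitality or nondegeneracy is required.\<close>

locale cstar_correspondence = hilbert_module M
  for M :: "('m, 'c::cstar_algebra) hmod" +
  fixes \<phi> :: "'a::cstar_algebra \<Rightarrow> 'm \<Rightarrow> 'm"
  assumes \<phi>_star: "is_adjoint M (\<phi> a) (\<phi> (star a))"
    and \<phi>_add: "y \<in> car M \<Longrightarrow> \<phi> (a + b) y = madd M (\<phi> a y) (\<phi> b y)"
    and \<phi>_scale: "y \<in> car M \<Longrightarrow> \<phi> (scaleC c a) y = mscale M c (\<phi> a y)"
    and \<phi>_mult: "y \<in> car M \<Longrightarrow> \<phi> (a * b) y = \<phi> a (\<phi> b y)"


section \<open>The interior tensor product\<close>

text \<open>A list \<open>[(x\<^sub>1, y\<^sub>1), \<dots>, (x\<^sub>n, y\<^sub>n)]\<close> stands for the finite sum of the elementary tensors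
  \<open>x\<^sub>i \<odot> y\<^sub>i\<close>; scalars are absorbed into the second factor, so all elements of the algebraic
  tensor product are represented. The interior tensor product is the Hausdorff completion of
  the space of these sums with respect to the seminorm of the semi-inner product determined by
  \<open>\<langle>x \<odot> y, x' \<odot> y'\<rangle> = \<langle>y, \<langle>x, x'\<rangle> y'\<rangle>\<close>: Cauchy sequences modulo sequences tending to zero. The
  bilinearity and balancing relations hold because the corresponding sums have seminorm zero.\<close>

definition tens_sums :: "('e, 'b) hmod \<Rightarrow> ('m, 'c) hmod \<Rightarrow> ('e \<times> 'm) list set" where
  "tens_sums E M = lists (car E \<times> car M)"

definition tens_inn :: "('e, 'b) hmod \<Rightarrow> ('m, 'c::cstar_algebra) hmod \<Rightarrow> ('b \<Rightarrow> 'm \<Rightarrow> 'm)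
    \<Rightarrow> ('e \<times> 'm) list \<Rightarrow> ('e \<times> 'm) list \<Rightarrow> 'c" where
  "tens_inn E M \<phi> u v = (\<Sum>(x, y)\<leftarrow>u. \<Sum>(x', y')\<leftarrow>v. inn M y (\<phi> (inn E x x') y'))"

definition tens_scale :: "('m, 'c) hmod \<Rightarrow> complex \<Rightarrow> ('e \<times> 'm) list \<Rightarrow> ('e \<times> 'm) list" where
  "tens_scale M c u = map (\<lambda>(x, y). (x, mscale M c y)) u"

definition tens_act :: "('m, 'c) hmod \<Rightarrow> ('e \<times> 'm) list \<Rightarrow> 'c \<Rightarrow> ('e \<times> 'm) list" where
  "tens_act M u c = map (\<lambda>(x, y). (x, mact M y c)) u"

definition tens_dist :: "('e, 'b) hmod \<Rightarrow> ('m, 'c::cstar_algebra) hmod \<Rightarrow> ('b \<Rightarrow> 'm \<Rightarrow> 'm)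
    \<Rightarrow> ('e \<times> 'm) list \<Rightarrow> ('e \<times> 'm) list \<Rightarrow> real" where
  "tens_dist E M \<phi> u v =
     (let w = u @ tens_scale M (- 1) v in sqrt (norm (tens_inn E M \<phi> w w)))"

definition tens_cauchy :: "('e, 'b) hmod \<Rightarrow> ('m, 'c::cstar_algebra) hmod \<Rightarrow> ('b \<Rightarrow> 'm \<Rightarrow> 'm)
    \<Rightarrow> (nat \<Rightarrow> ('e \<times> 'm) list) set" where
  "tens_cauchy E M \<phi> = {s. (\<forall>n. s n \<in> tens_sums E M)
     \<and> (\<forall>\<epsilon>>0. \<exists>N. \<forall>m\<ge>N. \<forall>n\<ge>N. tens_dist E M \<phi> (s m) (s n) < \<epsilon>)}"

definition tens_rel :: "('e, 'b) hmod \<Rightarrow> ('m, 'c::cstar_algebra) hmod \<Rightarrow> ('b \<Rightarrow> 'm \<Rightarrow> 'm)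
    \<Rightarrow> (nat \<Rightarrow> ('e \<times> 'm) list) rel" where
  "tens_rel E M \<phi> = {(s, t). s \<in> tens_cauchy E M \<phi> \<and> t \<in> tens_cauchy E M \<phi>
     \<and> (\<lambda>n. tens_dist E M \<phi> (s n) (t n)) \<longlonglongrightarrow> 0}"

definition interior_tensor :: "('e, 'b) hmod \<Rightarrow> ('m, 'c::cstar_algebra) hmod
    \<Rightarrow> ('b \<Rightarrow> 'm \<Rightarrow> 'm) \<Rightarrow> ((nat \<Rightarrow> ('e \<times> 'm) list) set, 'c) hmod" where
  "interior_tensor E M \<phi> =
    \<lparr> car = tens_cauchy E M \<phi> // tens_rel E M \<phi>,
      mzero = tens_rel E M \<phi> `` {\<lambda>n. []},
      madd = (\<lambda>U V. \<Union>s\<in>U. \<Union>t\<in>V. tens_rel E M \<phi> `` {\<lambda>n. s n @ t n}),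
      mscale = (\<lambda>c U. \<Union>s\<in>U. tens_rel E M \<phi> `` {\<lambda>n. tens_scale M c (s n)}),
      mact = (\<lambda>U c. \<Union>s\<in>U. tens_rel E M \<phi> `` {\<lambda>n. tens_act M (s n) c}),
      inn = (\<lambda>U V. THE l. \<forall>s\<in>U. \<forall>t\<in>V. (\<lambda>n. tens_inn E M \<phi> (s n) (t n)) \<longlonglongrightarrow> l) \<rparr>"

definition elem_tensor :: "('e, 'b) hmod \<Rightarrow> ('m, 'c::cstar_algebra) hmod
    \<Rightarrow> ('b \<Rightarrow> 'm \<Rightarrow> 'm) \<Rightarrow> 'e \<Rightarrow> 'm \<Rightarrow> (nat \<Rightarrow> ('e \<times> 'm) list) set" where
  "elem_tensor E M \<phi> x y = tens_rel E M \<phi> `` {\<lambda>n. [(x, y)]}"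


section \<open>Kernels\<close>

definition cpd_kernel ::
    "'s set \<Rightarrow> ('s \<Rightarrow> 's \<Rightarrow> 'b::cstar_algebra \<Rightarrow> 'c::cstar_algebra) \<Rightarrow> bool" where
  "cpd_kernel S \<KK> \<longleftrightarrow> (\<forall>\<sigma>\<in>S. \<forall>\<tau>\<in>S. bounded_clinear (\<KK> \<sigma> \<tau>))
     \<and> (\<forall>(n::nat) \<sigma> b c. (\<forall>i<n. \<sigma> i \<in> S) \<longrightarrow>
          cstar_nonneg (\<Sum>i<n. \<Sum>j<n. star (c i) * \<KK> (\<sigma> i) (\<sigma> j) (star (b i) * b j) * c j))"

definition kernel_family :: "('e, 'b) hmod \<Rightarrow> ('f, 'c) hmod \<Rightarrow> 's set
    \<Rightarrow> ('s \<Rightarrow> 's \<Rightarrow> 'b \<Rightarrow> 'c) \<Rightarrow> ('s \<Rightarrow> 'e \<Rightarrow> 'f) \<Rightarrow> bool" where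
  "kernel_family E F S \<KK> K \<longleftrightarrow> (\<forall>x\<in>car E. \<forall>x'\<in>car E. \<forall>\<sigma>\<in>S. \<forall>\<tau>\<in>S.
     inn F (K \<sigma> x) (K \<tau> x') = \<KK> \<sigma> \<tau> (inn E x x'))"

text \<open>HOL cannot quantify over types inside a formula, so "there is a correspondence" has to refer
  to a carrier type \<open>'m\<close>. The type \<open>'s \<Rightarrow> 'b \<Rightarrow> 'c\<close> is large enough for existence: on the closed
  subcorrespondence generated by \<open>\<ii> ` S\<close>, an element \<open>y\<close> is determined by the function
  \<open>\<lambda>\<sigma> b. \<langle>b \<ii>(\<sigma>), y\<rangle>\<close>.\<close>

definition tensor_factorization :: "('e, 'b::cstar_algebra) hmod \<Rightarrow> ('f, 'c::cstar_algebra) hmod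
    \<Rightarrow> 's set \<Rightarrow> ('s \<Rightarrow> 'e \<Rightarrow> 'f) \<Rightarrow> ('m, 'c) hmod \<Rightarrow> ('b \<Rightarrow> 'm \<Rightarrow> 'm) \<Rightarrow> ('s \<Rightarrow> 'm)
    \<Rightarrow> ((nat \<Rightarrow> ('e \<times> 'm) list) set \<Rightarrow> 'f) \<Rightarrow> bool" where
  "tensor_factorization E F S K M \<phi> \<ii> \<nu> \<longleftrightarrow>
     cstar_correspondence M \<phi> \<and> \<ii> \<in> S \<rightarrow> car M
     \<and> hmod_isometry (interior_tensor E M \<phi>) F \<nu>
     \<and> (\<forall>x\<in>car E. \<forall>\<sigma>\<in>S. \<nu> (elem_tensor E M \<phi> x (\<ii> \<sigma>)) = K \<sigma> x)"

end

theory Submission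
  imports Defs "HOL-Analysis.Operator_Norm" "HOL-Computational_Algebra.Polynomial"
begin

text \<open>Given a factorization, \<open>\<KK>\<^bsup>\<sigma>,\<tau>\<^esup>(b) = \<langle>\<ii>(\<sigma>), b \<ii>(\<tau>)\<rangle>\<close> is the required kernel: its sums are of the
  form \<open>\<langle>z, z\<rangle>\<close>, and it is bounded because \<open>\<parallel>b y\<parallel> \<le> \<parallel>b\<parallel> \<parallel>1 y\<parallel>\<close>. Conversely, a kernel yields a
  correspondence by completing the formal sums \<open>\<Sum> b\<^sub>j \<ii>(\<sigma>\<^sub>j) c\<^sub>j\<close> with
  \<open>\<langle>b \<ii>(\<sigma>) c, b' \<ii>(\<tau>) c'\<rangle> = c\<^sup>* \<KK>\<^bsup>\<sigma>,\<tau>\<^esup>(b\<^sup>* b') c'\<close>. The elements \<open>x b \<odot> \<ii>(\<sigma>) c = x \<odot> b \<ii>(\<sigma>) c\<close> are total in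
  the tensor product, and mapping them to \<open>\<K>\<^bsup>\<sigma>\<^esup>(x b) c\<close> preserves inner products, hence is well
  defined and linear.

  Both directions rest on the order structure of C*-algebras: elements \<open>b\<^sup>* b\<close> form a closed cone on
  which the norm is monotone, and the inner product on the tensor product is positive. The latter
  avoids matrix algebras over \<open>\<B>\<close>; it comes from a moment argument for the Gram matrix.\<close>

section \<open>Elementary C*-algebra facts\<close>

text \<open>Positivity means the bare existence of a \<open>b\<close> with
  \<open>a = star b * b\<close>, and from this form closure under sums and limits is not visible.
  The norm criterion \<open>spec_nonneg\<close> has these properties almost by construction; that
  the two notions agree is the real work, done by splitting off a negative part. The criterion
  mentions 1, so it is applied in the unitization. That \<C> may lack a unit returns in the second
  half: \<open>\<ii> \<sigma>\<close> need not be of the form \<open>b \<ii>(\<sigma>) c\<close>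
  with \<open>c\<close> in \<C>, so coefficients come from the unitization, whereas the CPD
  condition tests only coefficients in \<C>. Positivity of the enlarged form is recovered by
  compressions, its symmetry by polarization. The left action of a given correspondence need not be
  unital, which is why its bounds carry \<open>\<phi> 1 y\<close> instead of \<open>y\<close>. The
  moment argument reuses the square root iteration: run on polynomials, it makes
  \<open>1 - s\<close> a limit of squares. Only powers of one contraction on
  \<open>\<B>\<^sup>n\<close> enter, and no square root of the Gram matrix is ever formed.\<close>

lemma scaleC_one [simp]: "scaleC 1 (x::'a::cstar_algebra) = x"
  using scaleC_of_real[of 1 x] by simp

lemma scaleC_zero_left [simp]: "scaleC 0 (x::'a::cstar_algebra) = 0"
  using scaleC_of_real[of 0 x] by simp

lemma scaleC_zero_right [simp]: "scaleC c (0::'a::cstar_algebra) = 0"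
  using scaleC_add_right[of c 0 "0::'a"] by simp

lemma scaleC_minus_left [simp]: "scaleC (- c) (x::'a::cstar_algebra) = - scaleC c x"
  using scaleC_add_left[of "-c" c x] by (simp add: eq_neg_iff_add_eq_0)

lemma scaleC_minus_right [simp]: "scaleC c (- x::'a::cstar_algebra) = - scaleC c x"
  using scaleC_add_right[of c "-x" x] by (simp add: eq_neg_iff_add_eq_0)

lemma scaleC_diff_right: "scaleC c (x - y::'a::cstar_algebra) = scaleC c x - scaleC c y"
  using scaleC_add_right[of c x "-y"] by simp

lemma scaleC_sum_right: "scaleC c (sum f A) = (\<Sum>i\<in>A. scaleC c (f i :: 'a::cstar_algebra))"
  by (induction A rule: infinite_finite_induct) (auto simp: scaleC_add_right)

lemma scaleR_scaleC_commute:
  "scaleR r (scaleC c (x::'a::cstar_algebra)) = scaleC c (scaleR r x)"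
  by (simp flip: scaleC_of_real add: scaleC_scaleC mult.commute)

lemma star_zero [simp]: "star (0::'a::cstar_algebra) = 0"
  using star_add[of 0 "0::'a"] by simp

lemma star_minus [simp]: "star (- x::'a::cstar_algebra) = - star x"
  using star_add[of "-x" x] by (simp add: eq_neg_iff_add_eq_0)

lemma star_diff: "star (x - y::'a::cstar_algebra) = star x - star y"
  using star_add[of x "-y"] by simp

lemma star_scaleR: "star (scaleR r x::'a::cstar_algebra) = scaleR r (star x)"
  by (simp flip: scaleC_of_real add: star_scaleC)

lemma star_sum: "star (sum f A) = (\<Sum>i\<in>A. star (f i :: 'a::cstar_algebra))"
  by (induction A rule: infinite_finite_induct) (auto simp: star_add)

lemma norm_star [simp]: "norm (star x) = norm (x::'a::cstar_algebra)"
proof -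
  have le: "norm y \<le> norm (star y)" for y :: 'a
  proof (cases "norm y = 0")
    case False
    have "norm y * norm y \<le> norm (star y) * norm y"
      using norm_mult_ineq[of "star y" y] by (simp add: cstar_identity power2_eq_square)
    then show ?thesis using False by (simp add: mult_le_cancel_right)
  qed simp
  show ?thesis using le[of x] le[of "star x"] by (simp add: star_star)
qed

lemma cstar_identity': "norm (x * star x) = (norm (x::'a::cstar_algebra))\<^sup>2"
  using cstar_identity[of "star x"] by (simp add: star_star)

lemma star_mult_self_eq_0 [simp]: "star x * x = 0 \<longleftrightarrow> (x::'a::cstar_algebra) = 0"
  using cstar_identity[of x] by (metis norm_eq_zero zero_eq_power2)

lemma selfadjoint_square_norm:
  "star b = b \<Longrightarrow> norm (b * b) = (norm (b::'a::cstar_algebra))\<^sup>2"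
  by (metis cstar_identity)

lemma bounded_linear_star: "bounded_linear (star :: 'a::cstar_algebra \<Rightarrow> 'a)"
  by (intro bounded_linear_intro[where K=1]) (auto simp: star_add star_scaleR)

lemma bounded_linear_scaleC: "bounded_linear (scaleC c :: 'a::cstar_algebra \<Rightarrow> 'a)"
  by (intro bounded_linear_intro[where K="cmod c"])
    (auto simp: scaleC_add_right scaleR_scaleC_commute norm_scaleC)

lemmas tendsto_star [tendsto_intros] = bounded_linear.tendsto[OF bounded_linear_star]
lemmas tendsto_scaleC [tendsto_intros] = bounded_linear.tendsto[OF bounded_linear_scaleC]

lemma star_one [simp]: "star (1::'a::{cstar_algebra,monoid_mult}) = 1"
  using star_mult[of "star 1" "1::'a"] by (simp add: star_star)

section \<open>Unitization\<close>

datatype 'a unitized = Unitized (alg: 'a) (scal: complex)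

definition left_op :: "'a::cstar_algebra unitized \<Rightarrow> 'a \<Rightarrow> 'a" where
  "left_op u x = alg u * x + scaleC (scal u) x"

lemma bounded_linear_left_op: "bounded_linear (left_op u)"
  unfolding left_op_def
  by (intro bounded_linear_add bounded_linear_mult_right bounded_linear_scaleC)

instantiation unitized :: (cstar_algebra) real_algebra_1
begin

definition "0 = Unitized 0 0"
definition "1 = Unitized 0 1"
definition "u + v = Unitized (alg u + alg v) (scal u + scal v)"
definition "- u = Unitized (- alg u) (- scal u)"
definition "u - v = Unitized (alg u - alg v) (scal u - scal v)"
definition "u * v = Unitized (alg u * alg v + scaleC (scal u) (alg v) + scaleC (scal v) (alg u))
  (scal u * scal v)"
definition "scaleR r u = Unitized (scaleR r (alg u)) (complex_of_real r * scal u)"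

lemmas unitized_defs = zero_unitized_def one_unitized_def plus_unitized_def uminus_unitized_def
  minus_unitized_def times_unitized_def scaleR_unitized_def

instance
proof
  fix u v w :: "'a unitized" and r s :: real
  show "u + v + w = u + (v + w)" "u + v = v + u" "0 + u = u" "- u + u = 0" "u - v = u + - v"
    by (simp_all add: unitized_defs)
  show "u * v * w = u * (v * w)"
    by (simp add: unitized_defs mult_scaleC_left mult_scaleC_right scaleC_scaleC scaleC_add_right
        algebra_simps)
  show "(u + v) * w = u * w + v * w" "u * (v + w) = u * v + u * w"
    by (simp_all add: unitized_defs algebra_simps scaleC_add_left scaleC_add_right)
  show "1 * u = u" "u * 1 = u" "(0 :: 'a unitized) \<noteq> 1"
    by (simp_all add: unitized_defs)
  show "scaleR r (u + v) = scaleR r u + scaleR r v" "scaleR (r + s) u = scaleR r u + scaleR s u"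
    "scaleR r (scaleR s u) = scaleR (r * s) u" "scaleR 1 u = u"
    by (simp_all add: unitized_defs algebra_simps)
  have [simp]: "scaleC (complex_of_real r * c) x = scaleR r (scaleC c x)" for c and x :: 'a
    by (simp flip: scaleC_scaleC add: scaleC_of_real)
  show "scaleR r u * v = scaleR r (u * v)" "u * scaleR r v = scaleR r (u * v)"
    by (simp_all add: unitized_defs scaleR_add_right scaleR_scaleC_commute mult.left_commute)
qed

end

lemma alg_simps [simp]:
  "alg 0 = 0" "alg 1 = 0" "alg (u + v) = alg u + alg v" "alg (- u) = - alg u"
  "alg (u - v) = alg u - alg v" "alg (scaleR r u) = scaleR r (alg u)"
  and alg_mult: "alg (u * v) = alg u * alg v + scaleC (scal u) (alg v) + scaleC (scal v) (alg u)"
  by (simp_all add: unitized_defs)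

lemma scal_simps [simp]:
  "scal 0 = 0" "scal 1 = 1" "scal (u + v) = scal u + scal v" "scal (- u) = - scal u"
  "scal (u - v) = scal u - scal v" "scal (scaleR r u) = of_real r * scal u"
  "scal (u * v) = scal u * scal v"
  by (simp_all add: unitized_defs)

lemma left_op_mult: "left_op (u * v) = left_op u \<circ> left_op v"
  by (rule ext) (simp add: left_op_def alg_mult mult.assoc
      mult_scaleC_left mult_scaleC_right scaleC_scaleC scaleC_add_right algebra_simps)

lemma left_op_add: "left_op (u + v) = (\<lambda>x. left_op u x + left_op v x)"
  by (auto simp: left_op_def algebra_simps scaleC_add_left)

lemma left_op_scaleR: "left_op (scaleR r u) = (\<lambda>x. scaleR r (left_op u x))"
  by (rule ext) (simp add: left_op_def scaleC_add_right mult_scaleC_left scaleC_scaleC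
      flip: scaleC_of_real)

lemma norm_left_op_le: "norm (left_op u x) \<le> onorm (left_op u) * norm x"
  by (rule onorm[OF bounded_linear_left_op])

lemma onorm_left_op_nonneg [simp]: "0 \<le> onorm (left_op u)"
  by (rule onorm_pos_le[OF bounded_linear_left_op])

lemma onorm_left_op_mult: "onorm (left_op (u * v)) \<le> onorm (left_op u) * onorm (left_op v)"
  unfolding left_op_mult
  by (rule onorm_compose[OF bounded_linear_left_op bounded_linear_left_op])

text \<open>Tested on \<open>star (alg u)\<close>, left multiplication by \<open>alg u\<close>
  attains its full norm by the C*-identity, even in an algebra without unit. This makes
  \<open>alg\<close> continuous, which completeness of the unitization rests on.\<close>

lemma norm_alg_le: "norm (alg u) \<le> onorm (left_op u) + cmod (scal u)"
proof (cases "alg u = 0")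
  case False
  have "norm (alg u) * norm (alg u) = norm (alg u * star (alg u))"
    by (simp add: cstar_identity' power2_eq_square)
  also have "\<dots> = norm (left_op u (star (alg u)) - scaleC (scal u) (star (alg u)))"
    by (simp add: left_op_def)
  also have "\<dots> \<le> onorm (left_op u) * norm (alg u) + cmod (scal u) * norm (alg u)"
    using norm_left_op_le[of u "star (alg u)"]
    by (intro order_trans[OF norm_triangle_ineq4]) (simp add: norm_scaleC)
  also have "\<dots> = (onorm (left_op u) + cmod (scal u)) * norm (alg u)"
    by (rule distrib_right[symmetric])
  finally show ?thesis using False by (simp add: mult_le_cancel_right)
qed simp

lemma onorm_left_op_le: "onorm (left_op u) \<le> norm (alg u) + cmod (scal u)"
proof (rule onorm_bound)
  fix x show "norm (left_op u x) \<le> (norm (alg u) + cmod (scal u)) * norm x"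
    unfolding left_op_def distrib_right
    by (rule order_trans[OF norm_triangle_ineq]) (simp add: norm_mult_ineq norm_scaleC)
qed simp

instantiation unitized :: (cstar_algebra) real_normed_algebra_1
begin

text \<open>The second component of the maximum makes this a norm even if \<open>'a\<close> already has a unit,
  in which case the left multiplication operators do not separate points.\<close>
definition "norm u = max (onorm (left_op u)) (cmod (scal u))"
definition "sgn (u :: 'a unitized) = u /\<^sub>R norm u"
definition "dist (u :: 'a unitized) v = norm (u - v)"
definition "uniformity = (INF e\<in>{0<..}. principal {(x::'a unitized, y). dist x y < e})"
definition "open (U :: 'a unitized set) =
  (\<forall>x\<in>U. eventually (\<lambda>(x', y). x' = x \<longrightarrow> y \<in> U) uniformity)"

instance
proof
  fix u v w :: "'a unitized" and r :: real and U :: "'a unitized set"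
  show "sgn u = u /\<^sub>R norm u" by (rule sgn_unitized_def)
  show "dist u v = norm (u - v)" by (rule dist_unitized_def)
  show "uniformity = (INF e\<in>{0<..}. principal {(x::'a unitized, y). dist x y < e})"
    by (rule uniformity_unitized_def)
  show "open U = (\<forall>x\<in>U. eventually (\<lambda>(x', y). x' = x \<longrightarrow> y \<in> U) uniformity)"
    by (rule open_unitized_def)
  show "norm u = 0 \<longleftrightarrow> u = 0"
  proof
    assume "norm u = 0"
    then have "onorm (left_op u) \<le> 0" "cmod (scal u) \<le> 0"
      unfolding norm_unitized_def by (metis max.cobounded1, metis max.cobounded2)
    then have "cmod (scal u) \<le> 0" "norm (alg u) \<le> 0"
      using norm_alg_le[of u] by linarith+
    then have "scal u = 0" "alg u = 0" by simp_all
    then show "u = 0" by (metis unitized.collapse zero_unitized_def)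
  next
    assume "u = 0"
    then show "norm u = 0"
      using onorm_left_op_le[of u] onorm_left_op_nonneg[of u] unfolding norm_unitized_def
      by (intro antisym max.boundedI) (auto simp: max.coboundedI1)
  qed
  show "norm (u + v) \<le> norm u + norm v"
    using onorm_triangle[OF bounded_linear_left_op bounded_linear_left_op, of u v]
      norm_triangle_ineq[of "scal u" "scal v"]
    unfolding norm_unitized_def left_op_add scal_simps max_def by (simp split: if_splits)
  show "norm (scaleR r u) = \<bar>r\<bar> * norm u"
    by (simp add: norm_unitized_def left_op_scaleR onorm_scaleR[OF bounded_linear_left_op]
        norm_mult max_mult_distrib_left)
  show "norm (u * v) \<le> norm u * norm v"
    unfolding norm_unitized_def
  proof (rule max.boundedI)
    show "onorm (left_op (u * v)) \<le> max (onorm (left_op u)) (cmod (scal u))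
        * max (onorm (left_op v)) (cmod (scal v))"
      by (rule order_trans[OF onorm_left_op_mult], rule mult_mono) (auto simp: le_max_iff_disj)
    show "cmod (scal (u * v)) \<le> max (onorm (left_op u)) (cmod (scal u))
        * max (onorm (left_op v)) (cmod (scal v))"
      unfolding scal_simps norm_mult by (rule mult_mono) (auto simp: le_max_iff_disj)
  qed
  show "norm (1 :: 'a unitized) = 1"
    using onorm_left_op_le[of "1 :: 'a unitized"] by (simp add: norm_unitized_def)
qed

end

lemma onorm_le_norm_unitized: "onorm (left_op u) \<le> norm u"
  and norm_scal_le: "cmod (scal u) \<le> norm u"
  and norm_unitized_le: "norm u \<le> norm (alg u) + cmod (scal u)"
  using onorm_left_op_le[of u] by (simp_all add: norm_unitized_def)

lemma bounded_linear_alg: "bounded_linear (alg :: 'a::cstar_algebra unitized \<Rightarrow> 'a)"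
proof (rule bounded_linear_intro[where K=2])
  fix u :: "'a unitized"
  show "norm (alg u) \<le> norm u * 2"
    using norm_alg_le[of u] onorm_le_norm_unitized[of u] norm_scal_le[of u] by simp
qed simp_all

lemma bounded_linear_scal: "bounded_linear (scal :: 'a::cstar_algebra unitized \<Rightarrow> complex)"
  by (rule bounded_linear_intro[where K=1]) (simp_all add: scaleR_conv_of_real[where 'a=complex] norm_scal_le)

instantiation unitized :: (cstar_algebra) cstar_algebra
begin

definition "scaleC c u = Unitized (scaleC c (alg u)) (c * scal u)"
definition "star u = Unitized (star (alg u)) (cnj (scal u))"

lemma scaleC_star_sel [simp]:
  "alg (scaleC c u) = scaleC c (alg u)" "scal (scaleC c u) = c * scal u"
  "alg (star u) = star (alg u)" "scal (star u) = cnj (scal u)"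
  by (simp_all add: scaleC_unitized_def star_unitized_def)

lemma left_op_star:
  "star (left_op u x) * left_op u x = star x * left_op (star u * u) (x :: 'a)"
  by (simp add: left_op_def alg_mult mult.assoc mult_scaleC_left
      mult_scaleC_right scaleC_scaleC scaleC_add_right star_add star_mult star_scaleC algebra_simps)

text \<open>By \<open>left_op_star\<close>, \<open>left_op (star u)\<close> acts as an adjoint of
  \<open>left_op u\<close> for the algebra-valued inner product \<open>star x * y\<close>. The usual
  argument for Hilbert space operators then applies: the squared norm of \<open>v\<close> is at most
  the norm of \<open>star v * v\<close>, so \<open>star\<close> does not change the norm.\<close>

lemma onorm_left_op_star:
  fixes u :: "'a unitized"
  shows "onorm (left_op (star u * u)) = (onorm (left_op u))\<^sup>2"
proof -
  have sq: "(onorm (left_op v))\<^sup>2 \<le> onorm (left_op (star v * v))" for v :: "'a unitized"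
  proof -
    have "onorm (left_op v) \<le> sqrt (onorm (left_op (star v * v)))"
    proof (rule onorm_bound)
      fix x
      have "(norm (left_op v x))\<^sup>2 = norm (star x * left_op (star v * v) x)"
        using cstar_identity[of "left_op v x"] by (simp add: left_op_star)
      also have "\<dots> \<le> norm x * (onorm (left_op (star v * v)) * norm x)"
        by (rule order_trans[OF norm_mult_ineq])
          (simp add: mult_left_mono norm_left_op_le)
      also have "\<dots> = (sqrt (onorm (left_op (star v * v))) * norm x)\<^sup>2"
        by (simp add: power_mult_distrib) (simp add: power2_eq_square)
      finally show "norm (left_op v x) \<le> sqrt (onorm (left_op (star v * v))) * norm x"
        by (rule power2_le_imp_le) simp
    qed simp
    then show ?thesis
      using power_mono[of "onorm (left_op v)" "sqrt (onorm (left_op (star v * v)))" 2] by simp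
  qed
  have le: "onorm (left_op v) \<le> onorm (left_op (star v))" for v :: "'a unitized"
  proof (cases "onorm (left_op v) = 0")
    case False
    then have "onorm (left_op v) > 0"
      using onorm_left_op_nonneg[of v] by linarith
    moreover have "onorm (left_op v) * onorm (left_op v)
        \<le> onorm (left_op (star v)) * onorm (left_op v)"
      using sq[of v] onorm_left_op_mult[of "star v" v] by (simp add: power2_eq_square)
    ultimately show ?thesis by (simp add: mult_le_cancel_right)
  qed simp
  have "star (star u) = u" by (simp add: star_unitized_def star_star)
  then have eq: "onorm (left_op (star u)) = onorm (left_op u)"
    using le[of u] le[of "star u"] by simp
  show ?thesis
    using sq[of u] onorm_left_op_mult[of "star u" u] by (simp add: eq power2_eq_square)
qed

instance
proof
  fix u v :: "'a unitized" and c d :: complex and r :: real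
  show "scaleC c (u + v) = scaleC c u + scaleC c v" "scaleC (c + d) u = scaleC c u + scaleC d u"
    "scaleC c (scaleC d u) = scaleC (c * d) u" "scaleC (complex_of_real r) u = scaleR r u"
    "scaleC c u * v = scaleC c (u * v)" "u * scaleC c v = scaleC c (u * v)"
    "star (star u) = u" "star (u + v) = star u + star v"
    "star (scaleC c u) = scaleC (cnj c) (star u)" "star (u * v) = star v * star u"
    by (rule unitized.expand;
      simp add: alg_mult distrib_left distrib_right scaleC_add_left scaleC_add_right scaleC_scaleC
        scaleC_of_real mult_scaleC_left mult_scaleC_right star_add star_star star_scaleC star_mult
        mult.commute)+
  have le: "norm (scaleC c u) \<le> cmod c * norm u" for c and u :: "'a unitized"
  proof -
    have "left_op (scaleC c u) x = scaleC c (left_op u x)" for x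
      by (simp add: left_op_def scaleC_add_right scaleC_scaleC mult_scaleC_left)
    then have "onorm (left_op (scaleC c u)) \<le> cmod c * onorm (left_op u)"
      by (intro onorm_bound) (simp_all add: norm_scaleC mult_left_mono norm_left_op_le mult.assoc)
    then show ?thesis
      by (simp add: norm_unitized_def norm_mult max_mult_distrib_left)
  qed
  show "norm (scaleC c u) = cmod c * norm u"
  proof (cases "c = 0")
    case True
    then show ?thesis using le[of 0 u] by simp
  next
    case False
    have "norm u = norm (scaleC (inverse c) (scaleC c u))"
      using False by (simp add: scaleC_unitized_def scaleC_scaleC flip: mult.assoc)
    also have "\<dots> \<le> cmod (inverse c) * norm (scaleC c u)" by (rule le)
    finally have "cmod c * norm u \<le> cmod c * (cmod (inverse c) * norm (scaleC c u))"
      by (rule mult_left_mono) simp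
    also have "\<dots> = norm (scaleC c u)"
      using False by (simp flip: mult.assoc norm_mult)
    finally have "cmod c * norm u \<le> norm (scaleC c u)" .
    then show ?thesis using le[of c u] by simp
  qed
  have "norm (star u * u) = max ((onorm (left_op u))\<^sup>2) ((cmod (scal u))\<^sup>2)"
    by (simp add: norm_unitized_def onorm_left_op_star norm_mult power2_eq_square)
  also have "\<dots> = (max (onorm (left_op u)) (cmod (scal u)))\<^sup>2"
    using power_mono[of "onorm (left_op u)" "cmod (scal u)" 2]
      power_mono[of "cmod (scal u)" "onorm (left_op u)" 2]
    by (cases "onorm (left_op u) \<le> cmod (scal u)") (simp_all add: max_absorb1 max_absorb2)
  finally show "norm (star u * u) = (norm u)\<^sup>2"
    by (simp only: norm_unitized_def)
next
  fix X :: "nat \<Rightarrow> 'a unitized"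
  assume C: "Cauchy X"
  have "convergent (\<lambda>n. alg (X n))"
    by (rule Cauchy_convergent[OF bounded_linear.Cauchy[OF bounded_linear_alg C]])
  moreover have "convergent (\<lambda>n. scal (X n))"
    by (rule Cauchy_convergent[OF bounded_linear.Cauchy[OF bounded_linear_scal C]])
  ultimately obtain a c where a: "(\<lambda>n. alg (X n)) \<longlonglongrightarrow> a" and c: "(\<lambda>n. scal (X n)) \<longlonglongrightarrow> c"
    unfolding convergent_def by blast
  have "(\<lambda>n. norm (alg (X n) - a) + cmod (scal (X n) - c)) \<longlonglongrightarrow> 0"
    using tendsto_add[OF tendsto_norm_zero[OF LIM_zero[OF a]] tendsto_norm_zero[OF LIM_zero[OF c]]]
    by simp
  then have "(\<lambda>n. X n - Unitized a c) \<longlonglongrightarrow> 0"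
  proof (rule tendsto_0_le[where K=1], intro always_eventually allI)
    fix n
    show "norm (X n - Unitized a c) \<le> norm (norm (alg (X n) - a) + cmod (scal (X n) - c)) * 1"
      using norm_unitized_le[of "X n - Unitized a c"] by simp
  qed
  then have "X \<longlonglongrightarrow> Unitized a c" by (rule LIM_zero_cancel)
  then show "convergent X" by (rule convergentI)
qed

end

section \<open>Positivity in C*-algebras\<close>

text \<open>With \<open>\<parallel>u\<parallel> \<le> 1\<close>, the iteration \<open>Y \<mapsto> (u + Y\<^sup>2) / 2\<close> converges to \<open>1 - \<surd>(1 - u)\<close>;
  its increments are dominated by those of the scalar iteration with \<open>u = 1\<close>.\<close>

fun sqrt_majorant :: "nat \<Rightarrow> real" where
  "sqrt_majorant 0 = 0"
| "sqrt_majorant (Suc n) = (1 + (sqrt_majorant n)\<^sup>2) / 2"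

lemma sqrt_majorant_bounds: "0 \<le> sqrt_majorant n" "sqrt_majorant n \<le> 1"
proof (induction n)
  case (Suc n)
  { case 1 show ?case by simp }
  { case 2 show ?case using Suc power_mono[of "sqrt_majorant n" 1 2] by simp }
qed simp_all

lemma sqrt_majorant_mono: "sqrt_majorant n \<le> sqrt_majorant (Suc n)"
  using zero_le_power2[of "1 - sqrt_majorant n"] by (simp add: power2_eq_square algebra_simps)

lemma sqrt_majorant_convergent: "convergent sqrt_majorant"
proof -
  have "incseq sqrt_majorant" by (rule incseq_SucI) (rule sqrt_majorant_mono)
  then obtain L where "sqrt_majorant \<longlonglongrightarrow> L"
    by (rule incseq_convergent[where B=1]) (simp_all add: sqrt_majorant_bounds)
  then show ?thesis by (rule convergentI)
qed

lemma norm_mult_le: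
  fixes x y :: "'a::real_normed_algebra"
  shows "norm x \<le> r \<Longrightarrow> norm y \<le> s \<Longrightarrow> norm (x * y) \<le> r * s"
  by (rule order_trans[OF norm_mult_ineq]) (rule mult_mono', simp_all)

fun sqrt_iter :: "'a::real_normed_algebra_1 \<Rightarrow> nat \<Rightarrow> 'a" where
  "sqrt_iter u 0 = 0"
| "sqrt_iter u (Suc n) = (1/2) *\<^sub>R (u + sqrt_iter u n * sqrt_iter u n)"

lemma sqrt_iter_bounds:
  assumes "norm u \<le> 1"
  shows "norm (sqrt_iter u n) \<le> sqrt_majorant n"
    and "norm (sqrt_iter u (Suc n) - sqrt_iter u n) \<le> sqrt_majorant (Suc n) - sqrt_majorant n"
proof -
  show 1: "norm (sqrt_iter u n) \<le> sqrt_majorant n" for n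
  proof (induction n)
    case (Suc n)
    have "norm (sqrt_iter u n * sqrt_iter u n) \<le> (sqrt_majorant n)\<^sup>2"
      unfolding power2_eq_square by (intro norm_mult_le Suc)
    then show ?case
      using assms norm_triangle_ineq[of u "sqrt_iter u n * sqrt_iter u n"] by simp
  qed simp
  show "norm (sqrt_iter u (Suc n) - sqrt_iter u n) \<le> sqrt_majorant (Suc n) - sqrt_majorant n"
  proof (induction n)
    case 0 then show ?case using assms by simp
  next
    case (Suc n)
    let ?a = "sqrt_iter u n" and ?b = "sqrt_iter u (Suc n)"
    let ?p = "sqrt_majorant n" and ?q = "sqrt_majorant (Suc n)"
    have "sqrt_iter u (Suc (Suc n)) - ?b = (1/2) *\<^sub>R ((u + ?b * ?b) - (u + ?a * ?a))"
      unfolding scaleR_diff_right by (simp only: sqrt_iter.simps(2))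
    also have "\<dots> = (1/2) *\<^sub>R ((?b - ?a) * ?b + ?a * (?b - ?a))"
      by (simp add: algebra_simps del: sqrt_iter.simps)
    finally have eq: "sqrt_iter u (Suc (Suc n)) - ?b = \<dots>" .
    have "norm ((?b - ?a) * ?b + ?a * (?b - ?a)) \<le> (?q - ?p) * ?q + ?p * (?q - ?p)"
      by (intro norm_triangle_le add_mono norm_mult_le Suc 1)
    also have "\<dots> = 2 * (sqrt_majorant (Suc (Suc n)) - ?q)"
    proof -
      have "2 * sqrt_majorant (Suc (Suc n)) = 1 + ?q * ?q" "2 * ?q = 1 + ?p * ?p"
        by (simp_all add: power2_eq_square)
      then show ?thesis by (simp only: algebra_simps)
    qed
    finally show ?case unfolding eq by (simp del: sqrt_iter.simps sqrt_majorant.simps)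
  qed
qed

lemma sqrt_iter_convergent:
  fixes u :: "'a::{real_normed_algebra_1,banach}"
  assumes "norm u \<le> 1"
  shows "convergent (sqrt_iter u)"
proof -
  have le: "norm (sqrt_iter u (n + k) - sqrt_iter u n) \<le> sqrt_majorant (n + k) - sqrt_majorant n" for n k
  proof (induction k)
    case (Suc k)
    then show ?case
      using sqrt_iter_bounds(2)[OF assms, of "n + k"]
        norm_triangle_ineq[of "sqrt_iter u (Suc (n+k)) - sqrt_iter u (n+k)" "sqrt_iter u (n+k) - sqrt_iter u n"]
      by (simp del: sqrt_iter.simps sqrt_majorant.simps)
  qed simp
  have le': "norm (sqrt_iter u m - sqrt_iter u n) \<le> norm (sqrt_majorant m - sqrt_majorant n)" for m n
  proof (cases "n \<le> m")
    case True then show ?thesis using le[of n "m - n"] by simp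
  next
    case False then show ?thesis using le[of m "n - m"] by (simp add: norm_minus_commute)
  qed
  have "Cauchy sqrt_majorant" by (rule convergent_Cauchy[OF sqrt_majorant_convergent])
  then have "Cauchy (sqrt_iter u)"
    unfolding Cauchy_iff by (elim all_forward imp_forward ex_forward) (auto intro: le_less_trans[OF le'])
  then show ?thesis by (rule Cauchy_convergent)
qed

text \<open>The limit satisfies 2 Y = 1 - a + Y^2, which says that 1 - Y is a root of
  \<open>a\<close>. The iterates are polynomials in \<open>1 - a\<close>, so whatever commutes with
  \<open>a\<close> commutes with the root; this clause does the duty of a functional calculus
  below.\<close>

lemma cstar_sqrt:
  fixes a :: "'a::{cstar_algebra,real_normed_algebra_1}"
  assumes "star a = a" and "norm (1 - a) \<le> 1"
  obtains b where "star b = b" "b * b = a" "norm (1 - b) \<le> 1"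
    "\<And>c. c * a = a * c \<Longrightarrow> c * b = b * c"
proof -
  let ?u = "1 - a"
  obtain Y where Y: "sqrt_iter ?u \<longlonglongrightarrow> Y"
    using sqrt_iter_convergent[OF assms(2)] by (auto simp: convergent_def)
  have "(\<lambda>n. sqrt_iter ?u (Suc n)) \<longlonglongrightarrow> (1/2) *\<^sub>R (?u + Y * Y)"
    unfolding sqrt_iter.simps by (intro tendsto_intros Y)
  then have "Y = (1/2) *\<^sub>R (?u + Y * Y)"
    using LIMSEQ_Suc[OF Y] LIMSEQ_unique by blast
  then have "2 *\<^sub>R Y = 2 *\<^sub>R ((1/2) *\<^sub>R (?u + Y * Y))" by (rule arg_cong)
  then have sq: "(1 - Y) * (1 - Y) = a" by (simp add: algebra_simps scaleR_2)
  have st: "star (sqrt_iter ?u n) = sqrt_iter ?u n" for n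
    by (induction n) (simp_all add: star_add star_scaleR star_mult star_diff assms(1))
  then have "star Y = Y" using tendsto_star[OF Y] Y LIMSEQ_unique by (simp add: st)
  have co: "c * Y = Y * c" if "c * a = a * c" for c
  proof -
    have n: "c * sqrt_iter ?u n = sqrt_iter ?u n * c" for n
    proof (induction n)
      case (Suc n)
      have "c * (sqrt_iter ?u n * sqrt_iter ?u n) = sqrt_iter ?u n * sqrt_iter ?u n * c"
        by (metis Suc mult.assoc)
      then show ?case by (simp add: algebra_simps that)
    qed simp
    have "(\<lambda>n. c * sqrt_iter ?u n) \<longlonglongrightarrow> c * Y" "(\<lambda>n. sqrt_iter ?u n * c) \<longlonglongrightarrow> Y * c"
      by (intro tendsto_intros Y)+
    then show ?thesis using n LIMSEQ_unique by simp
  qed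
  have "norm Y \<le> 1"
  proof (rule LIMSEQ_le_const2[OF tendsto_norm[OF Y]])
    show "\<exists>N. \<forall>n\<ge>N. norm (sqrt_iter ?u n) \<le> 1"
      using sqrt_iter_bounds(1)[OF assms(2)] sqrt_majorant_bounds(2) order_trans by blast
  qed
  show ?thesis
  proof (rule that[OF _ sq])
    show "star (1 - Y) = 1 - Y" by (simp add: star_diff \<open>star Y = Y\<close>)
    show "norm (1 - (1 - Y)) \<le> 1" using \<open>norm Y \<le> 1\<close> by simp
    show "c * (1 - Y) = (1 - Y) * c" if "c * a = a * c" for c
      using co[OF that] by (simp add: algebra_simps)
  qed
qed

text \<open>If \<open>e, d\<close> are commuting and self-adjoint with \<open>e\<^sup>2 + d\<^sup>2 = t\<close> then \<open>z = e + \<i> d\<close> satisfies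
  \<open>z\<^sup>* z = t\<close>, and \<open>e = (z + z\<^sup>*) / 2\<close>.\<close>

lemma norm_le_of_sum_squares:
  fixes e d :: "'a::{cstar_algebra,real_normed_algebra_1}"
  assumes "star e = e" "star d = d" "e * d = d * e" "e * e + d * d = t *\<^sub>R 1" "0 \<le> t"
  shows "norm (e * e) \<le> t"
proof -
  define z where "z = e + scaleC \<i> d"
  have sz: "star z = e - scaleC \<i> d"
    by (simp add: z_def star_add star_scaleC assms)
  have "star z * z = e * e + d * d"
    unfolding sz by (simp add: z_def algebra_simps mult_scaleC_left mult_scaleC_right scaleC_scaleC
        scaleC_diff_right scaleC_add_right assms(3))
  then have nz: "(norm z)\<^sup>2 = t"
    using cstar_identity[of z] assms(4,5) by simp
  have "2 *\<^sub>R e = z + star z" unfolding sz by (simp add: z_def scaleR_2)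
  then have "2 * norm e \<le> norm z + norm z"
    using norm_triangle_ineq[of z "star z"] by (metis norm_star norm_scaleR abs_numeral)
  then have "(norm e)\<^sup>2 \<le> (norm z)\<^sup>2" by (intro power_mono) auto
  then show ?thesis using nz by (simp add: selfadjoint_square_norm assms(1))
qed

text \<open>For self-adjoint \<open>a\<close> the norm bound places the spectrum in [0, 2t]: this is
  nonnegativity of the spectrum, expressed through the norm alone.\<close>

definition spec_nonneg :: "'a::{cstar_algebra,real_normed_algebra_1} \<Rightarrow> bool" where
  "spec_nonneg a \<longleftrightarrow> star a = a \<and> (\<exists>t\<ge>0. norm (t *\<^sub>R 1 - a) \<le> t)"

lemma spec_nonneg_add:
  assumes "spec_nonneg a" "spec_nonneg b"
  shows "spec_nonneg (a + b)"
proof -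
  obtain s t where "s \<ge> 0" "norm (s *\<^sub>R 1 - a) \<le> s" "t \<ge> 0" "norm (t *\<^sub>R 1 - b) \<le> t"
    using assms by (auto simp: spec_nonneg_def)
  then have "norm ((s + t) *\<^sub>R 1 - (a + b)) \<le> s + t" "s + t \<ge> 0"
    using norm_triangle_ineq[of "s *\<^sub>R 1 - a" "t *\<^sub>R 1 - b"] by (simp_all add: algebra_simps)
  then show ?thesis using assms unfolding spec_nonneg_def by (auto simp: star_add)
qed

lemma spec_nonneg_scaleR:
  assumes "spec_nonneg a" "0 \<le> r"
  shows "spec_nonneg (r *\<^sub>R a)"
proof -
  obtain t where t: "t \<ge> 0" "norm (t *\<^sub>R 1 - a) \<le> t"
    using assms by (auto simp: spec_nonneg_def)
  have "norm ((r * t) *\<^sub>R 1 - r *\<^sub>R a) = r * norm (t *\<^sub>R 1 - a)"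
    using assms(2) by (metis abs_of_nonneg norm_scaleR scaleR_diff_right scaleR_scaleR)
  then have "norm ((r * t) *\<^sub>R 1 - r *\<^sub>R a) \<le> r * t" "r * t \<ge> 0"
    using t assms(2) by (simp_all add: mult_left_mono)
  then show ?thesis using assms unfolding spec_nonneg_def by (auto simp: star_scaleR)
qed

lemma spec_nonneg_sqrt:
  assumes "spec_nonneg a"
  obtains b where "spec_nonneg b" "b * b = a" "\<And>c. c * a = a * c \<Longrightarrow> c * b = b * c"
proof -
  obtain t where t: "t \<ge> 0" "norm (t *\<^sub>R 1 - a) \<le> t" and sa: "star a = a"
    using assms by (auto simp: spec_nonneg_def)
  show ?thesis
  proof (cases "t = 0")
    case True
    then have "a = 0" using t by simp
    then show ?thesis by (intro that[of 0]) (auto simp: spec_nonneg_def)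
  next
    case False
    have "norm (1 - (1/t) *\<^sub>R a) = (1/t) * norm (t *\<^sub>R 1 - a)"
      using False t(1) norm_scaleR[of "1/t" "t *\<^sub>R 1 - a"] by (simp add: scaleR_diff_right)
    also have "\<dots> \<le> 1" using t False by (simp add: divide_simps)
    finally have "norm (1 - (1/t) *\<^sub>R a) \<le> 1" .
    moreover have "star ((1/t) *\<^sub>R a) = (1/t) *\<^sub>R a" by (simp add: star_scaleR sa)
    ultimately obtain c where c: "star c = c" "c * c = (1/t) *\<^sub>R a" "norm (1 - c) \<le> 1"
      "\<And>d. d * ((1/t) *\<^sub>R a) = ((1/t) *\<^sub>R a) * d \<Longrightarrow> d * c = c * d"
      using cstar_sqrt by blast
    have "spec_nonneg c" using c(1,3) unfolding spec_nonneg_def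
      by (intro conjI exI[of _ 1]) simp_all
    show ?thesis
    proof (rule that)
      show "spec_nonneg (sqrt t *\<^sub>R c)"
        using \<open>spec_nonneg c\<close> by (rule spec_nonneg_scaleR) (use t in simp)
      show "(sqrt t *\<^sub>R c) * (sqrt t *\<^sub>R c) = a"
        using t(1) False by (simp add: c(2))
      show "d * (sqrt t *\<^sub>R c) = (sqrt t *\<^sub>R c) * d" if "d * a = a * d" for d
        using c(4)[of d] that by simp
    qed
  qed
qed

text \<open>The bound on \<open>b * b\<close> makes t - b^2 satisfy \<open>spec_nonneg\<close>, with
  radius \<open>t\<close>. Its root c commutes with \<open>b\<close>, and c^2 + b^2 = t, so
  \<open>norm_le_of_sum_squares\<close> bounds c^2 = t - b^2.\<close>

lemma spec_nonneg_square:
  fixes b :: "'a::{cstar_algebra,real_normed_algebra_1}"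
  assumes "star b = b" "norm (b * b) \<le> t"
  shows "norm (t *\<^sub>R 1 - b * b) \<le> t"
proof (cases "t = 0")
  case True
  with assms(2) have "b * b = 0" by simp
  then show ?thesis by (simp add: True)
next
  case False
  then have t: "t > 0" using assms(2) norm_ge_zero[of "b * b"] by linarith
  define a where "a = t *\<^sub>R 1 - b * b"
  have a: "star a = a" by (simp add: a_def star_diff star_scaleR star_mult assms)
  have "spec_nonneg a" unfolding spec_nonneg_def
    using a assms(2) t by (intro conjI exI[of _ t]) (simp_all add: a_def)
  then obtain c where c: "spec_nonneg c" "c * c = a" "\<And>d. d * a = a * d \<Longrightarrow> d * c = c * d"
    using spec_nonneg_sqrt by blast
  have "b * a = a * b" by (simp add: a_def algebra_simps)
  then have "c * b = b * c" by (simp add: c(3))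
  then have "norm (c * c) \<le> t"
    using c(1,2) t by (intro norm_le_of_sum_squares[of c b]) (auto simp: spec_nonneg_def a_def assms)
  then show ?thesis by (simp add: c(2) a_def)
qed

lemma spec_nonneg_square_self: "star b = b \<Longrightarrow> spec_nonneg (b * b)"
  using spec_nonneg_square[of b "norm (b * b)"] unfolding spec_nonneg_def
  by (auto simp: star_mult intro!: exI[of _ "norm (b * b)"])

text \<open>Fixing the radius to be \<open>norm a\<close> removes the existential quantifier and
  leaves a closed condition, as limits require.\<close>

lemma spec_nonneg_iff:
  "spec_nonneg a \<longleftrightarrow> star a = a \<and> norm (norm a *\<^sub>R 1 - a) \<le> norm a"
proof
  assume a: "spec_nonneg a"
  then obtain b where "spec_nonneg b" "b * b = a" using spec_nonneg_sqrt by blast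
  then show "star a = a \<and> norm (norm a *\<^sub>R 1 - a) \<le> norm a"
    using spec_nonneg_square[of b "norm a"] a by (auto simp: spec_nonneg_def)
qed (auto simp: spec_nonneg_def intro: exI[of _ "norm a"])

lemma spec_nonneg_norm_minus:
  "star a = a \<Longrightarrow> norm a \<le> t \<Longrightarrow> spec_nonneg (t *\<^sub>R 1 - a)"
  using order_trans[OF norm_ge_zero[of a]] unfolding spec_nonneg_def
  by (auto simp: star_diff star_scaleR intro!: exI[of _ t])

text \<open>With t the norm of x + y, the element t - x = (t - (x + y)) + y is a sum of two
  nonnegative ones. The roots of \<open>x\<close> and of t - x commute and their squares add up to
  t.\<close>

lemma spec_nonneg_norm_mono:
  assumes "spec_nonneg x" "spec_nonneg y"
  shows "norm x \<le> norm (x + y)"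
proof -
  let ?t = "norm (x + y)"
  have "spec_nonneg (?t *\<^sub>R 1 - (x + y) + y)"
    using assms by (intro spec_nonneg_add spec_nonneg_norm_minus) (auto simp: spec_nonneg_def star_add)
  then have "spec_nonneg (?t *\<^sub>R 1 - x)" by (simp add: algebra_simps)
  then obtain d where d: "spec_nonneg d" "d * d = ?t *\<^sub>R 1 - x"
    "\<And>c. c * (?t *\<^sub>R 1 - x) = (?t *\<^sub>R 1 - x) * c \<Longrightarrow> c * d = d * c"
    using spec_nonneg_sqrt by blast
  obtain e where e: "spec_nonneg e" "e * e = x" using spec_nonneg_sqrt[OF assms(1)] by blast
  have "e * x = x * e" by (simp add: mult.assoc flip: e(2))
  then have "e * d = d * e" by (intro d(3)) (simp add: algebra_simps)
  then have "norm (e * e) \<le> ?t"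
    using d(1,2) e by (intro norm_le_of_sum_squares[of e d]) (auto simp: spec_nonneg_def)
  then show ?thesis by (simp add: e(2))
qed

lemma spec_nonneg_antisym:
  assumes "spec_nonneg x" "spec_nonneg (- x)"
  shows "x = 0"
  using spec_nonneg_norm_mono[OF assms] by simp

text \<open>With \<open>e\<^sup>2 = - c\<^sup>* c\<close> and \<open>f = c e\<close>, both \<open>f\<^sup>* f\<close> and \<open>f f\<^sup>*\<close> are negatives of squares, whereas
  \<open>f\<^sup>* f + f f\<^sup>*\<close> is half of a sum of two squares.\<close>

lemma star_mult_self_not_negative:
  assumes "spec_nonneg (- (star c * c))"
  shows "c = 0"
proof -
  obtain e where e: "spec_nonneg e" "e * e = - (star c * c)"
    using spec_nonneg_sqrt[OF assms] by blast
  have se: "star e = e" using e(1) by (simp add: spec_nonneg_def)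
  define f where "f = c * e"
  define q where "q = star c * c"
  define r where "r = c * star c"
  have sq: "star q = q" "star r = r" by (simp_all add: q_def r_def star_mult star_star)
  have "star f * f = e * (star c * c) * e"
    by (simp add: f_def star_mult se mult.assoc)
  also have "\<dots> = - (e * (e * e) * e)" by (simp add: e(2))
  also have "\<dots> = - (q * q)" by (metis e(2) q_def minus_mult_minus mult.assoc)
  finally have f1: "star f * f = - (q * q)" .
  have "f * star f = c * (e * e) * star c"
    by (simp add: f_def star_mult se mult.assoc)
  also have "\<dots> = - (r * r)" by (simp add: e(2) r_def mult.assoc)
  finally have f2: "f * star f = - (r * r)" .
  define h where "h = f + star f"
  define k where "k = scaleC \<i> (f - star f)"
  have "star h = h" by (simp add: h_def star_add star_star)
  moreover have "star k = k"
    by (simp add: k_def star_diff star_star star_scaleC scaleC_diff_right)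
  ultimately have "spec_nonneg (h * h + k * k)"
    by (intro spec_nonneg_add spec_nonneg_square_self)
  also have "h * h + k * k = 2 *\<^sub>R (star f * f + f * star f)"
    by (simp add: h_def k_def mult_scaleC_left mult_scaleC_right scaleC_scaleC
        scaleC_diff_right scaleC_add_right scaleR_2 algebra_simps)
  finally have "spec_nonneg ((1/2) *\<^sub>R (2 *\<^sub>R (star f * f + f * star f)))"
    by (rule spec_nonneg_scaleR) simp
  then have "spec_nonneg (- (q * q + r * r))" by (simp add: f1 f2)
  moreover have "spec_nonneg (q * q + r * r)"
    by (intro spec_nonneg_add spec_nonneg_square_self sq)
  ultimately have "q * q + r * r = 0" by (intro spec_nonneg_antisym)
  then have "norm (q * q) \<le> 0"
    using spec_nonneg_norm_mono[OF spec_nonneg_square_self spec_nonneg_square_self, OF sq] by simp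
  then have "star q * q = 0" by (simp add: sq)
  then show ?thesis by (simp add: q_def)
qed

text \<open>Here \<open>g\<close> is the absolute value of \<open>a\<close> and \<open>m\<close> its
  negative part, so \<open>m * (g + a) = 0\<close>. The cube is used because its positivity is
  elementary: with \<open>r\<close> a root of \<open>g\<close>, it is the square of the self-adjoint
  \<open>m * r\<close>. The last clause turns positivity of the compression \<open>m * a * m\<close>
  into positivity of \<open>a\<close>, since that compression is minus the cube.\<close>

lemma negative_part:
  fixes a :: "'a::{cstar_algebra,real_normed_algebra_1}"
  assumes a: "star a = a"
  obtains g m where "g * g = a * a" "m = (1/2) *\<^sub>R (g - a)" "star m = m"
    "m * a * m = - (m * m * m)" "spec_nonneg (m * m * m)" "m * m * m = 0 \<Longrightarrow> spec_nonneg a"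
proof -
  obtain g where g: "spec_nonneg g" "g * g = a * a" "\<And>c. c * (a * a) = (a * a) * c \<Longrightarrow> c * g = g * c"
    using spec_nonneg_sqrt[OF spec_nonneg_square_self[OF a]] by blast
  have ag: "a * g = g * a" by (simp add: g(3) mult.assoc)
  have sg: "star g = g" using g(1) by (simp add: spec_nonneg_def)
  define m where "m = (1/2) *\<^sub>R (g - a)"
  have sm: "star m = m" by (simp add: m_def star_scaleR star_diff sg a)
  have "m * (g + a) = 0" by (simp add: m_def algebra_simps ag g(2))
  then have mg: "m * g = - (m * a)" by (simp add: distrib_left eq_neg_iff_add_eq_0)
  have "2 *\<^sub>R m = g - a" by (simp add: m_def)
  then have "2 *\<^sub>R (m * m) = m * g - m * a"
    by (metis mult_scaleR_right right_diff_distrib)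
  then have "2 *\<^sub>R (m * m) = 2 *\<^sub>R (m * g)" by (simp add: mg scaleR_2)
  then have mm: "m * m = m * g" by simp
  obtain r where r: "spec_nonneg r" "r * r = g" "\<And>c. c * g = g * c \<Longrightarrow> c * r = r * c"
    using spec_nonneg_sqrt[OF g(1)] by blast
  have "m * g = g * m" by (simp add: m_def algebra_simps ag)
  then have mr: "m * r = r * m" by (rule r(3))
  have sr: "star r = r" using r(1) by (simp add: spec_nonneg_def)
  have "m * m * m = m * r * (m * r)" by (metis mm r(2) mr mult.assoc)
  then have pm: "spec_nonneg (m * m * m)"
    using spec_nonneg_square_self[of "m * r"] by (simp add: star_mult sm sr mr)
  have ma: "m * a * m = - (m * m * m)" using mm mg by simp
  show ?thesis
  proof (rule that[OF g(2) m_def sm ma pm])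
    assume "m * m * m = 0"
    then have "star (m * m) * (m * m) = 0" by (simp add: star_mult sm flip: mult.assoc)
    then have "m * m = 0" by (simp only: star_mult_self_eq_0)
    then have "star m * m = 0" by (simp only: sm)
    then have "m = 0" by (simp only: star_mult_self_eq_0)
    then have "a = g" by (simp add: m_def)
    then show "spec_nonneg a" using g(1) by simp
  qed
qed

text \<open>For \<open>a = star b * b\<close> with negative part \<open>m\<close>, the element
  \<open>star (b * m) * (b * m)\<close> is minus a nonnegative cube. Then \<open>b * m\<close>
  vanishes by \<open>star_mult_self_not_negative\<close>, and the cube with it.\<close>

theorem cstar_nonneg_iff_spec:
  fixes a :: "'a::{cstar_algebra,real_normed_algebra_1}"
  shows "cstar_nonneg a \<longleftrightarrow> spec_nonneg a"
proof
  assume "spec_nonneg a"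
  then obtain b where "spec_nonneg b" "b * b = a" using spec_nonneg_sqrt by blast
  then show "cstar_nonneg a"
    unfolding cstar_nonneg_def by (intro exI[of _ b]) (simp add: spec_nonneg_def)
next
  assume "cstar_nonneg a"
  then obtain b where b: "a = star b * b" by (auto simp: cstar_nonneg_def)
  have "star a = a" by (simp add: b star_mult star_star)
  then obtain g m where "g * g = a * a" "m = (1/2) *\<^sub>R (g - a)" and m: "star m = m"
    "m * a * m = - (m * m * m)" "spec_nonneg (m * m * m)" "m * m * m = 0 \<Longrightarrow> spec_nonneg a"
    by (rule negative_part) blast
  have "star (b * m) * (b * m) = m * a * m" by (simp add: b star_mult m(1) mult.assoc)
  then have eq: "star (b * m) * (b * m) = - (m * m * m)" by (simp add: m(2))
  then have "b * m = 0" using m(3) by (intro star_mult_self_not_negative) simp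
  then have "m * m * m = 0" using eq by simp
  then show "spec_nonneg a" by (rule m(4))
qed

section \<open>Transfer of positivity to algebras without unit\<close>

definition emb :: "'a::cstar_algebra \<Rightarrow> 'a unitized" where
  "emb a = Unitized a 0"

lemma emb_sel [simp]: "alg (emb a) = a" "scal (emb a) = 0"
  by (simp_all add: emb_def)

lemma unitized_eqI: "alg u = alg v \<Longrightarrow> scal u = scal v \<Longrightarrow> u = v"
  by (rule unitized.expand) simp

lemma emb_alg: "scal u = 0 \<Longrightarrow> emb (alg u) = u"
  by (rule unitized_eqI) simp_all

lemma emb_simps:
  "emb 0 = 0" "emb (a + b) = emb a + emb b" "emb (a - b) = emb a - emb b" "emb (- a) = - emb a"
  "emb (a * b) = emb a * emb b" "emb (star a) = star (emb a)" "emb (r *\<^sub>R a) = r *\<^sub>R emb a"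
  "emb (scaleC c a) = scaleC c (emb a)"
  by (auto intro!: unitized_eqI simp: alg_mult)

lemma norm_emb [simp]: "norm (emb a) = norm a"
  using norm_unitized_le[of "emb a"] norm_alg_le[of "emb a"] onorm_le_norm_unitized[of "emb a"]
  by simp

lemma bounded_linear_emb: "bounded_linear emb"
  by (rule bounded_linear_intro[where K=1]) (simp_all add: emb_simps)

text \<open>If \<open>star u * u\<close> has scalar part 0, so has \<open>u\<close>: a witness in
  the unitization already lies in the algebra.\<close>

lemma cstar_nonneg_emb: "cstar_nonneg (emb a) \<longleftrightarrow> cstar_nonneg a"
proof
  assume "cstar_nonneg (emb a)"
  then obtain u where u: "emb a = star u * u" by (auto simp: cstar_nonneg_def)
  then have "scal (star u * u) = 0" by (metis emb_sel(2))
  then have "scal u = 0" by simp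
  then have "a = star (alg u) * alg u" using arg_cong[OF u, of alg] by (simp add: alg_mult)
  then show "cstar_nonneg a" by (auto simp: cstar_nonneg_def)
next
  assume "cstar_nonneg a"
  then show "cstar_nonneg (emb a)"
    unfolding cstar_nonneg_def by (auto simp: emb_simps)
qed

lemma cstar_nonneg_iff_spec_emb: "cstar_nonneg a \<longleftrightarrow> spec_nonneg (emb a)"
  by (simp add: cstar_nonneg_emb flip: cstar_nonneg_iff_spec)

lemma cstar_nonneg_star: "cstar_nonneg a \<Longrightarrow> star a = a"
  by (auto simp: cstar_nonneg_def star_mult star_star)

lemma cstar_nonneg_star_mult_self [simp]: "cstar_nonneg (star a * a)"
  by (auto simp: cstar_nonneg_def)

lemma cstar_nonneg_0 [simp]: "cstar_nonneg 0"
  unfolding cstar_nonneg_def by (rule exI[of _ 0]) simp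

lemma cstar_nonneg_add: "cstar_nonneg a \<Longrightarrow> cstar_nonneg b \<Longrightarrow> cstar_nonneg (a + b)"
  by (simp add: cstar_nonneg_iff_spec_emb emb_simps spec_nonneg_add)

lemma cstar_nonneg_sum: "(\<And>i. i \<in> A \<Longrightarrow> cstar_nonneg (f i)) \<Longrightarrow> cstar_nonneg (sum f A)"
  by (induction A rule: infinite_finite_induct) (auto intro: cstar_nonneg_add)

lemma cstar_nonneg_scaleR: "cstar_nonneg a \<Longrightarrow> 0 \<le> r \<Longrightarrow> cstar_nonneg (r *\<^sub>R a)"
  by (simp add: cstar_nonneg_iff_spec_emb emb_simps spec_nonneg_scaleR)

lemma cstar_nonneg_norm_mono:
  "cstar_nonneg a \<Longrightarrow> cstar_nonneg b \<Longrightarrow> norm a \<le> norm (a + b)"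
  using spec_nonneg_norm_mono[of "emb a" "emb b"]
  by (simp add: cstar_nonneg_iff_spec_emb flip: emb_simps(2))

lemma cstar_nonneg_norm_le:
  "cstar_nonneg a \<Longrightarrow> cstar_nonneg (b - a) \<Longrightarrow> norm a \<le> norm b"
  using cstar_nonneg_norm_mono[of a "b - a"] by simp

lemma cstar_nonneg_limit:
  fixes f :: "nat \<Rightarrow> 'a::cstar_algebra"
  assumes f: "f \<longlonglongrightarrow> l" and nn: "\<And>n. cstar_nonneg (f n)"
  shows "cstar_nonneg l"
proof -
  have e: "(\<lambda>n. emb (f n)) \<longlonglongrightarrow> emb l"
    by (rule bounded_linear.tendsto[OF bounded_linear_emb f])
  have sp: "star (emb (f n)) = emb (f n)"
    "norm (norm (emb (f n)) *\<^sub>R 1 - emb (f n)) \<le> norm (emb (f n))" for n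
    using nn[of n] unfolding cstar_nonneg_iff_spec_emb spec_nonneg_iff by auto
  have "star (emb l) = emb l"
    using tendsto_star[OF e] e LIMSEQ_unique by (simp add: sp(1))
  moreover have "(\<lambda>n. norm (norm (emb (f n)) *\<^sub>R 1 - emb (f n))) \<longlonglongrightarrow> norm (norm (emb l) *\<^sub>R 1 - emb l)"
    by (intro tendsto_intros e)
  then have "norm (norm (emb l) *\<^sub>R 1 - emb l) \<le> norm (emb l)"
    by (rule LIMSEQ_le[OF _ tendsto_norm[OF e]]) (use sp(2) in blast)
  ultimately show ?thesis by (simp add: cstar_nonneg_iff_spec_emb spec_nonneg_iff)
qed

lemma cstar_nonneg_conj: "cstar_nonneg a \<Longrightarrow> cstar_nonneg (star x * a * x)"
  unfolding cstar_nonneg_def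
  by (elim exE, rule_tac x = "b * x" in exI) (simp add: star_mult mult.assoc)

text \<open>This is the order relation a \<le> \<open>norm a\<close> 1, which holds in the
  unitization, conjugated by \<open>emb x\<close> back into the algebra.\<close>

lemma cstar_nonneg_conj_le:
  assumes "star a = a"
  shows "cstar_nonneg (norm a *\<^sub>R (star x * x) - star x * a * x)"
proof -
  have "cstar_nonneg (norm a *\<^sub>R 1 - emb a)"
    unfolding cstar_nonneg_iff_spec
    by (intro spec_nonneg_norm_minus) (simp_all add: assms flip: emb_simps(6))
  from cstar_nonneg_conj[OF this, of "emb x"] show ?thesis
    by (subst cstar_nonneg_emb[symmetric]) (simp add: algebra_simps emb_simps)
qed

text \<open>Serves to pass from coefficients in \<C> to coefficients in its unitization. Compressing
  by the skew part \<open>Z\<close> of \<open>X\<close> gives Z^3 = 0, so \<open>X\<close> is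
  self-adjoint; compressing by the negative part of \<open>X\<close> then makes the cube of that
  part both nonnegative and nonpositive.\<close>

lemma cstar_nonneg_of_compressions:
  fixes X :: "'a::cstar_algebra"
  assumes "\<And>u. cstar_nonneg (star u * X * u)"
  shows "cstar_nonneg X"
proof -
  define Z where "Z = X - star X"
  have sZ: "star Z = - Z" by (simp add: Z_def star_diff star_star)
  have "star Z * X * Z = star Z * star X * Z"
    using cstar_nonneg_star[OF assms, of Z] by (simp add: star_mult star_star mult.assoc)
  then have "star Z * (X - star X) * Z = 0"
    by (simp add: right_diff_distrib left_diff_distrib)
  then have "star Z * Z * Z = 0" by (simp only: Z_def[symmetric])
  then have "Z * Z * Z = 0" by (simp add: sZ)
  then have "star (Z * Z) * (Z * Z) = 0" by (simp add: star_mult sZ flip: mult.assoc)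
  then have "Z * Z = 0" by (simp only: star_mult_self_eq_0)
  then have "star Z * Z = 0" by (simp add: sZ)
  then have "Z = 0" by (simp only: star_mult_self_eq_0)
  then have "star X = X" by (simp add: Z_def)
  then have "star (emb X) = emb X" by (simp flip: emb_simps(6))
  then obtain g m where m: "g * g = emb X * emb X"
    "m = (1/2) *\<^sub>R (g - emb X)" "star m = m" "m * emb X * m = - (m * m * m)"
    "spec_nonneg (m * m * m)" "m * m * m = 0 \<Longrightarrow> spec_nonneg (emb X)"
    by (rule negative_part) blast
  \<comment> \<open>Only elements of the algebra are admissible compressions. The absolute value
    \<open>g\<close> comes from the unitization, but its square is that of \<open>emb X\<close>, so
    neither \<open>g\<close> nor \<open>m\<close> has a scalar part.\<close>
  have "scal (g * g) = 0" by (simp add: m(1))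
  then have "scal m = 0" by (simp add: m(2))
  then have "emb (alg m) = m" by (rule emb_alg)
  then have "spec_nonneg (m * emb X * m)"
    using assms[of "alg m"] \<open>emb (alg m) = m\<close> m(3)
    by (simp add: cstar_nonneg_iff_spec_emb emb_simps)
  then have "m * m * m = 0" using m(4,5) by (intro spec_nonneg_antisym) simp_all
  then show ?thesis using m(6) by (simp add: cstar_nonneg_iff_spec_emb)
qed

section \<open>Semi-inner product modules\<close>

text \<open>Only the form is axiomatized: identities between module elements are replaced throughout by
  equality of the values of the form. Hilbert modules, finite sums of elementary tensors and the
  formal sums in the construction of a correspondence from a kernel are all instances.\<close>

locale semi_inner =
  fixes V :: "'v set" and add :: "'v \<Rightarrow> 'v \<Rightarrow> 'v" and smul :: "complex \<Rightarrow> 'v \<Rightarrow> 'v"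
    and act :: "'v \<Rightarrow> 'c::cstar_algebra \<Rightarrow> 'v" and form :: "'v \<Rightarrow> 'v \<Rightarrow> 'c"
  assumes add_in [simp]: "x \<in> V \<Longrightarrow> y \<in> V \<Longrightarrow> add x y \<in> V"
    and smul_in [simp]: "x \<in> V \<Longrightarrow> smul k x \<in> V"
    and act_in [simp]: "x \<in> V \<Longrightarrow> act x b \<in> V"
    and form_add: "x \<in> V \<Longrightarrow> y \<in> V \<Longrightarrow> z \<in> V \<Longrightarrow> form x (add y z) = form x y + form x z"
    and form_smul: "x \<in> V \<Longrightarrow> y \<in> V \<Longrightarrow> form x (smul k y) = scaleC k (form x y)"
    and form_act: "x \<in> V \<Longrightarrow> y \<in> V \<Longrightarrow> form x (act y b) = form x y * b"
    and form_star: "x \<in> V \<Longrightarrow> y \<in> V \<Longrightarrow> star (form x y) = form y x"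
    and form_nonneg: "x \<in> V \<Longrightarrow> cstar_nonneg (form x x)"
begin

lemma form_add_left: "x \<in> V \<Longrightarrow> y \<in> V \<Longrightarrow> z \<in> V \<Longrightarrow> form (add x y) z = form x z + form y z"
  using form_add[of z x y] form_star by (metis add_in star_add)

lemma form_smul_left: "x \<in> V \<Longrightarrow> y \<in> V \<Longrightarrow> form (smul k x) y = scaleC (cnj k) (form x y)"
  using form_smul[of y x k] form_star by (metis smul_in star_scaleC)

lemma form_act_left: "x \<in> V \<Longrightarrow> y \<in> V \<Longrightarrow> form (act x b) y = star b * form x y"
  using form_act[of y x b] form_star by (metis act_in star_mult)

lemmas form_simps = form_add form_add_left form_smul form_smul_left form_act form_act_left

definition diff where "diff x y = add x (smul (- 1) y)"
definition nrm where "nrm x = sqrt (norm (form x x))"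
definition ds where "ds x y = nrm (diff x y)"

lemma diff_in [simp]: "x \<in> V \<Longrightarrow> y \<in> V \<Longrightarrow> diff x y \<in> V"
  by (simp add: diff_def)

lemma form_diff: "x \<in> V \<Longrightarrow> y \<in> V \<Longrightarrow> z \<in> V \<Longrightarrow> form x (diff y z) = form x y - form x z"
  by (simp add: diff_def form_simps)

lemma form_diff_left: "x \<in> V \<Longrightarrow> y \<in> V \<Longrightarrow> z \<in> V \<Longrightarrow> form (diff x y) z = form x z - form y z"
  by (simp add: diff_def form_simps)

lemma nrm_nonneg [simp]: "0 \<le> nrm x" by (simp add: nrm_def)
lemma ds_nonneg [simp]: "0 \<le> ds x y" by (simp add: ds_def)
lemma nrm_sq: "(nrm x)\<^sup>2 = norm (form x x)" by (simp add: nrm_def)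

text \<open>Positivity of the form at t y - x b with b = \<open>form x y\<close>, where the term
  \<open>star b * form x x * b\<close> is at most t \<open>star b * b\<close>; dividing by t gives
  the claim with t in place of the norm of \<open>form x x\<close>.\<close>

lemma cauchy_schwarz_order:
  assumes "x \<in> V" "y \<in> V"
  shows "cstar_nonneg (norm (form x x) *\<^sub>R form y y - form y x * form x y)"
proof -
  let ?a = "form x x" and ?b = "form x y"
  have sb: "star ?b = form y x" by (simp add: form_star assms)
  have pos: "cstar_nonneg (t *\<^sub>R form y y - form y x * ?b)" if t: "0 < t" "norm ?a \<le> t" for t
  proof -
    let ?w = "diff (smul (complex_of_real t) y) (act x ?b)"
    have "cstar_nonneg (form ?w ?w)" by (simp add: form_nonneg assms)
    moreover have "form ?w ?w = (t * t) *\<^sub>R form y y - (2 * t) *\<^sub>R (star ?b * ?b) + star ?b * ?a * ?b"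
      using assms
      by (simp add: form_diff form_diff_left form_simps scaleC_of_real sb scaleR_diff_right
          algebra_simps flip: scaleR_2)
    moreover have "cstar_nonneg (norm ?a *\<^sub>R (star ?b * ?b) - star ?b * ?a * ?b)"
      by (rule cstar_nonneg_conj_le) (simp add: form_star assms)
    moreover have "cstar_nonneg ((t - norm ?a) *\<^sub>R (star ?b * ?b))"
      using t by (intro cstar_nonneg_scaleR) simp_all
    ultimately have "cstar_nonneg ((t * t) *\<^sub>R form y y - (2 * t) *\<^sub>R (star ?b * ?b) + star ?b * ?a * ?b
        + (norm ?a *\<^sub>R (star ?b * ?b) - star ?b * ?a * ?b) + (t - norm ?a) *\<^sub>R (star ?b * ?b))"
      by (metis cstar_nonneg_add)
    then have "cstar_nonneg ((t * t) *\<^sub>R form y y - t *\<^sub>R (star ?b * ?b))"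
      using scaleR_left_distrib[of t t "star ?b * ?b"]
      by (simp add: scaleR_diff_left flip: mult_2)
    then have "cstar_nonneg ((1/t) *\<^sub>R ((t * t) *\<^sub>R form y y - t *\<^sub>R (star ?b * ?b)))"
      using t by (intro cstar_nonneg_scaleR) simp_all
    then show ?thesis using t by (simp add: scaleR_diff_right sb)
  qed
  \<comment> \<open>The division needs t > 0; letting t decrease to the norm of
    \<open>form x x\<close> covers a null vector \<open>x\<close> as well.\<close>
  have "(\<lambda>n. norm ?a + inverse (real (Suc n))) \<longlonglongrightarrow> norm ?a + 0"
    by (intro tendsto_intros LIMSEQ_inverse_real_of_nat)
  then have "(\<lambda>n. (norm ?a + inverse (real (Suc n))) *\<^sub>R form y y - form y x * ?b)
      \<longlonglongrightarrow> norm ?a *\<^sub>R form y y - form y x * ?b"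
    by (intro tendsto_intros) simp
  then show ?thesis
    by (rule cstar_nonneg_limit) (intro pos, simp_all add: add_nonneg_pos)
qed

lemma cauchy_schwarz:
  assumes "x \<in> V" "y \<in> V"
  shows "norm (form x y) \<le> nrm x * nrm y"
proof -
  have "norm (form y x * form x y) \<le> norm (norm (form x x) *\<^sub>R form y y)"
    by (rule cstar_nonneg_norm_le[OF _ cauchy_schwarz_order[OF assms]])
      (simp add: assms flip: form_star[of x y])
  then have "(norm (form x y))\<^sup>2 \<le> norm (form x x) * norm (form y y)"
    by (simp add: assms cstar_identity flip: form_star[of x y])
  then have "(norm (form x y))\<^sup>2 \<le> (nrm x * nrm y)\<^sup>2" by (simp add: power_mult_distrib nrm_sq)
  then show ?thesis by (rule power2_le_imp_le) simp
qed

lemma nrm_add_le: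
  assumes "x \<in> V" "y \<in> V"
  shows "nrm (add x y) \<le> nrm x + nrm y"
proof (rule power2_le_imp_le)
  have "(nrm (add x y))\<^sup>2 = norm (form x x + form x y + (form y x + form y y))"
    by (simp add: nrm_sq form_simps assms algebra_simps)
  also have "\<dots> \<le> (nrm x * nrm x + nrm x * nrm y) + (nrm y * nrm x + nrm y * nrm y)"
    by (intro norm_triangle_le add_mono cauchy_schwarz assms)
  finally show "(nrm (add x y))\<^sup>2 \<le> (nrm x + nrm y)\<^sup>2" by (simp add: power2_eq_square algebra_simps)
qed simp

lemma nrm_smul: "x \<in> V \<Longrightarrow> nrm (smul k x) = cmod k * nrm x"
  by (simp add: nrm_def form_simps norm_scaleC real_sqrt_mult flip: mult.assoc)

lemma nrm_act_le:
  assumes "x \<in> V"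
  shows "nrm (act x b) \<le> nrm x * norm b"
proof (rule power2_le_imp_le)
  have "norm (star b * (form x x * b)) \<le> norm b * (norm (form x x) * norm b)"
    by (intro norm_mult_le) simp_all
  then show "(nrm (act x b))\<^sup>2 \<le> (nrm x * norm b)\<^sup>2"
    using assms by (simp add: nrm_sq form_simps power_mult_distrib) (simp add: power2_eq_square mult_ac)
qed simp

lemma nrm_cong: "form x x = form y y \<Longrightarrow> nrm x = nrm y" by (simp add: nrm_def)

lemma ds_self [simp]: "x \<in> V \<Longrightarrow> ds x x = 0"
  by (simp add: ds_def nrm_def form_diff form_diff_left)

lemma ds_sym: "x \<in> V \<Longrightarrow> y \<in> V \<Longrightarrow> ds x y = ds y x"
  unfolding ds_def by (rule nrm_cong) (simp add: form_diff form_diff_left)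

lemma ds_triangle:
  assumes "x \<in> V" "y \<in> V" "z \<in> V"
  shows "ds x z \<le> ds x y + ds y z"
proof -
  have "ds x z = nrm (add (diff x y) (diff y z))"
    unfolding ds_def by (rule nrm_cong) (simp add: form_diff form_diff_left form_simps assms)
  then show ?thesis using nrm_add_le[of "diff x y" "diff y z"] assms by (simp add: ds_def)
qed

lemma nrm_le_ds:
  assumes "x \<in> V" "y \<in> V"
  shows "nrm x \<le> nrm y + ds x y"
proof -
  have "nrm x = nrm (add y (diff x y))"
    by (rule nrm_cong) (simp add: form_diff form_diff_left form_simps assms)
  then show ?thesis using nrm_add_le[of y "diff x y"] assms by (simp add: ds_def)
qed

lemma ds_add_le:
  assumes "x \<in> V" "y \<in> V" "x' \<in> V" "y' \<in> V"
  shows "ds (add x y) (add x' y') \<le> ds x x' + ds y y'"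
proof -
  have "ds (add x y) (add x' y') = nrm (add (diff x x') (diff y y'))"
    unfolding ds_def by (rule nrm_cong) (simp add: form_diff form_diff_left form_simps assms)
  then show ?thesis using nrm_add_le[of "diff x x'" "diff y y'"] assms by (simp add: ds_def)
qed

lemma ds_smul:
  assumes "x \<in> V" "y \<in> V"
  shows "ds (smul k x) (smul k y) = cmod k * ds x y"
proof -
  have "ds (smul k x) (smul k y) = nrm (smul k (diff x y))"
    unfolding ds_def
    by (rule nrm_cong) (simp add: form_diff form_diff_left form_simps assms scaleC_diff_right)
  then show ?thesis using assms by (simp add: nrm_smul ds_def)
qed

lemma ds_act_le:
  assumes "x \<in> V" "y \<in> V"
  shows "ds (act x b) (act y b) \<le> ds x y * norm b"
proof -
  have "ds (act x b) (act y b) = nrm (act (diff x y) b)"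
    unfolding ds_def
    by (rule nrm_cong) (simp add: form_diff form_diff_left form_simps assms algebra_simps)
  then show ?thesis using nrm_act_le[of "diff x y" b] assms by (simp add: ds_def)
qed

lemma ds_eq_0:
  assumes "x \<in> V" "y \<in> V" "\<And>w. w \<in> V \<Longrightarrow> form w x = form w y"
  shows "ds x y = 0"
  using assms by (simp add: ds_def nrm_def form_diff)

lemma norm_form_diff_le:
  assumes "x \<in> V" "y \<in> V" "x' \<in> V" "y' \<in> V"
  shows "norm (form x y - form x' y') \<le> nrm x * ds y y' + ds x x' * nrm y'"
proof -
  have "form x y - form x' y' = form x (diff y y') + form (diff x x') y'"
    by (simp add: form_diff form_diff_left assms)
  also have "norm \<dots> \<le> nrm x * ds y y' + ds x x' * nrm y'"
    unfolding ds_def by (intro norm_triangle_le add_mono cauchy_schwarz) (simp_all add: assms)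
  finally show ?thesis .
qed

section \<open>Cauchy sequences and limits of the form\<close>

definition cauchy :: "(nat \<Rightarrow> 'v) \<Rightarrow> bool" where
  "cauchy s \<longleftrightarrow> (\<forall>n. s n \<in> V) \<and> (\<forall>\<epsilon>>0. \<exists>N. \<forall>m\<ge>N. \<forall>n\<ge>N. ds (s m) (s n) < \<epsilon>)"

lemma cauchy_in: "cauchy s \<Longrightarrow> s n \<in> V" by (simp add: cauchy_def)

lemma cauchyD: "cauchy s \<Longrightarrow> \<epsilon> > 0 \<Longrightarrow> \<exists>N. \<forall>m\<ge>N. \<forall>n\<ge>N. ds (s m) (s n) < \<epsilon>"
  by (simp add: cauchy_def)

lemma cauchyI:
  assumes "\<And>n. s n \<in> V" "\<And>\<epsilon>. \<epsilon> > 0 \<Longrightarrow> \<exists>N. \<forall>m\<ge>N. \<forall>n\<ge>N. ds (s m) (s n) < \<epsilon>"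
  shows "cauchy s"
  using assms by (auto simp: cauchy_def)

lemma cauchy_const: "x \<in> V \<Longrightarrow> cauchy (\<lambda>n. x)"
  by (auto simp: cauchy_def)

lemma cauchy_bounded:
  assumes "cauchy s"
  obtains B where "\<And>n. nrm (s n) \<le> B"
proof -
  obtain N where N: "\<forall>m\<ge>N. \<forall>n\<ge>N. ds (s m) (s n) < 1" using cauchyD[OF assms, of 1] by auto
  have "nrm (s n) \<le> Max ((\<lambda>n. nrm (s n)) ` {..N}) + 1" for n
  proof (cases "n \<le> N")
    case True
    then have "nrm (s n) \<le> Max ((\<lambda>n. nrm (s n)) ` {..N})" by (intro Max_ge) auto
    then show ?thesis by simp
  next
    case False
    then have "nrm (s n) \<le> nrm (s N) + 1"
      using nrm_le_ds[of "s n" "s N"] N[rule_format, of n N] cauchy_in[OF assms] by fastforce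
    moreover have "nrm (s N) \<le> Max ((\<lambda>n. nrm (s n)) ` {..N})" by (intro Max_ge) auto
    ultimately show ?thesis by linarith
  qed
  then show ?thesis using that by blast
qed

lemma cauchy_close:
  assumes "cauchy s" "\<And>n. t n \<in> V" "(\<lambda>n. ds (s n) (t n)) \<longlonglongrightarrow> 0"
  shows "cauchy t"
proof (rule cauchyI)
  fix \<epsilon> :: real assume e: "\<epsilon> > 0"
  obtain N where N: "\<forall>m\<ge>N. \<forall>n\<ge>N. ds (s m) (s n) < \<epsilon>/3" using cauchyD[OF assms(1), of "\<epsilon>/3"] e by auto
  obtain N' where N': "\<forall>n\<ge>N'. ds (s n) (t n) < \<epsilon>/3"
    using LIMSEQ_D[OF assms(3), of "\<epsilon>/3"] e by auto
  have "ds (t m) (t n) < \<epsilon>" if "m \<ge> max N N'" "n \<ge> max N N'" for m n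
  proof -
    have "ds (t m) (t n) \<le> ds (t m) (s m) + (ds (s m) (s n) + ds (s n) (t n))"
      using ds_triangle[of "t m" "s m" "t n"] ds_triangle[of "s m" "s n" "t n"]
        cauchy_in[OF assms(1)] assms(2) by fastforce
    moreover have "ds (t m) (s m) = ds (s m) (t m)"
      by (rule ds_sym) (simp_all add: cauchy_in[OF assms(1)] assms(2))
    ultimately show ?thesis
      using that N[rule_format, of m n] N'[rule_format, of m] N'[rule_format, of n] by simp
  qed
  then show "\<exists>N. \<forall>m\<ge>N. \<forall>n\<ge>N. ds (t m) (t n) < \<epsilon>" by blast
qed (rule assms)

lemma cauchy_add:
  assumes "cauchy s" "cauchy t"
  shows "cauchy (\<lambda>n. add (s n) (t n))"
proof (rule cauchyI)
  fix \<epsilon> :: real assume e: "\<epsilon> > 0"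
  obtain N where N: "\<forall>m\<ge>N. \<forall>n\<ge>N. ds (s m) (s n) < \<epsilon>/2" using cauchyD[OF assms(1), of "\<epsilon>/2"] e by auto
  obtain N' where N': "\<forall>m\<ge>N'. \<forall>n\<ge>N'. ds (t m) (t n) < \<epsilon>/2" using cauchyD[OF assms(2), of "\<epsilon>/2"] e by auto
  have "ds (add (s m) (t m)) (add (s n) (t n)) < \<epsilon>" if "m \<ge> max N N'" "n \<ge> max N N'" for m n
    using ds_add_le[of "s m" "t m" "s n" "t n"] N[rule_format, of m n] N'[rule_format, of m n] that
      cauchy_in[OF assms(1)] cauchy_in[OF assms(2)] by fastforce
  then show "\<exists>N. \<forall>m\<ge>N. \<forall>n\<ge>N. ds (add (s m) (t m)) (add (s n) (t n)) < \<epsilon>" by blast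
qed (simp_all add: cauchy_in assms)

lemma cauchy_lipschitz:
  assumes "cauchy s" "\<And>x. x \<in> V \<Longrightarrow> T x \<in> V"
    and T: "\<And>x y. x \<in> V \<Longrightarrow> y \<in> V \<Longrightarrow> ds (T x) (T y) \<le> ds x y * C"
  shows "cauchy (\<lambda>n. T (s n))"
proof (rule cauchyI)
  fix \<epsilon> :: real assume e: "\<epsilon> > 0"
  obtain N where N: "\<forall>m\<ge>N. \<forall>n\<ge>N. ds (s m) (s n) < \<epsilon> / (\<bar>C\<bar> + 1)"
    using cauchyD[OF assms(1), of "\<epsilon> / (\<bar>C\<bar> + 1)"] e by auto
  have "ds (T (s m)) (T (s n)) < \<epsilon>" if "m \<ge> N" "n \<ge> N" for m n
  proof -
    have "ds (T (s m)) (T (s n)) \<le> ds (s m) (s n) * (\<bar>C\<bar> + 1)"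
      by (rule order_trans[OF T mult_left_mono]) (simp_all add: cauchy_in[OF assms(1)])
    also have "\<dots> < \<epsilon>" using N[rule_format, OF that] by (simp add: pos_less_divide_eq)
    finally show ?thesis .
  qed
  then show "\<exists>N. \<forall>m\<ge>N. \<forall>n\<ge>N. ds (T (s m)) (T (s n)) < \<epsilon>" by blast
qed (simp_all add: cauchy_in assms)

lemma cauchy_smul: "cauchy s \<Longrightarrow> cauchy (\<lambda>n. smul k (s n))"
  by (rule cauchy_lipschitz[where C="cmod k"]) (simp_all add: ds_smul mult.commute)

lemma cauchy_act: "cauchy s \<Longrightarrow> cauchy (\<lambda>n. act (s n) b)"
  by (rule cauchy_lipschitz[where C="norm b"]) (simp_all add: ds_act_le)

lemma cauchy_diff: "cauchy s \<Longrightarrow> cauchy t \<Longrightarrow> cauchy (\<lambda>n. diff (s n) (t n))"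
  unfolding diff_def by (intro cauchy_add cauchy_smul)

lemma form_limit_cong:
  assumes s: "cauchy s" and s': "cauchy s'" and t: "cauchy t" and t': "cauchy t'"
    and ss: "(\<lambda>n. ds (s n) (s' n)) \<longlonglongrightarrow> 0" and tt: "(\<lambda>n. ds (t n) (t' n)) \<longlonglongrightarrow> 0"
    and l: "(\<lambda>n. form (s n) (t n)) \<longlonglongrightarrow> l"
  shows "(\<lambda>n. form (s' n) (t' n)) \<longlonglongrightarrow> l"
proof -
  obtain A where A: "\<And>n. nrm (s n) \<le> A" using cauchy_bounded[OF s] by blast
  obtain B where B: "\<And>n. nrm (t' n) \<le> B" using cauchy_bounded[OF t'] by blast
  have "(\<lambda>n. A * ds (t n) (t' n) + ds (s n) (s' n) * B) \<longlonglongrightarrow> A * 0 + 0 * B"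
    by (intro tendsto_intros ss tt)
  then have "(\<lambda>n. A * ds (t n) (t' n) + ds (s n) (s' n) * B) \<longlonglongrightarrow> 0" by simp
  then have "(\<lambda>n. form (s n) (t n) - form (s' n) (t' n)) \<longlonglongrightarrow> 0"
  proof (rule tendsto_0_le[where K=1], intro always_eventually allI)
    fix n
    have "norm (form (s n) (t n) - form (s' n) (t' n)) \<le> nrm (s n) * ds (t n) (t' n) + ds (s n) (s' n) * nrm (t' n)"
      by (rule norm_form_diff_le) (simp_all add: cauchy_in s s' t t')
    also have "\<dots> \<le> A * ds (t n) (t' n) + ds (s n) (s' n) * B"
      by (intro add_mono mult_mono) (simp_all add: A B order_trans[OF nrm_nonneg A])
    finally show "norm (form (s n) (t n) - form (s' n) (t' n)) \<le> norm (A * ds (t n) (t' n) + ds (s n) (s' n) * B) * 1"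
      by simp
  qed
  from tendsto_diff[OF l this] show ?thesis by simp
qed

lemma form_convergent:
  assumes s: "cauchy s" and t: "cauchy t"
  shows "convergent (\<lambda>n. form (s n) (t n))"
proof -
  obtain A where A: "\<And>n. nrm (s n) \<le> A" using cauchy_bounded[OF s] by blast
  obtain B where B: "\<And>n. nrm (t n) \<le> B" using cauchy_bounded[OF t] by blast
  have pos: "A + B + 1 > 0"
    using order_trans[OF nrm_nonneg A] order_trans[OF nrm_nonneg B] by simp
  have "Cauchy (\<lambda>n. form (s n) (t n))"
  proof (rule CauchyI)
    fix e :: real assume e: "e > 0"
    then have e': "e / (A + B + 1) > 0" using pos by simp
    obtain N where N: "\<forall>m\<ge>N. \<forall>n\<ge>N. ds (s m) (s n) < e / (A + B + 1)" using cauchyD[OF s e'] by auto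
    obtain N' where N': "\<forall>m\<ge>N'. \<forall>n\<ge>N'. ds (t m) (t n) < e / (A + B + 1)" using cauchyD[OF t e'] by auto
    have "norm (form (s m) (t m) - form (s n) (t n)) < e" if "m \<ge> max N N'" "n \<ge> max N N'" for m n
    proof -
      have "norm (form (s m) (t m) - form (s n) (t n)) \<le> nrm (s m) * ds (t m) (t n) + ds (s m) (s n) * nrm (t n)"
        by (rule norm_form_diff_le) (simp_all add: cauchy_in s t)
      also have "\<dots> \<le> A * (e / (A + B + 1)) + (e / (A + B + 1)) * B"
        using N[rule_format, of m n] N'[rule_format, of m n] that e'
        by (intro add_mono mult_mono) (simp_all add: A B order_trans[OF nrm_nonneg A])
      also have "\<dots> < (A + B + 1) * (e / (A + B + 1))"
        using e' by (simp only: distrib_right mult.commute[of B])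
      also have "\<dots> = e" using pos by simp
      finally show ?thesis .
    qed
    then show "\<exists>M. \<forall>m\<ge>M. \<forall>n\<ge>M. norm (form (s m) (t m) - form (s n) (t n)) < e" by blast
  qed
  then show ?thesis by (rule Cauchy_convergent)
qed

lemma ds_limit_trans:
  assumes "cauchy s" "cauchy t" "cauchy u"
    "(\<lambda>n. ds (s n) (t n)) \<longlonglongrightarrow> 0" "(\<lambda>n. ds (t n) (u n)) \<longlonglongrightarrow> 0"
  shows "(\<lambda>n. ds (s n) (u n)) \<longlonglongrightarrow> 0"
proof (rule tendsto_sandwich[OF _ _ tendsto_const])
  show "(\<lambda>n. ds (s n) (t n) + ds (t n) (u n)) \<longlonglongrightarrow> 0"
    using tendsto_add[OF assms(4,5)] by simp
qed (use assms in \<open>auto intro!: always_eventually ds_triangle cauchy_in\<close>)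

lemma ds_limit_add:
  assumes "cauchy s" "cauchy t" "cauchy s'" "cauchy t'"
    "(\<lambda>n. ds (s n) (s' n)) \<longlonglongrightarrow> 0" "(\<lambda>n. ds (t n) (t' n)) \<longlonglongrightarrow> 0"
  shows "(\<lambda>n. ds (add (s n) (t n)) (add (s' n) (t' n))) \<longlonglongrightarrow> 0"
proof (rule tendsto_sandwich[OF _ _ tendsto_const])
  show "(\<lambda>n. ds (s n) (s' n) + ds (t n) (t' n)) \<longlonglongrightarrow> 0"
    using tendsto_add[OF assms(5,6)] by simp
qed (use assms in \<open>auto intro!: always_eventually ds_add_le cauchy_in\<close>)

lemma ds_limit_smul:
  assumes "cauchy s" "cauchy s'" "(\<lambda>n. ds (s n) (s' n)) \<longlonglongrightarrow> 0"
  shows "(\<lambda>n. ds (smul k (s n)) (smul k (s' n))) \<longlonglongrightarrow> 0"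
  using tendsto_mult_left[OF assms(3), of "cmod k"]
  by (simp add: ds_smul cauchy_in[OF assms(1)] cauchy_in[OF assms(2)])

text \<open>The addition on \<open>V\<close> is not assumed associative or commutative, so a finite
  sum makes sense only as a vector that pairs like one.\<close>

lemma ex_sum:
  assumes "V \<noteq> {}" "finite A" and x: "\<And>i. i \<in> A \<Longrightarrow> x i \<in> V"
  shows "\<exists>v\<in>V. \<forall>w\<in>V. form w v = (\<Sum>i\<in>A. form w (x i))"
  using assms(2) x
proof (induction A)
  case empty
  obtain z where "z \<in> V" using assms(1) by blast
  \<comment> \<open>The structure has no zero vector; 0 times any element pairs like one.\<close>
  then show ?case by (intro bexI[of _ "smul 0 z"]) (simp_all add: form_smul)
next
  case (insert i A)
  then obtain v where "v \<in> V" "\<forall>w\<in>V. form w v = (\<Sum>i\<in>A. form w (x i))" by auto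
  then show ?case using insert
    by (intro bexI[of _ "add (x i) v"]) (simp_all add: form_simps)
qed

lemma sum_form_nonneg:
  assumes x: "\<And>i. i \<in> A \<Longrightarrow> x i \<in> V"
  shows "cstar_nonneg (\<Sum>i\<in>A. \<Sum>j\<in>A. form (x i) (x j))"
proof (cases "finite A \<and> V \<noteq> {}")
  case True
  then obtain v where v: "v \<in> V" "\<And>w. w \<in> V \<Longrightarrow> form w v = (\<Sum>i\<in>A. form w (x i))"
    using ex_sum[where A=A and x=x] x by blast
  have "form v v = (\<Sum>i\<in>A. form v (x i))" by (rule v(2)[OF v(1)])
  also have "\<dots> = (\<Sum>i\<in>A. star (form (x i) v))" using v(1) x by (simp add: form_star)
  also have "\<dots> = (\<Sum>i\<in>A. \<Sum>j\<in>A. form (x j) (x i))" using x by (simp add: v(2) star_sum form_star)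
  also have "\<dots> = (\<Sum>i\<in>A. \<Sum>j\<in>A. form (x i) (x j))" by (rule sum.swap)
  finally show ?thesis using form_nonneg[OF v(1)] by simp
next
  case False
  then have "A = {} \<or> infinite A" using x by auto
  then show ?thesis by auto
qed

end

sublocale hilbert_module \<subseteq> si: semi_inner "car M" "madd M" "mscale M" "mact M" "inn M"
  by unfold_locales (simp_all add: add_closed scale_closed act_closed inn_add inn_scale inn_act
      inn_star inn_nonneg)

context hilbert_module
begin

lemma mdiff_eq: "mdiff M x y = si.diff x y" by (simp add: mdiff_def si.diff_def)
lemma mnorm_eq: "mnorm M x = si.nrm x" by (simp add: mnorm_def si.nrm_def)
lemma mnorm_mdiff_eq: "mnorm M (mdiff M x y) = si.ds x y"
  by (simp add: mdiff_eq mnorm_eq si.ds_def)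

lemma car_nonempty: "car M \<noteq> {}" using zero_closed by blast

lemma eq_of_ds_0:
  assumes "x \<in> car M" "y \<in> car M" "si.ds x y = 0"
  shows "x = y"
proof -
  have sc0: "mscale M 0 z = mzero M" if "z \<in> car M" for z
    by (rule inn_definite) (simp_all add: that inn_scale)
  have "inn M (mdiff M x y) (mdiff M x y) = 0"
    using assms(3) by (simp add: si.ds_def si.nrm_def mdiff_eq)
  then have "mdiff M x y = mzero M"
    by (rule inn_definite[rotated]) (simp add: mdiff_eq assms)
  moreover have "madd M (mdiff M x y) y = x"
  proof -
    have "madd M (mscale M (- 1) y) y = mzero M"
      using scale_add_left[of y "- 1" 1] assms sc0[of y] by (simp add: scale_one)
    then have "madd M (mdiff M x y) y = madd M x (mzero M)"
      using assms by (simp add: mdiff_def add_assoc scale_closed)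
    then show ?thesis using assms by (simp add: add_commute[of x] add_zero zero_closed)
  qed
  ultimately show ?thesis using assms by (simp add: add_zero)
qed

lemma inn_zero [simp]: "x \<in> car M \<Longrightarrow> inn M x (mzero M) = 0"
proof -
  assume x: "x \<in> car M"
  have "inn M x (madd M (mzero M) (mzero M)) = inn M x (mzero M)"
    by (simp add: add_zero zero_closed)
  then show ?thesis using x by (simp add: inn_add zero_closed)
qed

lemma ex_limit:
  assumes "si.cauchy s"
  obtains l where "l \<in> car M" "(\<lambda>n. si.ds (s n) l) \<longlonglongrightarrow> 0"
  using complete[of s] assms that unfolding mnorm_mdiff_eq si.cauchy_def by blast

end

section \<open>Positivity of the interior tensor product\<close>

definition moment :: "(nat \<Rightarrow> 'a::real_vector) \<Rightarrow> real poly \<Rightarrow> 'a" where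
  "moment h p = (\<Sum>k\<le>degree p. coeff p k *\<^sub>R h k)"

lemma moment_eq: "degree p \<le> N \<Longrightarrow> moment h p = (\<Sum>k\<le>N. coeff p k *\<^sub>R h k)"
  unfolding moment_def by (rule sum.mono_neutral_left) (auto simp: coeff_eq_0)

lemma moment_add: "moment h (p + q) = moment h p + moment h q"
proof -
  let ?N = "max (degree p) (degree q)"
  have "moment h (p + q) = (\<Sum>k\<le>?N. coeff (p + q) k *\<^sub>R h k)"
    by (rule moment_eq) (rule degree_add_le_max)
  also have "\<dots> = moment h p + moment h q"
    by (simp add: moment_eq[of p ?N] moment_eq[of q ?N] scaleR_left_distrib sum.distrib)
  finally show ?thesis .
qed

lemma moment_smult: "moment h (smult r p) = r *\<^sub>R moment h p"
  by (simp add: moment_eq[OF degree_smult_le] moment_def[of h p] scaleR_sum_right)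

lemma moment_monom: "moment h (monom r k) = r *\<^sub>R h k"
proof -
  have "moment h (monom r k) = (\<Sum>j\<le>k. coeff (monom r k) j *\<^sub>R h j)"
    by (rule moment_eq) (rule degree_monom_le)
  also have "\<dots> = (\<Sum>j\<le>k. if k = j then r *\<^sub>R h j else 0)" by (rule sum.cong) auto
  finally show ?thesis by simp
qed

lemma moment_0 [simp]: "moment h 0 = 0" by (simp add: moment_def)

lemma moment_sum: "moment h (sum f A) = (\<Sum>i\<in>A. moment h (f i))"
  by (induction A rule: infinite_finite_induct) (simp_all add: moment_add)

lemma moment_mult:
  "moment h (p * q) = (\<Sum>i\<le>degree p. \<Sum>j\<le>degree q. (coeff p i * coeff q j) *\<^sub>R h (i + j))"
proof -
  have "p * q = (\<Sum>i\<le>degree p. monom (coeff p i) i) * (\<Sum>j\<le>degree q. monom (coeff q j) j)"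
    by (simp add: poly_as_sum_of_monoms)
  also have "\<dots> = (\<Sum>i\<le>degree p. \<Sum>j\<le>degree q. monom (coeff p i * coeff q j) (i + j))"
    by (simp add: sum_product mult_monom)
  finally show ?thesis by (simp add: moment_sum moment_monom)
qed

text \<open>The iteration \<open>sqrt_iter\<close> with the variable s for \<open>u\<close>: on
  [-1, 1] it approximates 1 - \<surd>(1 - s).\<close>

fun sqrt_poly :: "nat \<Rightarrow> real poly" where
  "sqrt_poly 0 = 0"
| "sqrt_poly (Suc n) = smult (1/2) (monom 1 1 + sqrt_poly n * sqrt_poly n)"

lemma poly_sqrt_poly_1: "poly (sqrt_poly n) 1 = sqrt_majorant n"
  by (induction n) (simp_all add: poly_monom power2_eq_square)

lemma coeff_mult_nonneg:
  fixes p q :: "real poly"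
  shows "(\<And>k. 0 \<le> coeff p k) \<Longrightarrow> (\<And>k. 0 \<le> coeff q k) \<Longrightarrow> 0 \<le> coeff (p * q) k"
  unfolding coeff_mult by (intro sum_nonneg mult_nonneg_nonneg)

lemma coeff_sqrt_poly_nonneg: "0 \<le> coeff (sqrt_poly n) k"
  by (induction n arbitrary: k) (simp_all add: coeff_mult_nonneg)

text \<open>For a polynomial with nonnegative coefficients the value at 1 is the sum of the
  coefficients, so a bounded sequence has moments controlled by that value. For these increments the
  value at 1 is an increment of \<open>sqrt_majorant\<close>, which tends to 0.\<close>

lemma coeff_sqrt_poly_diff_nonneg: "0 \<le> coeff (sqrt_poly (Suc n) - sqrt_poly n) k"
proof (induction n arbitrary: k)
  case 0
  show ?case by simp
next
  case (Suc n)
  let ?a = "sqrt_poly n" and ?b = "sqrt_poly (Suc n)"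
  have "sqrt_poly (Suc (Suc n)) - ?b
      = smult (1/2) ((monom 1 1 + ?b * ?b) - (monom 1 1 + ?a * ?a))"
    unfolding smult_diff_right by (simp only: sqrt_poly.simps(2))
  also have "\<dots> = smult (1/2) ((?b - ?a) * (?b + ?a))"
    by (simp only: square_diff_square_factored add_diff_cancel_left mult.commute)
  finally have eq: "sqrt_poly (Suc (Suc n)) - ?b = \<dots>" .
  show ?case unfolding eq
    using coeff_mult_nonneg[of "?b - ?a" "?b + ?a" k] Suc coeff_sqrt_poly_nonneg[of n]
      coeff_sqrt_poly_nonneg[of "Suc n"] by (simp del: sqrt_poly.simps)
qed

lemma norm_moment_le:
  fixes h :: "nat \<Rightarrow> 'a::real_normed_vector"
  assumes "\<And>k. norm (h k) \<le> B" "\<And>k. 0 \<le> coeff p k"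
  shows "norm (moment h p) \<le> B * poly p 1"
proof -
  have "norm (moment h p) \<le> (\<Sum>k\<le>degree p. coeff p k * B)"
    unfolding moment_def using assms by (intro sum_norm_le) (simp add: mult_left_mono)
  then show ?thesis by (simp add: poly_altdef mult.commute flip: sum_distrib_left)
qed

text \<open>A bounded sequence with positive Hankel form behaves like the moments of a positive measure on
  \<open>[-1, 1]\<close>: here \<open>h 0 - h 1\<close> is the integral of \<open>1 - s\<close>, which is the limit of the squares
  \<open>(1 - p\<^sub>n(s))\<^sup>2\<close>.\<close>

lemma hankel_nonneg_diff:
  fixes h :: "nat \<Rightarrow> 'a::cstar_algebra"
  assumes bd: "\<And>k. norm (h k) \<le> B"
    and pos: "\<And>N c. cstar_nonneg (\<Sum>k\<le>N. \<Sum>l\<le>N. (c k * c l) *\<^sub>R h (k + l))"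
  shows "cstar_nonneg (h 0 - h 1)"
proof -
  let ?d = "\<lambda>n. sqrt_poly (Suc n) - sqrt_poly n"
  \<comment> \<open>With \<open>p\<^sub>n\<close> for \<open>sqrt_poly n\<close>, the recursion
    reads \<open>2 p\<^sub>n\<^sub>+\<^sub>1 = s + p\<^sub>n\<^sup>2\<close>; inserted into
    \<open>1 - 2 p\<^sub>n + p\<^sub>n\<^sup>2\<close> it leaves \<open>1 - s\<close> plus twice the
    increment.\<close>
  have eq: "moment h ((1 - sqrt_poly n) * (1 - sqrt_poly n)) = h 0 - h 1 + 2 *\<^sub>R moment h (?d n)" for n
  proof -
    have "(1 - sqrt_poly n) * (1 - sqrt_poly n) = monom 1 0 + monom (- 1) 1 + smult 2 (?d n)"
      by (intro poly_eq_poly_eq_iff[THEN iffD1] ext) (simp add: poly_monom field_simps)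
    then show ?thesis by (simp only: moment_add moment_smult moment_monom) simp
  qed
  have "(\<lambda>n. sqrt_majorant (Suc n) - sqrt_majorant n) \<longlonglongrightarrow> 0"
    using sqrt_majorant_convergent LIMSEQ_Suc tendsto_diff[of "\<lambda>n. sqrt_majorant (Suc n)" _ _ sqrt_majorant]
    unfolding convergent_def by fastforce
  then have "(\<lambda>n. moment h (?d n)) \<longlonglongrightarrow> 0"
  proof (rule tendsto_0_le[where K=B], intro always_eventually allI)
    fix n
    have "norm (moment h (?d n)) \<le> B * poly (?d n) 1"
      by (rule norm_moment_le[OF bd coeff_sqrt_poly_diff_nonneg])
    also have "poly (?d n) 1 = sqrt_majorant (Suc n) - sqrt_majorant n"
      by (simp only: poly_diff poly_sqrt_poly_1)
    finally show "norm (moment h (?d n)) \<le> norm (sqrt_majorant (Suc n) - sqrt_majorant n) * B"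
      using sqrt_majorant_mono[of n] by (simp add: mult.commute del: sqrt_majorant.simps)
  qed
  then have "(\<lambda>n. h 0 - h 1 + 2 *\<^sub>R moment h (?d n)) \<longlonglongrightarrow> h 0 - h 1 + 2 *\<^sub>R 0"
    by (intro tendsto_intros)
  then have "(\<lambda>n. h 0 - h 1 + 2 *\<^sub>R moment h (?d n)) \<longlonglongrightarrow> h 0 - h 1" by simp
  then show ?thesis
  proof (rule cstar_nonneg_limit)
    show "cstar_nonneg (h 0 - h 1 + 2 *\<^sub>R moment h (?d n))" for n
      unfolding eq[symmetric] moment_mult by (rule pos)
  qed
qed

context cstar_correspondence
begin

lemma phi_closed [simp]: "y \<in> car M \<Longrightarrow> \<phi> a y \<in> car M"
  using \<phi>_star[of a] by (auto simp: is_adjoint_def)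

lemma inn_phi_left: "x \<in> car M \<Longrightarrow> y \<in> car M \<Longrightarrow> inn M (\<phi> a x) y = inn M x (\<phi> (star a) y)"
  using \<phi>_star[of a] by (auto simp: is_adjoint_def)

lemma inn_phi: "x \<in> car M \<Longrightarrow> y \<in> car M \<Longrightarrow> inn M x (\<phi> a y) = inn M (\<phi> (star a) x) y"
  by (simp add: inn_phi_left star_star)

lemma inn_phi_vec:
  assumes "x \<in> car M" "y \<in> car M"
  shows "z \<in> car M \<Longrightarrow> inn M x (\<phi> a (madd M y z)) = inn M x (\<phi> a y) + inn M x (\<phi> a z)"
    and "inn M x (\<phi> a (mscale M k y)) = scaleC k (inn M x (\<phi> a y))"
    and "inn M x (\<phi> a (mact M y c)) = inn M x (\<phi> a y) * c"
  by (simp_all add: inn_phi assms si.form_simps)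

lemma inn_phi_alg:
  assumes "x \<in> car M" "y \<in> car M"
  shows inn_phi_add: "inn M x (\<phi> (a + b) y) = inn M x (\<phi> a y) + inn M x (\<phi> b y)"
    and inn_phi_scaleC: "inn M x (\<phi> (scaleC k a) y) = scaleC k (inn M x (\<phi> a y))"
    and inn_phi_scaleR: "inn M x (\<phi> (r *\<^sub>R a) y) = r *\<^sub>R inn M x (\<phi> a y)"
  using \<phi>_scale[of y "complex_of_real r" a]
  by (simp_all add: \<phi>_add \<phi>_scale inn_add inn_scale assms scaleC_of_real)

lemma inn_phi_diff:
  "x \<in> car M \<Longrightarrow> y \<in> car M \<Longrightarrow> inn M x (\<phi> (a - b) y) = inn M x (\<phi> a y) - inn M x (\<phi> b y)"
  using inn_phi_add[of x y "a - b" b] by simp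

lemma inn_phi_sum:
  "x \<in> car M \<Longrightarrow> y \<in> car M \<Longrightarrow> inn M x (\<phi> (sum f A) y) = (\<Sum>i\<in>A. inn M x (\<phi> (f i) y))"
  by (induction A rule: infinite_finite_induct)
    (use inn_phi_diff[of x y 0 0] in \<open>simp_all add: inn_phi_add\<close>)

lemma inn_phi_phi:
  "x \<in> car M \<Longrightarrow> y \<in> car M \<Longrightarrow> inn M (\<phi> a x) (\<phi> b y) = inn M x (\<phi> (star a * b) y)"
  by (simp add: inn_phi_left \<phi>_mult)

end

text \<open>Writing the positive element \<open>(norm a)\<^sup>2 *\<^sub>R 1 - star a * a\<close> as
  \<open>star d * d\<close> and applying it between two copies of \<open>y\<close> yields the inner
  product of \<open>\<phi> d y\<close> with itself. The 1 in it contributes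
  \<open>\<phi> 1 y\<close>.\<close>

lemma nrm_phi_le:
  fixes \<phi> :: "'b::{cstar_algebra,monoid_mult} \<Rightarrow> 'm \<Rightarrow> 'm" and M :: "('m,'c::cstar_algebra) hmod"
  assumes "cstar_correspondence M \<phi>" and y: "y \<in> car M"
  shows "semi_inner.nrm (inn M) (\<phi> a y) \<le> norm a * semi_inner.nrm (inn M) (\<phi> 1 y)"
proof -
  interpret cstar_correspondence M \<phi> by fact
  let ?q = "\<lambda>a. inn M y (\<phi> a y)"
  have "cstar_nonneg (norm (star a * a) *\<^sub>R (star 1 * 1) - star 1 * (star a * a) * 1)"
    by (rule cstar_nonneg_conj_le) (simp add: star_mult star_star)
  then obtain d where d: "(norm a)\<^sup>2 *\<^sub>R 1 - star a * a = star d * d"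
    by (auto simp: cstar_nonneg_def cstar_identity)
  have "?q (star d * d) = inn M (\<phi> d y) (\<phi> d y)" by (simp add: inn_phi_phi y)
  then have "cstar_nonneg (?q (star d * d))" by (simp add: inn_nonneg y)
  then have "cstar_nonneg ((norm a)\<^sup>2 *\<^sub>R ?q 1 - ?q (star a * a))"
    by (simp add: inn_phi_diff inn_phi_scaleR y flip: d)
  moreover have "cstar_nonneg (?q (star a * a))"
    using inn_nonneg[of "\<phi> a y"] by (simp add: inn_phi_phi y)
  ultimately have "norm (?q (star a * a)) \<le> norm ((norm a)\<^sup>2 *\<^sub>R ?q 1)"
    by (intro cstar_nonneg_norm_le)
  moreover have "?q 1 = inn M (\<phi> 1 y) (\<phi> 1 y)" by (simp add: inn_phi_phi y)
  moreover have "?q (star a * a) = inn M (\<phi> a y) (\<phi> a y)" by (simp add: inn_phi_phi y)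
  ultimately have "(si.nrm (\<phi> a y))\<^sup>2 \<le> (norm a * si.nrm (\<phi> 1 y))\<^sup>2"
    by (simp add: si.nrm_sq power_mult_distrib)
  then show ?thesis by (rule power2_le_imp_le) simp
qed

text \<open>On \<open>\<B>\<^sup>n\<close> let \<open>X\<close> be a small multiple of the Gram matrix \<open>\<langle>x\<^sub>i, x\<^sub>j\<rangle>\<close> and \<open>T = 1 - X\<close>, a self-adjoint
  contraction. The claim is \<open>h 0 - h 1 \<ge> 0\<close> for \<open>h k = \<Sum> \<langle>y\<^sub>i, (T\<^sup>k)\<^sub>i\<^sub>j y\<^sub>j\<rangle>\<close>, and the Hankel form of \<open>h\<close> is
  \<open>\<Sum>\<^sub>m \<langle>z\<^sub>m, z\<^sub>m\<rangle>\<close> with \<open>z\<^sub>m = \<Sum> c\<^sub>k (T\<^sup>k)\<^sub>m\<^sub>i y\<^sub>i\<close>.\<close>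

lemma gram_sum_nonneg:
  fixes E :: "('e,'b::{cstar_algebra,monoid_mult}) hmod" and M :: "('m,'c::cstar_algebra) hmod"
  assumes "hilbert_module E" "cstar_correspondence M \<phi>"
    and x: "\<And>i. i < (n::nat) \<Longrightarrow> x i \<in> car E" and y: "\<And>i. i < n \<Longrightarrow> y i \<in> car M"
  shows "cstar_nonneg (\<Sum>i<n. \<Sum>j<n. inn M (y i) (\<phi> (inn E (x i) (x j)) (y j)))"
proof -
  interpret E: hilbert_module E by fact
  interpret cstar_correspondence M \<phi> by fact
  define bf :: "(nat \<Rightarrow> 'b) \<Rightarrow> (nat \<Rightarrow> 'b) \<Rightarrow> 'b" where "bf b b' = (\<Sum>i<n. star (b i) * b' i)" for b b'
  \<comment> \<open>This is \<open>\<B>\<^sup>n\<close> with its standard inner product; coordinates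
    from \<open>n\<close> on are invisible to the form, which is therefore only
    semi-definite.\<close>
  interpret bv: semi_inner UNIV "\<lambda>b b' i. b i + b' i" "\<lambda>k b i. scaleC k (b i)" "\<lambda>b c i. b i * c" bf
    by unfold_locales (auto simp: bf_def distrib_left sum.distrib mult_scaleC_right scaleC_sum_right
        sum_distrib_right mult.assoc star_sum star_mult star_star intro: cstar_nonneg_sum)
  define G where "G = (\<Sum>i<n. norm (inn E (x i) (x i)))"
  \<comment> \<open>Cauchy-Schwarz bounds the form at \<open>X b\<close> by \<rho> G times the
    pairing of \<open>b\<close> with \<open>X b\<close>. Hence \<rho> G \<le> 2 is what makes
    \<open>T\<close> a contraction; the summand 1 avoids dividing by zero.\<close>
  define \<rho> where "\<rho> = 1 / (1 + G)"
  have G0: "G \<ge> 0" unfolding G_def by (intro sum_nonneg) simp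
  then have \<rho>: "\<rho> > 0" "\<rho> * G \<le> 2" by (simp_all add: \<rho>_def divide_simps)
  define X where "X b i = \<rho> *\<^sub>R (\<Sum>j<n. inn E (x i) (x j) * b j)" for b i
  define T where "T b i = b i - X b i" for b i
  have ex_v: "\<exists>v\<in>car E. \<forall>w\<in>car E. inn E w v = (\<Sum>j<n. inn E w (x j) * b j)" for b
  proof -
    have "\<exists>v\<in>car E. \<forall>w\<in>car E. inn E w v = (\<Sum>j<n. inn E w (mact E (x j) (b j)))"
      by (rule E.si.ex_sum[OF E.car_nonempty, of "{..<n}" "\<lambda>j. mact E (x j) (b j)"])
        (auto simp: x E.act_closed)
    then show ?thesis by (simp add: E.inn_act x)
  qed
  have bf_diff: "bf (\<lambda>i. b i - b' i) (\<lambda>i. c i - c' i) = bf b c - bf b c' - bf b' c + bf b' c'" for b b' c c'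
    by (simp add: bf_def star_diff algebra_simps sum.distrib sum_subtractf)
  have bf_diff_left: "bf (\<lambda>i. b i - b' i) c = bf b c - bf b' c" for b b' c
    by (simp add: bf_def star_diff algebra_simps sum_subtractf)
  have bf_diff_right: "bf b (\<lambda>i. c i - c' i) = bf b c - bf b c'" for b c c'
    by (simp add: bf_def algebra_simps sum_subtractf)
  have X_sym: "bf (X b) b' = bf b (X b')" for b b'
  proof -
    have "bf (X b) b' = \<rho> *\<^sub>R (\<Sum>i<n. \<Sum>j<n. star (b j) * inn E (x j) (x i) * b' i)"
      by (simp add: bf_def X_def star_scaleR star_sum star_mult E.inn_star x scaleR_sum_right sum_distrib_right)
    also have "\<dots> = \<rho> *\<^sub>R (\<Sum>j<n. \<Sum>i<n. star (b j) * inn E (x j) (x i) * b' i)"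
      by (subst sum.swap) simp
    also have "\<dots> = bf b (X b')"
      by (simp add: bf_def X_def scaleR_sum_right sum_distrib_left mult.assoc)
    finally show ?thesis .
  qed
  have T_sym: "bf (T b) b' = bf b (T b')" for b b'
    unfolding T_def[abs_def] bf_diff_left bf_diff_right by (simp add: X_sym)
  have T_contr: "bv.nrm (T b) \<le> bv.nrm b" for b
  proof -
    obtain v where v: "v \<in> car E" "\<And>w. w \<in> car E \<Longrightarrow> inn E w v = (\<Sum>j<n. inn E w (x j) * b j)"
      using ex_v[of b] by blast
    have Xv: "X b i = \<rho> *\<^sub>R inn E (x i) v" if "i < n" for i
      using that by (simp add: X_def v(2) x)
    have "inn E v v = star (inn E v v)" by (simp add: E.inn_star v(1))
    also have "\<dots> = (\<Sum>j<n. star (b j) * inn E (x j) v)"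
      by (simp add: v(1) v(2)[OF v(1)] star_sum star_mult E.inn_star x)
    finally have vv: "\<rho> *\<^sub>R inn E v v = bf b (X b)"
      by (simp add: bf_def Xv scaleR_sum_right)
    have XX: "bf (X b) (X b) = (\<rho> * \<rho>) *\<^sub>R (\<Sum>i<n. inn E v (x i) * inn E (x i) v)"
      by (simp add: bf_def Xv star_scaleR E.inn_star x v(1) scaleR_sum_right)
    \<comment> \<open>The vector \<open>v\<close> is the sum of the \<open>x j\<close> acted on by
      \<open>b j\<close>. The first summand collects Cauchy-Schwarz for \<open>v\<close> against
      each \<open>x i\<close>; the second has a nonnegative coefficient because \<rho> G \<le>
      2.\<close>
    have "cstar_nonneg ((\<rho> * \<rho>) *\<^sub>R (\<Sum>i<n. norm (inn E (x i) (x i)) *\<^sub>R inn E v v - inn E v (x i) * inn E (x i) v)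
        + (2 * \<rho> - \<rho> * \<rho> * G) *\<^sub>R inn E v v)"
      using \<rho> v(1) x
      by (intro cstar_nonneg_add cstar_nonneg_scaleR cstar_nonneg_sum E.si.cauchy_schwarz_order
          E.inn_nonneg) (auto simp: mult.assoc)
    also have "(\<rho> * \<rho>) *\<^sub>R (\<Sum>i<n. norm (inn E (x i) (x i)) *\<^sub>R inn E v v - inn E v (x i) * inn E (x i) v)
        + (2 * \<rho> - \<rho> * \<rho> * G) *\<^sub>R inn E v v = 2 *\<^sub>R (\<rho> *\<^sub>R inn E v v) - bf (X b) (X b)"
      by (simp add: XX sum_subtractf scaleR_diff_right scaleR_diff_left G_def flip: scaleR_sum_left)
    also have "\<dots> = bf b b - bf (T b) (T b)"
      unfolding T_def[abs_def] bf_diff by (simp add: vv X_sym scaleR_2)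
    finally have "norm (bf (T b) (T b)) \<le> norm (bf b b)"
      by (intro cstar_nonneg_norm_le) (simp_all add: bv.form_nonneg)
    then show ?thesis by (simp add: bv.nrm_def)
  qed
  have Tk_contr: "bv.nrm ((T ^^ k) b) \<le> bv.nrm b" for k b
    by (induction k) (auto intro: order_trans[OF T_contr])
  \<comment> \<open>Self-adjointness of \<open>T\<close> makes the pairing of two powers depend only
    on the sum of the exponents, the Hankel pattern.\<close>
  have Tk_sym: "bf ((T ^^ k) b) ((T ^^ l) b') = bf b ((T ^^ (k + l)) b')" for k l b b'
  proof (induction k arbitrary: l)
    case (Suc k)
    then show ?case using Suc.IH[of "Suc l"] by (simp add: T_sym)
  qed simp
  \<comment> \<open>The standard basis: pairing \<open>e i\<close> with a power of \<open>T\<close>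
    at \<open>e j\<close> reads off the matrix entry (i, j).\<close>
  define e :: "nat \<Rightarrow> nat \<Rightarrow> 'b" where "e i j = (if j = i then 1 else 0)" for i j
  have bf_e: "bf (e i) b = b i" if "i < n" for i b
  proof -
    have "bf (e i) b = (\<Sum>j<n. if i = j then b j else 0)"
      unfolding bf_def by (rule sum.cong) (auto simp: e_def)
    then show ?thesis using that by simp
  qed
  define h where "h k = (\<Sum>i<n. \<Sum>j<n. inn M (y i) (\<phi> (bf (e i) ((T ^^ k) (e j))) (y j)))" for k
  have "cstar_nonneg (h 0 - h 1)"
  proof (rule hankel_nonneg_diff)
    fix k
    show "norm (h k) \<le> (\<Sum>i<n. \<Sum>j<n. si.nrm (y i) * ((bv.nrm (e i) * bv.nrm (e j)) * si.nrm (\<phi> 1 (y j))))"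
      unfolding h_def
    proof (intro sum_norm_le)
      fix i j assume "i \<in> {..<n}" "j \<in> {..<n}"
      then have ij: "y i \<in> car M" "y j \<in> car M" using y by auto
      let ?a = "bf (e i) ((T ^^ k) (e j))"
      have "norm ?a \<le> bv.nrm (e i) * bv.nrm ((T ^^ k) (e j))" by (rule bv.cauchy_schwarz) simp_all
      also have "\<dots> \<le> bv.nrm (e i) * bv.nrm (e j)" by (intro mult_left_mono Tk_contr) simp
      finally have "norm ?a * si.nrm (\<phi> 1 (y j)) \<le> (bv.nrm (e i) * bv.nrm (e j)) * si.nrm (\<phi> 1 (y j))"
        by (rule mult_right_mono) simp
      then have "si.nrm (\<phi> ?a (y j)) \<le> (bv.nrm (e i) * bv.nrm (e j)) * si.nrm (\<phi> 1 (y j))"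
        using nrm_phi_le[OF assms(2) ij(2), of ?a] by simp
      then have "si.nrm (y i) * si.nrm (\<phi> ?a (y j)) \<le> si.nrm (y i) * ((bv.nrm (e i) * bv.nrm (e j)) * si.nrm (\<phi> 1 (y j)))"
        by (rule mult_left_mono) simp
      then show "norm (inn M (y i) (\<phi> ?a (y j))) \<le> si.nrm (y i) * ((bv.nrm (e i) * bv.nrm (e j)) * si.nrm (\<phi> 1 (y j)))"
        using si.cauchy_schwarz[of "y i" "\<phi> ?a (y j)"] ij by simp
    qed
  next
    fix N :: nat and c :: "nat \<Rightarrow> real"
    define A where "A = {..N} \<times> {..<n}"
    define z where "z m p = mscale M (complex_of_real (c (fst p))) (\<phi> ((T ^^ fst p) (e (snd p)) m) (y (snd p)))" for m p
    have zin: "z m p \<in> car M" if "p \<in> A" for m p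
      using that by (auto simp: z_def A_def y scale_closed)
    have inn_z: "(\<Sum>m<n. inn M (z m (k, i)) (z m (l, j)))
        = (c k * c l) *\<^sub>R inn M (y i) (\<phi> (bf (e i) ((T ^^ (k + l)) (e j))) (y j))"
      if "i < n" "j < n" for k l i j
    proof -
      have "(\<Sum>m<n. inn M (z m (k, i)) (z m (l, j)))
        = (\<Sum>m<n. (c k * c l) *\<^sub>R inn M (y i) (\<phi> (star ((T ^^ k) (e i) m) * (T ^^ l) (e j) m) (y j)))"
        using that y
        by (simp add: z_def si.form_smul si.form_smul_left scaleC_of_real inn_phi_phi mult.commute)
      also have "\<dots> = (c k * c l) *\<^sub>R inn M (y i) (\<phi> (bf ((T ^^ k) (e i)) ((T ^^ l) (e j))) (y j))"
        using that y by (simp add: bf_def inn_phi_sum scaleR_sum_right)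
      finally show ?thesis by (simp add: Tk_sym)
    qed
    have "(\<Sum>k\<le>N. \<Sum>l\<le>N. (c k * c l) *\<^sub>R h (k + l))
      = (\<Sum>k\<le>N. \<Sum>l\<le>N. \<Sum>i<n. \<Sum>j<n. \<Sum>m<n. inn M (z m (k, i)) (z m (l, j)))"
      by (simp add: h_def scaleR_sum_right inn_z)
    also have "\<dots> = (\<Sum>k\<le>N. \<Sum>i<n. \<Sum>l\<le>N. \<Sum>j<n. \<Sum>m<n. inn M (z m (k, i)) (z m (l, j)))"
      by (intro sum.cong refl sum.swap)
    also have "\<dots> = (\<Sum>p\<in>A. \<Sum>q\<in>A. \<Sum>m<n. inn M (z m p) (z m q))"
      unfolding A_def sum.cartesian_product' by (rule refl)
    also have "\<dots> = (\<Sum>p\<in>A. \<Sum>m<n. \<Sum>q\<in>A. inn M (z m p) (z m q))"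
      by (intro sum.cong refl sum.swap)
    also have "\<dots> = (\<Sum>m<n. \<Sum>p\<in>A. \<Sum>q\<in>A. inn M (z m p) (z m q))"
      by (rule sum.swap)
    finally show "cstar_nonneg (\<Sum>k\<le>N. \<Sum>l\<le>N. (c k * c l) *\<^sub>R h (k + l))"
      by (simp only:) (intro cstar_nonneg_sum si.sum_form_nonneg zin)
  qed
  moreover have "h 0 - h 1 = \<rho> *\<^sub>R (\<Sum>i<n. \<Sum>j<n. inn M (y i) (\<phi> (inn E (x i) (x j)) (y j)))"
  proof -
    have "bf (e i) (e j) - bf (e i) (T (e j)) = \<rho> *\<^sub>R inn E (x i) (x j)" if "i < n" "j < n" for i j
    proof -
      have "bf (e i) (e j) - bf (e i) (T (e j)) = X (e j) i"
        by (simp add: bf_e that T_def)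
      also have "\<dots> = \<rho> *\<^sub>R (\<Sum>k<n. if j = k then inn E (x i) (x k) else 0)"
        unfolding X_def by (intro arg_cong[where f="scaleR \<rho>"] sum.cong) (auto simp: e_def)
      finally show ?thesis using that by simp
    qed
    then have "inn M (y i) (\<phi> (bf (e i) (e j)) (y j)) - inn M (y i) (\<phi> (bf (e i) (T (e j))) (y j))
        = \<rho> *\<^sub>R inn M (y i) (\<phi> (inn E (x i) (x j)) (y j))" if "i < n" "j < n" for i j
      using that y by (simp flip: inn_phi_diff inn_phi_scaleR)
    then show ?thesis by (simp add: h_def scaleR_sum_right flip: sum_subtractf)
  qed
  ultimately have "cstar_nonneg (\<rho> *\<^sub>R (\<Sum>i<n. \<Sum>j<n. inn M (y i) (\<phi> (inn E (x i) (x j)) (y j))))"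
    by simp
  from cstar_nonneg_scaleR[OF this, of "1/\<rho>"] show ?thesis using \<rho>(1) by simp
qed

section \<open>The interior tensor product as a completed semi-inner product module\<close>

locale tensor_pair = E: hilbert_module E + cstar_correspondence M \<phi>
  for E :: "('e,'b::{cstar_algebra,monoid_mult}) hmod"
    and M :: "('m,'c::cstar_algebra) hmod" and \<phi> :: "'b \<Rightarrow> 'm \<Rightarrow> 'm"
begin

lemma tens_sums_simps [simp]:
  "[] \<in> tens_sums E M"
  "p # u \<in> tens_sums E M \<longleftrightarrow> fst p \<in> car E \<and> snd p \<in> car M \<and> u \<in> tens_sums E M"
  "u @ v \<in> tens_sums E M \<longleftrightarrow> u \<in> tens_sums E M \<and> v \<in> tens_sums E M"
  by (cases p; auto simp: tens_sums_def)+

lemma tens_inn_simps [simp]: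
  "tens_inn E M \<phi> [] v = 0"
  "tens_inn E M \<phi> u [] = 0"
  "tens_inn E M \<phi> (u @ u') v = tens_inn E M \<phi> u v + tens_inn E M \<phi> u' v"
  "tens_inn E M \<phi> u (v @ v') = tens_inn E M \<phi> u v + tens_inn E M \<phi> u v'"
  by (simp_all add: tens_inn_def case_prod_unfold sum_list_addf)

lemma tens_inn_Cons:
  "tens_inn E M \<phi> (p # u) v = tens_inn E M \<phi> [p] v + tens_inn E M \<phi> u v"
  "NO_MATCH [] v \<Longrightarrow> tens_inn E M \<phi> u (q # v) = tens_inn E M \<phi> u [q] + tens_inn E M \<phi> u v"
  using tens_inn_simps(3)[of "[p]" u v] tens_inn_simps(4)[of u "[q]" v] by simp_all

lemma tens_inn_elem [simp]:
  "tens_inn E M \<phi> [(x, y)] [(x', y')] = inn M y (\<phi> (inn E x x') y')"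
  by (simp add: tens_inn_def)

lemma tens_inn_star:
  assumes "u \<in> tens_sums E M" "v \<in> tens_sums E M"
  shows "star (tens_inn E M \<phi> u v) = tens_inn E M \<phi> v u"
proof -
  have 1: "star (tens_inn E M \<phi> [p] [q]) = tens_inn E M \<phi> [q] [p]"
    if "[p] \<in> tens_sums E M" "[q] \<in> tens_sums E M" for p q
    using that by (cases p; cases q) (simp add: inn_star inn_phi_left E.inn_star)
  have 2: "star (tens_inn E M \<phi> [p] v) = tens_inn E M \<phi> v [p]"
    if "[p] \<in> tens_sums E M" "v \<in> tens_sums E M" for p v
    using that(2)
  proof (induction v)
    case (Cons q v)
    then show ?case using 1[of p q] that(1) tens_inn_Cons(1)[of q v "[p]"]
        tens_inn_simps(4)[of "[p]" "[q]" v] by (simp add: star_add)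
  qed simp
  show ?thesis using assms(1)
  proof (induction u)
    case (Cons p u)
    then show ?case using 2[of p v] assms(2) tens_inn_Cons(1)[of p u v]
        tens_inn_simps(4)[of v "[p]" u] by (simp add: star_add)
  qed simp
qed

text \<open>Scalars and the right action both work on second factors and come out of the form as an
  additive map \<open>f\<close>, so one induction serves both.\<close>

lemma tens_inn_map:
  assumes T: "\<And>y. y \<in> car M \<Longrightarrow> T y \<in> car M" and f: "f 0 = 0" "\<And>a b. f (a + b) = f a + f b"
    and Tf: "\<And>a y z. y \<in> car M \<Longrightarrow> z \<in> car M \<Longrightarrow> inn M z (\<phi> a (T y)) = f (inn M z (\<phi> a y))"
    and u: "u \<in> tens_sums E M" and v: "v \<in> tens_sums E M"
  shows "tens_inn E M \<phi> u (map (\<lambda>(x, y). (x, T y)) v) = f (tens_inn E M \<phi> u v)"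
proof -
  have 1: "tens_inn E M \<phi> [p] (map (\<lambda>(x, y). (x, T y)) v) = f (tens_inn E M \<phi> [p] v)"
    if "[p] \<in> tens_sums E M" for p
    using v
  proof (induction v)
    case (Cons q v)
    obtain x y x' y' where pq: "p = (x, y)" "q = (x', y')" by (cases p, cases q) auto
    show ?case using Cons that tens_inn_simps(4)[of "[p]" "[q]" v]
        tens_inn_simps(4)[of "[p]" "[(x', T y')]" "map (\<lambda>(x, y). (x, T y)) v"]
      by (simp add: f Tf pq)
  qed (simp add: f)
  show ?thesis using u
  proof (induction u)
    case (Cons p u)
    then show ?case
      using 1[of p] tens_inn_Cons(1)[of p u v] tens_inn_Cons(1)[of p u "map (\<lambda>(x, y). (x, T y)) v"]
      by (simp add: f)
  qed (simp add: f)
qed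

sublocale t: semi_inner "tens_sums E M" append "tens_scale M" "tens_act M" "tens_inn E M \<phi>"
proof
  fix u v w :: "('e \<times> 'm) list" and k b
  assume u: "u \<in> tens_sums E M"
  show "tens_scale M k u \<in> tens_sums E M" "tens_act M u b \<in> tens_sums E M"
    using u by (induction u) (auto simp: tens_scale_def tens_act_def scale_closed act_closed)
  show "cstar_nonneg (tens_inn E M \<phi> u u)"
  proof -
    have mem: "fst (u ! i) \<in> car E" "snd (u ! i) \<in> car M" if "i < length u" for i
      using u nth_mem[OF that] unfolding tens_sums_def by auto
    have "tens_inn E M \<phi> u u = (\<Sum>i<length u. \<Sum>j<length u.
        inn M (snd (u ! i)) (\<phi> (inn E (fst (u ! i)) (fst (u ! j))) (snd (u ! j))))"
      by (simp add: tens_inn_def case_prod_unfold sum_list_sum_nth atLeast0LessThan)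
    then show ?thesis
      using gram_sum_nonneg[OF E.hilbert_module_axioms cstar_correspondence_axioms mem] by simp
  qed
  assume v: "v \<in> tens_sums E M"
  show "tens_inn E M \<phi> u (tens_scale M k v) = scaleC k (tens_inn E M \<phi> u v)"
    unfolding tens_scale_def using u v
    by (intro tens_inn_map) (simp_all add: scale_closed scaleC_add_right inn_phi_vec)
  show "tens_inn E M \<phi> u (tens_act M v b) = tens_inn E M \<phi> u v * b"
    unfolding tens_act_def using u v
    by (intro tens_inn_map) (simp_all add: act_closed distrib_right inn_phi_vec)
  show "star (tens_inn E M \<phi> u v) = tens_inn E M \<phi> v u" by (rule tens_inn_star[OF u v])
qed simp_all

lemma tens_dist_eq: "tens_dist E M \<phi> = t.ds"
  by (intro ext) (simp add: tens_dist_def t.ds_def t.nrm_def t.diff_def Let_def)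

lemma tens_cauchy_eq: "tens_cauchy E M \<phi> = Collect t.cauchy"
  by (auto simp: tens_cauchy_def t.cauchy_def tens_dist_eq)

lemma tens_rel_iff: "(s, s') \<in> tens_rel E M \<phi> \<longleftrightarrow>
    t.cauchy s \<and> t.cauchy s' \<and> (\<lambda>n. t.ds (s n) (s' n)) \<longlonglongrightarrow> 0"
  by (simp add: tens_rel_def tens_cauchy_eq tens_dist_eq)

lemma equiv_tens_rel: "equiv (Collect t.cauchy) (tens_rel E M \<phi>)"
proof (rule equivI)
  show "tens_rel E M \<phi> \<subseteq> Collect t.cauchy \<times> Collect t.cauchy" by (auto simp: tens_rel_iff)
  show "refl_on (Collect t.cauchy) (tens_rel E M \<phi>)"
    by (auto simp: refl_on_def tens_rel_iff t.cauchy_in)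
  show "sym (tens_rel E M \<phi>)"
    by (rule symI) (simp add: tens_rel_iff t.ds_sym t.cauchy_in)
  show "trans (tens_rel E M \<phi>)"
    by (rule transI) (auto simp: tens_rel_iff intro: t.ds_limit_trans)
qed

abbreviation cls where "cls s \<equiv> tens_rel E M \<phi> `` {s}"

lemma cls_self: "t.cauchy s \<Longrightarrow> s \<in> cls s"
  by (rule equiv_class_self[OF equiv_tens_rel]) simp

lemma cls_eqI: "t.cauchy s \<Longrightarrow> t.cauchy s' \<Longrightarrow> (\<lambda>n. t.ds (s n) (s' n)) \<longlonglongrightarrow> 0 \<Longrightarrow> cls s = cls s'"
  by (rule equiv_class_eq[OF equiv_tens_rel]) (simp add: tens_rel_iff)

lemma car_interior: "car (interior_tensor E M \<phi>) = {cls s | s. t.cauchy s}"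
  by (auto simp: interior_tensor_def tens_cauchy_eq quotient_def)

lemma inn_interior:
  assumes "t.cauchy s" "t.cauchy s'" "(\<lambda>n. tens_inn E M \<phi> (s n) (s' n)) \<longlonglongrightarrow> l"
  shows "inn (interior_tensor E M \<phi>) (cls s) (cls s') = l"
proof -
  have "(THE l. \<forall>u\<in>cls s. \<forall>v\<in>cls s'. (\<lambda>n. tens_inn E M \<phi> (u n) (v n)) \<longlonglongrightarrow> l) = l"
  proof (rule the_equality)
    show "\<forall>u\<in>cls s. \<forall>v\<in>cls s'. (\<lambda>n. tens_inn E M \<phi> (u n) (v n)) \<longlonglongrightarrow> l"
      using t.form_limit_cong[OF assms(1) _ assms(2) _ _ _ assms(3)] by (auto simp: tens_rel_iff)
    show "l' = l" if "\<forall>u\<in>cls s. \<forall>v\<in>cls s'. (\<lambda>n. tens_inn E M \<phi> (u n) (v n)) \<longlonglongrightarrow> l'" for l'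
      using that cls_self[OF assms(1)] cls_self[OF assms(2)] LIMSEQ_unique[OF _ assms(3)] by blast
  qed
  then show ?thesis by (simp add: interior_tensor_def)
qed

lemma madd_interior:
  assumes "t.cauchy s" "t.cauchy s'"
  shows "madd (interior_tensor E M \<phi>) (cls s) (cls s') = cls (\<lambda>n. s n @ s' n)"
proof -
  have "cls (\<lambda>n. u n @ v n) = cls (\<lambda>n. s n @ s' n)" if "u \<in> cls s" "v \<in> cls s'" for u v
    using that assms
    by (intro cls_eqI[symmetric] t.cauchy_add t.ds_limit_add) (auto simp: tens_rel_iff)
  then have "(\<Union>u\<in>cls s. \<Union>v\<in>cls s'. cls (\<lambda>n. u n @ v n)) = cls (\<lambda>n. s n @ s' n)"
    by (intro UN_constant_eq[OF cls_self[OF assms(1)]] UN_constant_eq[OF cls_self[OF assms(2)]] ballI)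
  then show ?thesis by (simp add: interior_tensor_def)
qed

lemma mscale_interior:
  assumes "t.cauchy s"
  shows "mscale (interior_tensor E M \<phi>) k (cls s) = cls (\<lambda>n. tens_scale M k (s n))"
proof -
  have "cls (\<lambda>n. tens_scale M k (u n)) = cls (\<lambda>n. tens_scale M k (s n))" if "u \<in> cls s" for u
    using that assms
    by (intro cls_eqI[symmetric] t.cauchy_smul t.ds_limit_smul) (auto simp: tens_rel_iff)
  then have "(\<Union>u\<in>cls s. cls (\<lambda>n. tens_scale M k (u n))) = cls (\<lambda>n. tens_scale M k (s n))"
    by (intro UN_constant_eq[OF cls_self[OF assms]] ballI)
  then show ?thesis by (simp add: interior_tensor_def)
qed

end

section \<open>From a factorization to a kernel\<close>

theorem kernel_of_factorization:
  fixes E :: "('e,'b::{cstar_algebra,monoid_mult}) hmod" and F :: "('f,'c::cstar_algebra) hmod"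
    and M :: "('m,'c) hmod"
  assumes "hilbert_module E" and tf: "tensor_factorization E F S K M \<phi> i \<nu>"
  shows "\<exists>\<KK>. cpd_kernel S \<KK> \<and> kernel_family E F S \<KK> K"
proof -
  interpret tensor_pair E M \<phi>
    using assms unfolding tensor_pair_def tensor_factorization_def by auto
  have i: "i \<sigma> \<in> car M" if "\<sigma> \<in> S" for \<sigma>
    using tf that by (auto simp: tensor_factorization_def)
  have \<nu>: "\<nu> (elem_tensor E M \<phi> x (i \<sigma>)) = K \<sigma> x" if "x \<in> car E" "\<sigma> \<in> S" for x \<sigma>
    using tf that by (auto simp: tensor_factorization_def)
  have iso: "inn F (\<nu> U) (\<nu> V) = inn (interior_tensor E M \<phi>) U V"
    if "U \<in> car (interior_tensor E M \<phi>)" "V \<in> car (interior_tensor E M \<phi>)" for U V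
    using tf that by (auto simp: tensor_factorization_def hmod_isometry_def)
  define \<KK> where "\<KK> \<sigma> \<tau> b = inn M (i \<sigma>) (\<phi> b (i \<tau>))" for \<sigma> \<tau> b
  have "bounded_clinear (\<KK> \<sigma> \<tau>)" if "\<sigma> \<in> S" "\<tau> \<in> S" for \<sigma> \<tau>
  proof -
    have "bounded_linear (\<KK> \<sigma> \<tau>)"
    proof (rule bounded_linear_intro[where K="si.nrm (i \<sigma>) * si.nrm (\<phi> 1 (i \<tau>))"])
      fix b
      have "norm (\<KK> \<sigma> \<tau> b) \<le> si.nrm (i \<sigma>) * si.nrm (\<phi> b (i \<tau>))"
        unfolding \<KK>_def using i that by (intro si.cauchy_schwarz) simp_all
      also have "\<dots> \<le> si.nrm (i \<sigma>) * (norm b * si.nrm (\<phi> 1 (i \<tau>)))"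
        using i that by (intro mult_left_mono nrm_phi_le[OF cstar_correspondence_axioms]) simp_all
      finally show "norm (\<KK> \<sigma> \<tau> b) \<le> norm b * (si.nrm (i \<sigma>) * si.nrm (\<phi> 1 (i \<tau>)))"
        by (simp add: mult_ac)
    qed (use i that in \<open>simp_all add: \<KK>_def inn_phi_alg\<close>)
    then show ?thesis using i that by (simp add: bounded_clinear_def \<KK>_def inn_phi_alg)
  qed
  moreover have "cstar_nonneg (\<Sum>j<n. \<Sum>k<n. star (c j) * \<KK> (\<sigma> j) (\<sigma> k) (star (b j) * b k) * c k)"
    if "\<forall>j<n. \<sigma> j \<in> S" for n :: nat and \<sigma> b c
  proof -
    define z where "z j = mact M (\<phi> (b j) (i (\<sigma> j))) (c j)" for j
    have zin: "z j \<in> car M" if "j \<in> {..<n}" for j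
      using that \<open>\<forall>j<n. \<sigma> j \<in> S\<close> i by (simp add: z_def act_closed)
    have "inn M (z j) (z k) = star (c j) * \<KK> (\<sigma> j) (\<sigma> k) (star (b j) * b k) * c k" if "j < n" "k < n" for j k
      using that \<open>\<forall>j<n. \<sigma> j \<in> S\<close> i
      by (simp add: z_def \<KK>_def si.form_act si.form_act_left inn_phi_phi act_closed)
    then have "(\<Sum>j<n. \<Sum>k<n. star (c j) * \<KK> (\<sigma> j) (\<sigma> k) (star (b j) * b k) * c k)
        = (\<Sum>j<n. \<Sum>k<n. inn M (z j) (z k))" by simp
    then show ?thesis using si.sum_form_nonneg[of "{..<n}" z] zin by simp
  qed
  ultimately have "cpd_kernel S \<KK>" unfolding cpd_kernel_def by blast
  moreover have "inn F (K \<sigma> x) (K \<tau> x') = \<KK> \<sigma> \<tau> (inn E x x')"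
    if "x \<in> car E" "x' \<in> car E" "\<sigma> \<in> S" "\<tau> \<in> S" for x x' \<sigma> \<tau>
  proof -
    have c: "t.cauchy (\<lambda>n. [(x, i \<sigma>)])" "t.cauchy (\<lambda>n. [(x', i \<tau>)])"
      using that i by (auto intro!: t.cauchy_const)
    then have "cls (\<lambda>n. [(x, i \<sigma>)]) \<in> car (interior_tensor E M \<phi>)"
      "cls (\<lambda>n. [(x', i \<tau>)]) \<in> car (interior_tensor E M \<phi>)"
      by (auto simp: car_interior)
    from iso[OF this] have "inn F (K \<sigma> x) (K \<tau> x')
        = inn (interior_tensor E M \<phi>) (cls (\<lambda>n. [(x, i \<sigma>)])) (cls (\<lambda>n. [(x', i \<tau>)]))"
      using that by (simp add: \<nu> flip: elem_tensor_def)
    \<comment> \<open>Elementary tensors are classes of constant sequences, so the limit that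
      defines the inner product is that of a constant.\<close>
    also have "\<dots> = \<KK> \<sigma> \<tau> (inn E x x')"
      using c by (intro inn_interior) (simp_all add: \<KK>_def)
    finally show ?thesis .
  qed
  ultimately show ?thesis unfolding kernel_family_def by blast
qed

section \<open>The correspondence of a completely positive definite kernel\<close>

text \<open>The Hausdorff completion of a semi-inner product module, realized as a module of functions:
  \<open>ev\<close> evaluates against a total family, so that a Cauchy sequence is determined up to null
  sequences by the pointwise limit of its evaluations.\<close>

locale evaluated = semi_inner V add smul act form
  for V :: "'v set" and add smul act and form :: "'v \<Rightarrow> 'v \<Rightarrow> 'c::cstar_algebra" +
  fixes ev :: "'v \<Rightarrow> 's \<Rightarrow> 'b \<Rightarrow> 'c" and nul :: 'v
  assumes nul_in: "nul \<in> V" and ev_nul: "ev nul \<tau> b = 0"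
    and ev_add: "x \<in> V \<Longrightarrow> y \<in> V \<Longrightarrow> ev (add x y) \<tau> b = ev x \<tau> b + ev y \<tau> b"
    and ev_smul: "x \<in> V \<Longrightarrow> ev (smul k x) \<tau> b = scaleC k (ev x \<tau> b)"
    and ev_act: "x \<in> V \<Longrightarrow> ev (act x c) \<tau> b = ev x \<tau> b * c"
    and ev_bounded: "\<exists>C\<ge>0. \<forall>x\<in>V. norm (ev x \<tau> b) \<le> C * nrm x"
    and ev_total: "x \<in> V \<Longrightarrow> (\<And>\<tau> b. (\<lambda>n. ev (s n) \<tau> b) \<longlonglongrightarrow> 0) \<Longrightarrow> (\<And>n. s n \<in> V)
      \<Longrightarrow> (\<lambda>n. form x (s n)) \<longlonglongrightarrow> 0"
begin

definition rep :: "(nat \<Rightarrow> 'v) \<Rightarrow> ('s \<Rightarrow> 'b \<Rightarrow> 'c) \<Rightarrow> bool" where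
  "rep s f \<longleftrightarrow> cauchy s \<and> (\<forall>\<tau> b. (\<lambda>n. ev (s n) \<tau> b) \<longlonglongrightarrow> f \<tau> b)"

text \<open>The elements are functions and not classes of sequences, because the existence claim
  prescribes the carrier type. The price is that inner products are read off from representing
  sequences; \<open>rep_unique\<close> makes this unambiguous.\<close>

definition completion :: "('s \<Rightarrow> 'b \<Rightarrow> 'c, 'c) hmod" where
  "completion = \<lparr> car = {f. \<exists>s. rep s f}, mzero = (\<lambda>_ _. 0), madd = (\<lambda>f g \<tau> b. f \<tau> b + g \<tau> b),
     mscale = (\<lambda>k f \<tau> b. scaleC k (f \<tau> b)), mact = (\<lambda>f c \<tau> b. f \<tau> b * c),
     inn = (\<lambda>f g. THE l. \<forall>s t. rep s f \<longrightarrow> rep t g \<longrightarrow> (\<lambda>n. form (s n) (t n)) \<longlonglongrightarrow> l) \<rparr>"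

lemma completion_simps:
  "f \<in> car completion \<longleftrightarrow> (\<exists>s. rep s f)" "mzero completion = (\<lambda>_ _. 0)"
  "madd completion f g = (\<lambda>\<tau> b. f \<tau> b + g \<tau> b)"
  "mscale completion k f = (\<lambda>\<tau> b. scaleC k (f \<tau> b))"
  "mact completion f c = (\<lambda>\<tau> b. f \<tau> b * c)"
  by (simp_all add: completion_def)

lemma ev_diff: "x \<in> V \<Longrightarrow> y \<in> V \<Longrightarrow> ev (diff x y) \<tau> b = ev x \<tau> b - ev y \<tau> b"
  by (simp add: diff_def ev_add ev_smul)

lemma rep_cauchy: "rep s f \<Longrightarrow> cauchy s" by (simp add: rep_def)

lemma rep_ev: "rep s f \<Longrightarrow> (\<lambda>n. ev (s n) \<tau> b) \<longlonglongrightarrow> f \<tau> b" by (simp add: rep_def)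

lemma rep_const: "x \<in> V \<Longrightarrow> rep (\<lambda>n. x) (ev x)"
  by (simp add: rep_def cauchy_const)

lemma rep_add: "rep s f \<Longrightarrow> rep t g \<Longrightarrow> rep (\<lambda>n. add (s n) (t n)) (\<lambda>\<tau> b. f \<tau> b + g \<tau> b)"
  by (auto simp: rep_def cauchy_add ev_add cauchy_in intro: tendsto_add)

lemma rep_smul: "rep s f \<Longrightarrow> rep (\<lambda>n. smul k (s n)) (\<lambda>\<tau> b. scaleC k (f \<tau> b))"
  by (auto simp: rep_def cauchy_smul ev_smul cauchy_in intro: tendsto_scaleC)

lemma rep_act: "rep s f \<Longrightarrow> rep (\<lambda>n. act (s n) c) (\<lambda>\<tau> b. f \<tau> b * c)"
  by (auto simp: rep_def cauchy_act ev_act cauchy_in intro: tendsto_mult tendsto_const)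

text \<open>For Cauchy sequences, pointwise null implies null in norm: choose N with
  \<open>d n\<close> close to \<open>d N\<close> for large n. Then \<open>form (d n) (d n)\<close>
  is close to \<open>form (d N) (d n)\<close>, which tends to 0 by \<open>ev_total\<close>.\<close>

lemma null_of_ev:
  assumes d: "cauchy d" and ev: "\<And>\<tau> b. (\<lambda>n. ev (d n) \<tau> b) \<longlonglongrightarrow> 0"
  shows "(\<lambda>n. form (d n) (d n)) \<longlonglongrightarrow> 0"
proof (rule LIMSEQ_I)
  fix \<epsilon> :: real assume e: "\<epsilon> > 0"
  obtain B where B: "\<And>n. nrm (d n) \<le> B" using cauchy_bounded[OF d] by blast
  have B0: "B + 1 > 0" using order_trans[OF nrm_nonneg B] by simp
  then obtain N where N: "\<forall>m\<ge>N. \<forall>n\<ge>N. ds (d m) (d n) < \<epsilon> / 2 / (B + 1)"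
    using cauchyD[OF d, of "\<epsilon> / 2 / (B + 1)"] e by auto
  have "(\<lambda>n. form (d N) (d n)) \<longlonglongrightarrow> 0"
    by (rule ev_total) (simp_all add: cauchy_in[OF d] ev)
  then obtain N' where N': "\<forall>n\<ge>N'. norm (form (d N) (d n)) < \<epsilon> / 2"
    using LIMSEQ_D[of _ 0 "\<epsilon>/2"] e by auto
  have "norm (form (d n) (d n) - 0) < \<epsilon>" if n: "n \<ge> max N N'" for n
  proof -
    have "norm (form (d n) (d n) - form (d N) (d n)) \<le> nrm (d n) * ds (d n) (d n) + ds (d n) (d N) * nrm (d n)"
      by (rule norm_form_diff_le) (simp_all add: cauchy_in[OF d])
    also have "\<dots> = ds (d n) (d N) * nrm (d n)" by (simp add: cauchy_in[OF d])
    also have "\<dots> \<le> \<epsilon> / 2 / (B + 1) * (B + 1)"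
      using N[rule_format, of n N] n B[of n] B0 e by (intro mult_mono) simp_all
    also have "\<dots> = \<epsilon> / 2"
      using B0 nonzero_mult_div_cancel_right[of "B + 1" "\<epsilon> / 2"]
      by (simp only: times_divide_eq_left)
    finally have "norm (form (d n) (d n) - form (d N) (d n)) \<le> \<epsilon> / 2" .
    moreover have "norm (form (d N) (d n)) < \<epsilon> / 2" using N' n by simp
    ultimately show ?thesis
      using norm_triangle_ineq[of "form (d n) (d n) - form (d N) (d n)" "form (d N) (d n)"] by simp
  qed
  then show "\<exists>N. \<forall>n\<ge>N. norm (form (d n) (d n) - 0) < \<epsilon>" by blast
qed

lemma nrm_limit_0: "(\<lambda>n. form (d n) (d n)) \<longlonglongrightarrow> 0 \<Longrightarrow> (\<lambda>n. nrm (d n)) \<longlonglongrightarrow> 0"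
  unfolding nrm_def using tendsto_real_sqrt[OF tendsto_norm, of "\<lambda>n. form (d n) (d n)" 0] by simp

lemma rep_unique:
  assumes "rep s f" "rep s' f"
  shows "(\<lambda>n. ds (s n) (s' n)) \<longlonglongrightarrow> 0"
proof -
  have "(\<lambda>n. ev (diff (s n) (s' n)) \<tau> b) \<longlonglongrightarrow> 0" for \<tau> b
    using tendsto_diff[OF rep_ev[OF assms(1)] rep_ev[OF assms(2)], of \<tau> b \<tau> b]
    by (simp add: ev_diff cauchy_in rep_cauchy[OF assms(1)] rep_cauchy[OF assms(2)])
  then show ?thesis unfolding ds_def
    by (intro nrm_limit_0 null_of_ev cauchy_diff rep_cauchy[OF assms(1)] rep_cauchy[OF assms(2)])
qed

lemma inn_completion_lim:
  assumes s: "rep s f" and t: "rep t g"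
  shows "(\<lambda>n. form (s n) (t n)) \<longlonglongrightarrow> inn completion f g"
proof -
  obtain l where l: "(\<lambda>n. form (s n) (t n)) \<longlonglongrightarrow> l"
    using form_convergent[OF rep_cauchy[OF s] rep_cauchy[OF t]] by (auto simp: convergent_def)
  have "(THE l. \<forall>s t. rep s f \<longrightarrow> rep t g \<longrightarrow> (\<lambda>n. form (s n) (t n)) \<longlonglongrightarrow> l) = l"
  proof (rule the_equality)
    show "\<forall>s t. rep s f \<longrightarrow> rep t g \<longrightarrow> (\<lambda>n. form (s n) (t n)) \<longlonglongrightarrow> l"
      using form_limit_cong[OF rep_cauchy[OF s] rep_cauchy rep_cauchy[OF t] rep_cauchy
          rep_unique[OF s] rep_unique[OF t] l] by blast
    show "l' = l" if "\<forall>s t. rep s f \<longrightarrow> rep t g \<longrightarrow> (\<lambda>n. form (s n) (t n)) \<longlonglongrightarrow> l'" for l'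
      using that s t LIMSEQ_unique[OF _ l] by blast
  qed
  then show ?thesis using l by (simp add: completion_def)
qed

lemma inn_completionI:
  "rep s f \<Longrightarrow> rep t g \<Longrightarrow> (\<lambda>n. form (s n) (t n)) \<longlonglongrightarrow> l \<Longrightarrow> inn completion f g = l"
  using inn_completion_lim LIMSEQ_unique by blast

lemma inn_completion_ev: "x \<in> V \<Longrightarrow> y \<in> V \<Longrightarrow> inn completion (ev x) (ev y) = form x y"
  by (rule inn_completionI[OF rep_const rep_const]) simp_all

lemma ev_in: "x \<in> V \<Longrightarrow> ev x \<in> car completion"
  using rep_const by (auto simp: completion_simps)

sublocale c: semi_inner "car completion" "madd completion" "mscale completion" "mact completion"
  "inn completion"
proof
  fix f g h :: "'s \<Rightarrow> 'b \<Rightarrow> 'c" and k c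
  assume "f \<in> car completion"
  then obtain s where s: "rep s f" by (auto simp: completion_simps)
  have sV: "s n \<in> V" for n by (rule cauchy_in[OF rep_cauchy[OF s]])
  show "mscale completion k f \<in> car completion" "mact completion f c \<in> car completion"
    using rep_smul[OF s] rep_act[OF s] by (auto simp: completion_simps)
  show "cstar_nonneg (inn completion f f)"
    by (rule cstar_nonneg_limit[OF inn_completion_lim[OF s s]]) (simp add: form_nonneg sV)
  assume "g \<in> car completion"
  then obtain t where t: "rep t g" by (auto simp: completion_simps)
  have tV: "t n \<in> V" for n by (rule cauchy_in[OF rep_cauchy[OF t]])
  show "madd completion f g \<in> car completion"
    using rep_add[OF s t] by (auto simp: completion_simps)
  note st = inn_completion_lim[OF s t]
  show "inn completion f (mscale completion k g) = scaleC k (inn completion f g)"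
    unfolding completion_simps using tendsto_scaleC[OF st, of k]
    by (intro inn_completionI[OF s rep_smul[OF t]]) (simp add: form_smul sV tV)
  show "inn completion f (mact completion g c) = inn completion f g * c"
    unfolding completion_simps using tendsto_mult[OF st tendsto_const, of c]
    by (intro inn_completionI[OF s rep_act[OF t]]) (simp add: form_act sV tV)
  show "star (inn completion f g) = inn completion g f"
    using tendsto_star[OF st]
    by (intro inn_completionI[OF t s, symmetric]) (simp add: form_star sV tV)
  assume "h \<in> car completion"
  then obtain u where u: "rep u h" by (auto simp: completion_simps)
  have uV: "u n \<in> V" for n by (rule cauchy_in[OF rep_cauchy[OF u]])
  show "inn completion f (madd completion g h) = inn completion f g + inn completion f h"
    unfolding completion_simps using tendsto_add[OF st inn_completion_lim[OF s u]]
    by (intro inn_completionI[OF s rep_add[OF t u]]) (simp add: form_add sV tV uV)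
qed

lemma ds_completion_lim:
  assumes s: "rep s f" and t: "rep t g"
  shows "(\<lambda>n. ds (s n) (t n)) \<longlonglongrightarrow> c.ds f g"
proof -
  have "rep (\<lambda>n. diff (s n) (t n)) (c.diff f g)"
    unfolding diff_def c.diff_def completion_simps by (intro rep_add rep_smul s t)
  from inn_completion_lim[OF this this] show ?thesis
    unfolding ds_def c.ds_def nrm_def c.nrm_def by (intro tendsto_intros)
qed

lemma ds_completion_ev: "x \<in> V \<Longrightarrow> y \<in> V \<Longrightarrow> c.ds (ev x) (ev y) = ds x y"
  using ds_completion_lim[OF rep_const rep_const, of x y] LIMSEQ_unique[OF _ tendsto_const] by metis

lemma ev_dense:
  assumes "f \<in> car completion" "\<epsilon> > 0"
  obtains x where "x \<in> V" "c.ds f (ev x) < \<epsilon>"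
proof -
  obtain s where s: "rep s f" using assms(1) by (auto simp: completion_simps)
  obtain N where N: "\<forall>m\<ge>N. \<forall>n\<ge>N. ds (s m) (s n) < \<epsilon>/2"
    using cauchyD[OF rep_cauchy[OF s], of "\<epsilon>/2"] assms(2) by auto
  have sN: "s N \<in> V" by (rule cauchy_in[OF rep_cauchy[OF s]])
  have "c.ds f (ev (s N)) \<le> \<epsilon>/2"
    by (rule LIMSEQ_le_const2[OF ds_completion_lim[OF s rep_const[OF sN]]])
      (use N in \<open>auto intro!: exI[of _ N] less_imp_le\<close>)
  then show ?thesis using that[OF sN] assms(2) by simp
qed

text \<open>Approximating the n-th term by some \<open>ev (x n)\<close> up to 1/(n+1) gives a
  sequence \<open>x\<close> that is Cauchy in \<open>V\<close>. Its evaluations converge pointwise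
  because they are bounded functionals, and the limit function is the element sought.\<close>

lemma completion_complete:
  assumes f: "c.cauchy f"
  shows "\<exists>l\<in>car completion. (\<lambda>n. c.ds (f n) l) \<longlonglongrightarrow> 0"
proof -
  have "\<exists>x\<in>V. c.ds (f n) (ev x) < inverse (real (Suc n))" for n
    by (rule ev_dense[OF c.cauchy_in[OF f, of n], of "inverse (real (Suc n))"]) auto
  then obtain x where x: "\<And>n. x n \<in> V" "\<And>n. c.ds (f n) (ev (x n)) < inverse (real (Suc n))"
    by metis
  have fx: "(\<lambda>n. c.ds (f n) (ev (x n))) \<longlonglongrightarrow> 0"
    by (rule tendsto_sandwich[OF _ _ tendsto_const LIMSEQ_inverse_real_of_nat])
      (use x(2) in \<open>auto intro!: always_eventually less_imp_le\<close>)
  have cx: "c.cauchy (\<lambda>n. ev (x n))"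
    by (rule c.cauchy_close[OF f _ fx]) (simp add: ev_in x)
  have cauchy_x: "cauchy x"
    by (rule cauchyI) (use x(1) c.cauchyD[OF cx] in \<open>simp_all add: ds_completion_ev\<close>)
  have "convergent (\<lambda>n. ev (x n) \<tau> b)" for \<tau> b
  proof -
    obtain C where C: "C \<ge> 0" "\<And>y. y \<in> V \<Longrightarrow> norm (ev y \<tau> b) \<le> C * nrm y"
      using ev_bounded[of \<tau> b] by blast
    have "Cauchy (\<lambda>n. ev (x n) \<tau> b)"
    proof (rule CauchyI)
      fix \<epsilon> :: real assume e: "\<epsilon> > 0"
      obtain N where N: "\<forall>m\<ge>N. \<forall>n\<ge>N. ds (x m) (x n) < \<epsilon> / (C + 1)"
        using cauchyD[OF cauchy_x, of "\<epsilon> / (C + 1)"] e C(1) by auto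
      have "norm (ev (x m) \<tau> b - ev (x n) \<tau> b) < \<epsilon>" if "m \<ge> N" "n \<ge> N" for m n
      proof -
        have "norm (ev (x m) \<tau> b - ev (x n) \<tau> b) \<le> C * ds (x m) (x n)"
          using C(2)[of "diff (x m) (x n)"] x(1) by (simp add: ev_diff ds_def)
        also have "\<dots> \<le> (C + 1) * ds (x m) (x n)" by (intro mult_right_mono) simp_all
        also have "\<dots> < \<epsilon>"
          using N[rule_format, OF that] C(1) by (simp add: pos_less_divide_eq mult.commute)
        finally show ?thesis .
      qed
      then show "\<exists>M. \<forall>m\<ge>M. \<forall>n\<ge>M. norm (ev (x m) \<tau> b - ev (x n) \<tau> b) < \<epsilon>" by blast
    qed
    then show ?thesis by (rule Cauchy_convergent)
  qed
  then have "rep x (\<lambda>\<tau> b. lim (\<lambda>n. ev (x n) \<tau> b))"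
    using cauchy_x by (simp add: rep_def convergent_LIMSEQ_iff)
  then obtain l where l: "rep x l" by blast
  then have lin: "l \<in> car completion" by (auto simp: completion_simps)
  have "(\<lambda>k. c.ds (ev (x k)) l) \<longlonglongrightarrow> 0"
  proof (rule LIMSEQ_I)
    fix \<epsilon> :: real assume e: "\<epsilon> > 0"
    obtain N where N: "\<forall>m\<ge>N. \<forall>n\<ge>N. ds (x m) (x n) < \<epsilon>/2"
      using cauchyD[OF cauchy_x, of "\<epsilon>/2"] e by auto
    have "c.ds (ev (x k)) l \<le> \<epsilon>/2" if "k \<ge> N" for k
      by (rule LIMSEQ_le_const2[OF ds_completion_lim[OF rep_const[OF x(1)] l]])
        (use N that in \<open>auto intro!: exI[of _ N] less_imp_le\<close>)
    then have "\<forall>k\<ge>N. norm (c.ds (ev (x k)) l - 0) < \<epsilon>" using e by fastforce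
    then show "\<exists>N. \<forall>k\<ge>N. norm (c.ds (ev (x k)) l - 0) < \<epsilon>" by blast
  qed
  from c.ds_limit_trans[OF f cx c.cauchy_const[OF lin] fx this] lin show ?thesis by blast
qed

lemma hilbert_module_completion: "hilbert_module completion"
proof
  show "mzero completion \<in> car completion"
    using rep_const[OF nul_in] by (auto simp: completion_simps ev_nul[abs_def] intro!: exI)
  show "x = mzero completion" if x: "x \<in> car completion" "inn completion x x = 0" for x
  proof -
    obtain s where s: "rep s x" using x(1) by (auto simp: completion_simps)
    have "(\<lambda>n. nrm (s n)) \<longlonglongrightarrow> 0"
      using nrm_limit_0 inn_completion_lim[OF s s] x(2) by simp
    have "x \<tau> b = 0" for \<tau> b
    proof -
      obtain C where C: "C \<ge> 0" "\<And>y. y \<in> V \<Longrightarrow> norm (ev y \<tau> b) \<le> C * nrm y"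
        using ev_bounded[of \<tau> b] by blast
      have "(\<lambda>n. ev (s n) \<tau> b) \<longlonglongrightarrow> 0"
        by (rule tendsto_0_le[OF \<open>(\<lambda>n. nrm (s n)) \<longlonglongrightarrow> 0\<close>, of _ C])
          (use C(2) cauchy_in[OF rep_cauchy[OF s]] in \<open>auto simp: mult.commute\<close>)
      then show ?thesis using rep_ev[OF s] LIMSEQ_unique by blast
    qed
    then show ?thesis by (auto simp: completion_simps)
  qed
  show "\<exists>y\<in>car completion. madd completion x y = mzero completion" if "x \<in> car completion" for x
    using c.smul_in[OF that, of "- 1"]
    by (intro bexI[of _ "mscale completion (- 1) x"]) (simp_all add: completion_simps(2-5))
  have ds: "mnorm completion (mdiff completion f g) = c.ds f g" for f g
    by (simp add: mnorm_def mdiff_def c.ds_def c.diff_def c.nrm_def)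
  show "\<exists>l\<in>car completion. (\<lambda>n. mnorm completion (mdiff completion (s n) l)) \<longlonglongrightarrow> 0"
    if "\<And>n. s n \<in> car completion"
      "\<forall>\<epsilon>>0. \<exists>N. \<forall>m\<ge>N. \<forall>n\<ge>N. mnorm completion (mdiff completion (s m) (s n)) < \<epsilon>" for s
    using that unfolding ds by (intro completion_complete c.cauchyI) auto
qed (simp_all add: c.form_add c.form_smul c.form_act c.form_star c.form_nonneg,
  simp_all add: completion_simps(2-5) scaleC_scaleC scaleC_add_left scaleC_add_right
    mult_scaleC_left mult_scaleC_right distrib_left distrib_right mult.assoc add_ac)

end

text \<open>A list of triples \<open>(\<sigma>, b, \<gamma>)\<close> stands for the sum of the elements \<open>b \<ii>(\<sigma>) \<gamma>\<close>. Letting \<open>\<gamma>\<close> range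
  over the unitization of \<open>\<C>\<close> puts \<open>\<ii>(\<sigma>)\<close> itself among these sums.\<close>

locale cpd =
  fixes S :: "'s set" and \<KK> :: "'s \<Rightarrow> 's \<Rightarrow> 'b::{cstar_algebra,monoid_mult} \<Rightarrow> 'c::cstar_algebra"
  assumes cpd: "cpd_kernel S \<KK>"
begin

lemma kernel_linear:
  assumes "\<sigma> \<in> S" "\<tau> \<in> S"
  shows "\<KK> \<sigma> \<tau> (a + b) = \<KK> \<sigma> \<tau> a + \<KK> \<sigma> \<tau> b" "\<KK> \<sigma> \<tau> (scaleC k a) = scaleC k (\<KK> \<sigma> \<tau> a)"
proof -
  have "bounded_clinear (\<KK> \<sigma> \<tau>)" using cpd assms unfolding cpd_kernel_def by blast
  then show "\<KK> \<sigma> \<tau> (a + b) = \<KK> \<sigma> \<tau> a + \<KK> \<sigma> \<tau> b" "\<KK> \<sigma> \<tau> (scaleC k a) = scaleC k (\<KK> \<sigma> \<tau> a)"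
    unfolding bounded_clinear_def by (simp_all add: linear_add[OF bounded_linear.linear])
qed

section \<open>Formal sums over a kernel and their form\<close>

definition gsums :: "('s \<times> 'b \<times> 'c unitized) list set" where
  "gsums = {L. fst ` set L \<subseteq> S}"

definition uform :: "('s \<times> 'b \<times> 'c unitized) list \<Rightarrow> ('s \<times> 'b \<times> 'c unitized) list \<Rightarrow> 'c unitized" where
  "uform L L' = (\<Sum>(\<sigma>, b, \<gamma>)\<leftarrow>L. \<Sum>(\<tau>, b', \<gamma>')\<leftarrow>L'. star \<gamma> * emb (\<KK> \<sigma> \<tau> (star b * b')) * \<gamma>')"

text \<open>Every summand of \<open>uform\<close> has a factor in \<C>, an ideal of the unitization,
  so \<open>alg\<close> discards nothing; see \<open>emb_gform\<close>.\<close>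

definition gform where "gform L L' = alg (uform L L')"

definition lsmul :: "complex \<Rightarrow> ('s \<times> 'b \<times> 'c unitized) list \<Rightarrow> ('s \<times> 'b \<times> 'c unitized) list" where
  "lsmul k = map (\<lambda>(\<sigma>, b, \<gamma>). (\<sigma>, b, scaleC k \<gamma>))"
definition ract :: "('s \<times> 'b \<times> 'c unitized) list \<Rightarrow> 'c \<Rightarrow> ('s \<times> 'b \<times> 'c unitized) list" where
  "ract L c = map (\<lambda>(\<sigma>, b, \<gamma>). (\<sigma>, b, \<gamma> * emb c)) L"
definition lact :: "'b \<Rightarrow> ('s \<times> 'b \<times> 'c unitized) list \<Rightarrow> ('s \<times> 'b \<times> 'c unitized) list" where
  "lact a = map (\<lambda>(\<sigma>, b, \<gamma>). (\<sigma>, a * b, \<gamma>))"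

lemma gsums_simps [simp]:
  "[] \<in> gsums" "p # L \<in> gsums \<longleftrightarrow> fst p \<in> S \<and> L \<in> gsums" "L @ L' \<in> gsums \<longleftrightarrow> L \<in> gsums \<and> L' \<in> gsums"
  "lsmul k L \<in> gsums \<longleftrightarrow> L \<in> gsums" "ract L c \<in> gsums \<longleftrightarrow> L \<in> gsums" "lact a L \<in> gsums \<longleftrightarrow> L \<in> gsums"
  by (auto simp: gsums_def lsmul_def ract_def lact_def image_image case_prod_unfold)

lemma uform_simps [simp]:
  "uform [] L = 0" "uform L [] = 0"
  "uform (L1 @ L2) L = uform L1 L + uform L2 L" "uform L (L1 @ L2) = uform L L1 + uform L L2"
  by (simp_all add: uform_def case_prod_unfold sum_list_addf)

lemma uform_single [simp]:
  "uform [(\<sigma>, b, \<gamma>)] [(\<tau>, b', \<gamma>')] = star \<gamma> * emb (\<KK> \<sigma> \<tau> (star b * b')) * \<gamma>'"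
  by (simp add: uform_def)

lemma uform_Cons: "uform (p # L) L' = uform [p] L' + uform L L'"
  using uform_simps(3)[of "[p]" L L'] by simp

lemma uform_Cons_right: "uform L (p # L') = uform L [p] + uform L L'"
  using uform_simps(4)[of L "[p]" L'] by simp

text \<open>Identities additive in both arguments need to be checked on single generators
  only.\<close>

lemma uform_induct:
  assumes "L \<in> gsums" "L' \<in> gsums"
    and zero: "\<And>L. P [] L" "\<And>L. P L []"
    and add: "\<And>L1 L2 L. P L1 L \<Longrightarrow> P L2 L \<Longrightarrow> P (L1 @ L2) L"
      "\<And>L1 L2 L. P L L1 \<Longrightarrow> P L L2 \<Longrightarrow> P L (L1 @ L2)"
    and single: "\<And>\<sigma> b \<gamma> \<tau> b' \<gamma>'. \<sigma> \<in> S \<Longrightarrow> \<tau> \<in> S \<Longrightarrow> P [(\<sigma>, b, \<gamma>)] [(\<tau>, b', \<gamma>')]"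
  shows "P L L'"
proof -
  have 1: "P [(\<sigma>, b, \<gamma>)] L'" if "\<sigma> \<in> S" for \<sigma> b \<gamma>
    using assms(2)
  proof (induction L')
    case (Cons p L')
    then show ?case
      using add(2)[of "[(\<sigma>, b, \<gamma>)]" "[p]" L'] single[OF that, of "fst p" b \<gamma> "fst (snd p)" "snd (snd p)"]
      by simp
  qed (rule zero)
  show ?thesis using assms(1)
  proof (induction L)
    case (Cons p L)
    then show ?case
      using add(1)[of "[p]" L' L] 1[of "fst p" "fst (snd p)" "snd (snd p)"] by simp
  qed (rule zero)
qed

lemma scal_uform: "L \<in> gsums \<Longrightarrow> L' \<in> gsums \<Longrightarrow> scal (uform L L') = 0"
  by (rule uform_induct[where P="\<lambda>L L'. scal (uform L L') = 0"]) simp_all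

lemma emb_gform: "L \<in> gsums \<Longrightarrow> L' \<in> gsums \<Longrightarrow> emb (gform L L') = uform L L'"
  unfolding gform_def by (rule emb_alg) (rule scal_uform)

lemma map_append_simps [simp]:
  "lsmul k [] = []" "lsmul k (L @ L') = lsmul k L @ lsmul k L'" "lsmul k [(\<sigma>, b, \<gamma>)] = [(\<sigma>, b, scaleC k \<gamma>)]"
  "ract [] c = []" "ract (L @ L') c = ract L c @ ract L' c" "ract [(\<sigma>, b, \<gamma>)] c = [(\<sigma>, b, \<gamma> * emb c)]"
  "lact a [] = []" "lact a (L @ L') = lact a L @ lact a L'" "lact a [(\<sigma>, b, \<gamma>)] = [(\<sigma>, a * b, \<gamma>)]"
  by (simp_all add: lsmul_def ract_def lact_def)

lemma uform_lsmul: "L \<in> gsums \<Longrightarrow> L' \<in> gsums \<Longrightarrow> uform L (lsmul k L') = scaleC k (uform L L')"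
  by (rule uform_induct[where P="\<lambda>L L'. uform L (lsmul k L') = scaleC k (uform L L')"])
    (simp_all add: scaleC_add_right mult_scaleC_right)

lemma uform_ract: "L \<in> gsums \<Longrightarrow> L' \<in> gsums \<Longrightarrow> uform L (ract L' c) = uform L L' * emb c"
  by (rule uform_induct[where P="\<lambda>L L'. uform L (ract L' c) = uform L L' * emb c"])
    (simp_all add: distrib_right mult.assoc)

lemma uform_lact:
  "L \<in> gsums \<Longrightarrow> L' \<in> gsums \<Longrightarrow> uform (lact a L) L' = uform L (lact (star a) L')"
  by (rule uform_induct[where P="\<lambda>L L'. uform (lact a L) L' = uform L (lact (star a) L')"])
    (simp_all add: star_mult mult.assoc)

lemma uform_lact_add:
  "L \<in> gsums \<Longrightarrow> L' \<in> gsums \<Longrightarrow> uform L (lact (a + b) L') = uform L (lact a L') + uform L (lact b L')"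
  by (rule uform_induct[where P="\<lambda>L L'. uform L (lact (a + b) L') = uform L (lact a L') + uform L (lact b L')"])
    (simp_all add: distrib_left distrib_right kernel_linear emb_simps)

lemma uform_lact_scaleC:
  "L \<in> gsums \<Longrightarrow> L' \<in> gsums \<Longrightarrow> uform L (lact (scaleC k a) L') = scaleC k (uform L (lact a L'))"
  by (rule uform_induct[where P="\<lambda>L L'. uform L (lact (scaleC k a) L') = scaleC k (uform L (lact a L'))"])
    (simp_all add: scaleC_add_right kernel_linear emb_simps mult_scaleC_left mult_scaleC_right)

lemma lact_lact: "lact a (lact b L) = lact (a * b) L"
  by (simp add: lact_def case_prod_unfold mult.assoc)

lemma lact_1: "lact 1 L = L"
  by (simp add: lact_def case_prod_unfold map_idI)

text \<open>Compressing by \<open>u\<close> in \<C> turns each unitized coefficient \<gamma> into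
  \<gamma> u, which lies in \<C>. There the CPD condition applies, and
  \<open>cstar_nonneg_of_compressions\<close> removes \<open>u\<close> again.\<close>

lemma gform_nonneg:
  assumes "L \<in> gsums"
  shows "cstar_nonneg (gform L L)"
proof (rule cstar_nonneg_of_compressions)
  fix u :: 'c
  define \<sigma> where "\<sigma> j = fst (L ! j)" for j
  define b where "b j = fst (snd (L ! j))" for j
  define c where "c j = alg (snd (snd (L ! j)) * emb u)" for j
  have c: "emb (c j) = snd (snd (L ! j)) * emb u" for j
    unfolding c_def by (rule emb_alg) simp
  have "\<sigma> j \<in> S" if "j < length L" for j
    using assms nth_mem[OF that] unfolding gsums_def \<sigma>_def by auto
  then have pos: "cstar_nonneg (\<Sum>j<length L. \<Sum>k<length L. star (c j) * \<KK> (\<sigma> j) (\<sigma> k) (star (b j) * b k) * c k)"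
    using cpd unfolding cpd_kernel_def by blast
  have "emb (star u * gform L L * u) = star (emb u) * uform L L * emb u"
    by (simp add: emb_simps emb_gform assms)
  also have "uform L L = (\<Sum>j<length L. \<Sum>k<length L.
      star (snd (snd (L ! j))) * emb (\<KK> (\<sigma> j) (\<sigma> k) (star (b j) * b k)) * snd (snd (L ! k)))"
    by (simp add: uform_def case_prod_unfold sum_list_sum_nth atLeast0LessThan \<sigma>_def b_def)
  also have "star (emb u) * \<dots> * emb u = (\<Sum>j<length L. \<Sum>k<length L.
      star (emb (c j)) * emb (\<KK> (\<sigma> j) (\<sigma> k) (star (b j) * b k)) * emb (c k))"
    by (simp add: c sum_distrib_left sum_distrib_right star_mult mult.assoc)
  also have "\<dots> = emb (\<Sum>j<length L. \<Sum>k<length L. star (c j) * \<KK> (\<sigma> j) (\<sigma> k) (star (b j) * b k) * c k)"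
    by (simp add: linear_sum[OF bounded_linear.linear[OF bounded_linear_emb]] emb_simps)
  finally have "star u * gform L L * u = (\<Sum>j<length L. \<Sum>k<length L. star (c j) * \<KK> (\<sigma> j) (\<sigma> k) (star (b j) * b k) * c k)"
    by (simp only: emb_def unitized.inject)
  then show "cstar_nonneg (star u * gform L L * u)" using pos by simp
qed

text \<open>Hermitian symmetry follows from positivity by polarization. The form at \<ii>(\<sigma>)
  + b \<ii>(\<tau>) \<gamma> is self-adjoint. With A = \<open>\<KK> \<sigma> \<tau> b\<close> and B
  = \<open>\<KK> \<tau> \<sigma> (star b)\<close>, the choice \<gamma> = 1 makes A + B self-adjoint,
  and \<gamma> = \<i> makes \<i> (A - B) self-adjoint; together the adjoint of A is B.\<close>

lemma kernel_star:
  assumes "\<sigma> \<in> S" "\<tau> \<in> S"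
  shows "star (\<KK> \<sigma> \<tau> b) = \<KK> \<tau> \<sigma> (star b)"
proof -
  let ?A = "\<KK> \<sigma> \<tau> b" and ?B = "\<KK> \<tau> \<sigma> (star b)"
  let ?D = "\<KK> \<sigma> \<sigma> 1" and ?D' = "\<KK> \<tau> \<tau> (star b * b)"
  have D: "star ?D = ?D"
    using cstar_nonneg_star[OF gform_nonneg[of "[(\<sigma>, 1, 1)]"]] assms by (simp add: gform_def)
  have D': "star ?D' = ?D'"
    using cstar_nonneg_star[OF gform_nonneg[of "[(\<tau>, b, 1)]"]] assms by (simp add: gform_def)
  have gf: "gform [(\<sigma>, 1, 1), (\<tau>, b, \<gamma>)] [(\<sigma>, 1, 1), (\<tau>, b, \<gamma>)]
      = ?D + alg (emb ?A * \<gamma>) + alg (star \<gamma> * emb ?B) + alg (star \<gamma> * emb ?D' * \<gamma>)" for \<gamma>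
    by (simp add: gform_def uform_def)
  have "star (?D + ?A + ?B + ?D') = ?D + ?A + ?B + ?D'"
    using cstar_nonneg_star[OF gform_nonneg[of "[(\<sigma>, 1, 1), (\<tau>, b, 1)]"]] assms by (simp add: gf)
  then have 1: "star ?A + star ?B = ?A + ?B"
    by (simp add: star_add D D')
  have "star (?D + scaleC \<i> ?A - scaleC \<i> ?B + ?D') = ?D + scaleC \<i> ?A - scaleC \<i> ?B + ?D'"
    using cstar_nonneg_star[OF gform_nonneg[of "[(\<sigma>, 1, 1), (\<tau>, b, scaleC \<i> 1)]"]] assms
    by (simp add: gf star_scaleC mult_scaleC_left mult_scaleC_right scaleC_scaleC)
  then have "scaleC \<i> (star ?B - star ?A) = scaleC \<i> (?A - ?B)"
    by (simp add: star_add star_diff star_scaleC D D' scaleC_diff_right algebra_simps)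
  then have "scaleC (- \<i>) (scaleC \<i> (star ?B - star ?A)) = scaleC (- \<i>) (scaleC \<i> (?A - ?B))"
    by (rule arg_cong)
  then have 2: "star ?B - star ?A = ?A - ?B" by (simp add: scaleC_scaleC)
  have "2 *\<^sub>R star ?A = (star ?A + star ?B) - (star ?B - star ?A)" by (simp add: scaleR_2)
  also have "\<dots> = 2 *\<^sub>R ?B" by (simp add: 1 2 scaleR_2)
  finally show ?thesis by simp
qed

lemma uform_star: "L \<in> gsums \<Longrightarrow> L' \<in> gsums \<Longrightarrow> star (uform L L') = uform L' L"
  by (rule uform_induct[where P="\<lambda>L L'. star (uform L L') = uform L' L"])
    (simp_all add: star_add star_mult star_star kernel_star mult.assoc flip: emb_simps(6))

sublocale g: semi_inner gsums append lsmul ract gform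
proof
  fix L L' L'' :: "('s \<times> 'b \<times> 'c unitized) list" and k c
  assume L: "L \<in> gsums" and L': "L' \<in> gsums"
  show "gform L (lsmul k L') = scaleC k (gform L L')"
    by (simp add: gform_def uform_lsmul L L')
  show "gform L (ract L' c) = gform L L' * c"
    by (simp add: gform_def uform_ract L L' alg_mult scal_uform)
  show "star (gform L L') = gform L' L"
    using uform_star[OF L L'] by (simp add: gform_def flip: scaleC_star_sel(3))
qed (simp_all add: gform_def gform_nonneg[unfolded gform_def])

text \<open>Off \<open>S\<close> nothing is known of the kernel, so the evaluation is set to 0
  there.\<close>

definition gev where "gev L \<tau> b = (if \<tau> \<in> S then gform [(\<tau>, b, 1)] L else 0)"

sublocale ev: evaluated gsums append lsmul ract gform gev "[]"
proof
  fix x y :: "('s \<times> 'b \<times> 'c unitized) list" and \<tau> b k c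
  show "gev [] \<tau> b = 0" by (simp add: gev_def gform_def)
  have "norm (gev x \<tau> b) \<le> (if \<tau> \<in> S then g.nrm [(\<tau>, b, 1)] else 0) * g.nrm x" if "x \<in> gsums" for x
    using g.cauchy_schwarz[of "[(\<tau>, b, 1)]" x] that by (simp add: gev_def)
  then show "\<exists>C\<ge>0. \<forall>x\<in>gsums. norm (gev x \<tau> b) \<le> C * g.nrm x"
    by (intro exI[of _ "if \<tau> \<in> S then g.nrm [(\<tau>, b, 1)] else 0"]) simp
  assume x: "x \<in> gsums"
  show "gev (lsmul k x) \<tau> b = scaleC k (gev x \<tau> b)" "gev (ract x c) \<tau> b = gev x \<tau> b * c"
    using x by (simp_all add: gev_def g.form_simps)
  show "(\<lambda>n. gform x (s n)) \<longlonglongrightarrow> 0" if ev: "\<And>\<tau> b. (\<lambda>n. gev (s n) \<tau> b) \<longlonglongrightarrow> 0" and s: "\<And>n. s n \<in> gsums" for s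
    using x
  proof (induction x)
    case Nil
    then show ?case by (simp add: gform_def)
  next
    case (Cons p x)
    obtain \<sigma> a \<gamma> where p: "p = (\<sigma>, a, \<gamma>)" by (cases p)
    have \<sigma>: "\<sigma> \<in> S" using Cons.prems by (simp add: p)
    \<comment> \<open>A general left coefficient \<gamma> comes out as a factor, so pairings with
      all generators are governed by the evaluations, whose coefficient is 1.\<close>
    have "uform [p] L = star \<gamma> * uform [(\<sigma>, a, 1)] L" for L
      by (simp add: p uform_def case_prod_unfold sum_list_const_mult mult.assoc)
    then have "gform [p] (s n) = alg (star \<gamma> * emb (gev (s n) \<sigma> a))" for n
      using \<sigma> s[of n] by (simp add: gform_def gev_def emb_alg scal_uform)
    then have eq: "gform (p # x) (s n) = alg (star \<gamma> * emb (gev (s n) \<sigma> a)) + gform x (s n)" for n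
      by (simp add: gform_def uform_Cons[of p x])
    have "(\<lambda>n. emb (gev (s n) \<sigma> a)) \<longlonglongrightarrow> emb 0"
      by (rule bounded_linear.tendsto[OF bounded_linear_emb ev])
    then have "(\<lambda>n. alg (star \<gamma> * emb (gev (s n) \<sigma> a))) \<longlonglongrightarrow> alg (star \<gamma> * 0)"
      by (intro bounded_linear.tendsto[OF bounded_linear_alg] tendsto_intros) (simp add: emb_simps)
    from tendsto_add[OF this Cons.IH] Cons.prems show ?case by (simp add: eq)
  qed
  assume "y \<in> gsums"
  then show "gev (x @ y) \<tau> b = gev x \<tau> b + gev y \<tau> b"
    using x by (simp add: gev_def g.form_simps)
qed simp

abbreviation corr where "corr \<equiv> ev.completion"

text \<open>An element y is stored as the function \<langle>b \<ii>(\<tau>), y\<rangle> of \<tau>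
  and b; moving \<open>a\<close> to the left side of the inner product turns it into
  \<open>star a\<close> in front of b.\<close>

definition corr_act :: "'b \<Rightarrow> ('s \<Rightarrow> 'b \<Rightarrow> 'c) \<Rightarrow> 's \<Rightarrow> 'b \<Rightarrow> 'c" where
  "corr_act a f \<tau> b = f \<tau> (star a * b)"

definition corr_gen :: "'s \<Rightarrow> 's \<Rightarrow> 'b \<Rightarrow> 'c" where
  "corr_gen \<sigma> = gev [(\<sigma>, 1, 1)]"

lemma gform_lact: "L \<in> gsums \<Longrightarrow> L' \<in> gsums \<Longrightarrow> gform (lact a L) L' = gform L (lact (star a) L')"
  by (simp add: gform_def uform_lact)

lemma gev_lact: "L \<in> gsums \<Longrightarrow> gev (lact a L) \<tau> b = gev L \<tau> (star a * b)"
  using gform_lact[of "[(\<tau>, b, 1)]" L "star a"] by (simp add: gev_def star_star)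

text \<open>The argument of \<open>nrm_phi_le\<close>, carried out on formal sums before there is a
  correspondence. Here 1 acts identically. The bound lets the left action pass to Cauchy
  sequences.\<close>

lemma nrm_lact_le:
  assumes L: "L \<in> gsums"
  shows "g.nrm (lact a L) \<le> norm a * g.nrm L"
proof -
  let ?q = "\<lambda>a. gform L (lact a L)"
  have q: "gform (lact a L) (lact a L) = ?q (star a * a)" for a
    by (simp add: gform_lact lact_lact L)
  have qd: "?q (a - b) = ?q a - ?q b" for a b
    using uform_lact_add[OF L L, of "a - b" b] by (simp add: gform_def)
  have qr: "?q (r *\<^sub>R 1) = r *\<^sub>R gform L L" for r
    using uform_lact_scaleC[OF L L, of "complex_of_real r" 1] by (simp add: gform_def scaleC_of_real lact_1)
  have "cstar_nonneg (norm (star a * a) *\<^sub>R (star 1 * 1) - star 1 * (star a * a) * 1)"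
    by (rule cstar_nonneg_conj_le) (simp add: star_mult star_star)
  then obtain d where "(norm a)\<^sup>2 *\<^sub>R 1 - star a * a = star d * d"
    by (auto simp: cstar_nonneg_def cstar_identity)
  then have "(norm a)\<^sup>2 *\<^sub>R gform L L - gform (lact a L) (lact a L) = gform (lact d L) (lact d L)"
    by (simp add: q flip: qr qd)
  then have "norm (gform (lact a L) (lact a L)) \<le> norm ((norm a)\<^sup>2 *\<^sub>R gform L L)"
    using L by (intro cstar_nonneg_norm_le) (simp_all add: g.form_nonneg)
  then have "(g.nrm (lact a L))\<^sup>2 \<le> (norm a * g.nrm L)\<^sup>2"
    by (simp add: g.nrm_sq power_mult_distrib)
  then show ?thesis by (rule power2_le_imp_le) simp
qed

lemma rep_lact:
  assumes "ev.rep s f"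
  shows "ev.rep (\<lambda>n. lact a (s n)) (corr_act a f)"
proof -
  have ds: "g.ds (lact a x) (lact a y) \<le> g.ds x y * norm a" if "x \<in> gsums" "y \<in> gsums" for x y
  proof -
    have "g.diff (lact a x) (lact a y) = lact a (g.diff x y)"
      by (simp add: g.diff_def lact_def lsmul_def case_prod_unfold)
    then show ?thesis
      using nrm_lact_le[of "g.diff x y" a] that by (simp add: g.ds_def mult.commute)
  qed
  have "g.cauchy (\<lambda>n. lact a (s n))"
    by (rule g.cauchy_lipschitz[OF ev.rep_cauchy[OF assms] _ ds]) simp_all
  then show ?thesis
    using ev.rep_ev[OF assms] g.cauchy_in[OF ev.rep_cauchy[OF assms]]
    by (simp add: ev.rep_def gev_lact corr_act_def)
qed

lemma cstar_correspondence_corr: "cstar_correspondence corr corr_act"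
proof -
  interpret hilbert_module corr by (rule ev.hilbert_module_completion)
  have in': "corr_act a f \<in> car corr" if "f \<in> car corr" for a f
    using that rep_lact by (auto simp: ev.completion_simps)
  show ?thesis
  proof
    fix a b k
    show "is_adjoint corr (corr_act a) (corr_act (star a))"
      unfolding is_adjoint_def
    proof (intro conjI ballI)
      fix f g :: "'s \<Rightarrow> 'b \<Rightarrow> 'c"
      assume "f \<in> car corr" "g \<in> car corr"
      then obtain s t where s: "ev.rep s f" and t: "ev.rep t g" by (auto simp: ev.completion_simps)
      have "(\<lambda>n. gform (s n) (lact (star a) (t n))) \<longlonglongrightarrow> inn corr f (corr_act (star a) g)"
        by (rule ev.inn_completion_lim[OF s rep_lact[OF t]])
      then show "inn corr (corr_act a f) g = inn corr f (corr_act (star a) g)"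
        using g.cauchy_in[OF ev.rep_cauchy[OF s]] g.cauchy_in[OF ev.rep_cauchy[OF t]]
        by (intro ev.inn_completionI[OF rep_lact[OF s] t]) (simp add: gform_lact)
    qed (use in' in auto)
    fix f assume "f \<in> car corr"
    then obtain s where s: "ev.rep s f" by (auto simp: ev.completion_simps)
    have sin: "s n \<in> gsums" for n by (rule g.cauchy_in[OF ev.rep_cauchy[OF s]])
    have lim: "(\<lambda>n. gev (lact a (s n)) \<tau> c) \<longlonglongrightarrow> corr_act a f \<tau> c" for a \<tau> c
      by (rule ev.rep_ev[OF rep_lact[OF s]])
    \<comment> \<open>An arbitrary function need not be additive in its second argument. For
      elements of the carrier this is inherited from representing sequences.\<close>
    have "gev (lact (a + b) (s n)) \<tau> c = gev (lact a (s n)) \<tau> c + gev (lact b (s n)) \<tau> c" for n \<tau> c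
      by (simp add: gev_def gform_def uform_lact_add sin)
    then have "corr_act (a + b) f \<tau> c = corr_act a f \<tau> c + corr_act b f \<tau> c" for \<tau> c
      using lim[of "a + b" \<tau> c] tendsto_add[OF lim[of a \<tau> c] lim[of b \<tau> c]] LIMSEQ_unique by simp
    then show "corr_act (a + b) f = madd corr (corr_act a f) (corr_act b f)"
      by (simp add: ev.completion_simps fun_eq_iff)
    have "gev (lact (scaleC k a) (s n)) \<tau> c = scaleC k (gev (lact a (s n)) \<tau> c)" for n \<tau> c
      by (simp add: gev_def gform_def uform_lact_scaleC sin)
    then have "corr_act (scaleC k a) f \<tau> c = scaleC k (corr_act a f \<tau> c)" for \<tau> c
      using lim[of "scaleC k a" \<tau> c] tendsto_scaleC[OF lim[of a \<tau> c], of k] LIMSEQ_unique by simp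
    then show "corr_act (scaleC k a) f = mscale corr k (corr_act a f)"
      by (simp add: ev.completion_simps fun_eq_iff)
    show "corr_act (a * b) f = corr_act a (corr_act b f)"
      by (simp add: corr_act_def fun_eq_iff star_mult mult.assoc)
  qed
qed

lemma corr_act_1: "corr_act 1 f = f"
  by (simp add: corr_act_def fun_eq_iff)

lemma corr_gen_in: "\<sigma> \<in> S \<Longrightarrow> corr_gen \<sigma> \<in> car corr"
  unfolding corr_gen_def by (rule ev.ev_in) simp

lemma corr_act_gev: "L \<in> gsums \<Longrightarrow> corr_act a (gev L) = gev (lact a L)"
  by (simp add: corr_act_def gev_lact fun_eq_iff)

lemma inn_corr_gen:
  assumes "\<sigma> \<in> S" "\<tau> \<in> S"
  shows "inn corr (corr_gen \<sigma>) (corr_act b (corr_gen \<tau>)) = \<KK> \<sigma> \<tau> b"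
  using assms by (simp add: corr_gen_def corr_act_gev ev.inn_completion_ev gform_def)

text \<open>Splits \<gamma> into its part in \<C> and its scalar part, so that the generator b
  \<ii>(\<sigma>) \<gamma> is expressed through operations of the correspondence over \<C>
  itself.\<close>

lemma gev_Cons:
  assumes "\<sigma> \<in> S" "L \<in> gsums"
  shows "gev ((\<sigma>, b, \<gamma>) # L) = madd corr (corr_act b (madd corr (mact corr (corr_gen \<sigma>) (alg \<gamma>))
    (mscale corr (scal \<gamma>) (corr_gen \<sigma>)))) (gev L)"
proof -
  let ?L = "ract [(\<sigma>, 1, 1)] (alg \<gamma>) @ lsmul (scal \<gamma>) [(\<sigma>, 1, 1)]"
  have "uform p [(\<sigma>, b, \<gamma>)] = uform p (lact b ?L)" for p
  proof (induction p)
    case (Cons q p)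
    have \<gamma>: "\<gamma> = emb (alg \<gamma>) + scaleC (scal \<gamma>) 1" by (rule unitized_eqI) simp_all
    obtain \<tau> c \<delta> where q: "q = (\<tau>, c, \<delta>)" by (cases q)
    have "uform [q] [(\<sigma>, b, \<gamma>)] = uform [q] (lact b ?L)"
      by (subst \<gamma>) (simp add: q distrib_left lact_def uform_def)
    with Cons show ?case by (simp only: uform_Cons[of q p])
  qed simp
  then have 1: "gev ((\<sigma>, b, \<gamma>) # L) \<tau> c = gev (lact b ?L) \<tau> c + gev L \<tau> c" for \<tau> c
    by (simp add: gev_def gform_def uform_Cons_right[of _ _ L])
  have 2: "gev (lact b ?L) = corr_act b (gev ?L)"
    using assms by (intro corr_act_gev[symmetric]) simp
  have 3: "gev ?L = madd corr (mact corr (corr_gen \<sigma>) (alg \<gamma>)) (mscale corr (scal \<gamma>) (corr_gen \<sigma>))"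
    unfolding corr_gen_def ev.completion_simps using assms
    by (intro ext) (simp only: ev.ev_add ev.ev_act ev.ev_smul gsums_simps fst_conv)
  show ?thesis
    unfolding 3[symmetric] 2[symmetric] by (intro ext) (simp only: ev.completion_simps(3) 1)
qed

end

section \<open>The isometry determined by a kernel family\<close>

context tensor_pair
begin

text \<open>On lists the tensor relations hold only up to null vectors. Pairing with every
  \<open>w\<close> expresses them in the form that \<open>ds_eq_0\<close> turns into distance
  zero.\<close>

lemma tens_inn_right:
  assumes w: "w \<in> tens_sums E M" and x: "x \<in> car E" and y: "y \<in> car M"
  shows "z \<in> car M \<Longrightarrow> tens_inn E M \<phi> w [(x, madd M y z)] = tens_inn E M \<phi> w [(x, y)] + tens_inn E M \<phi> w [(x, z)]"
    and "tens_inn E M \<phi> w [(x, mscale M k y)] = tens_inn E M \<phi> w (tens_scale M k [(x, y)])"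
    and "tens_inn E M \<phi> w [(x, mact M y c)] = tens_inn E M \<phi> w (tens_act M [(x, y)] c)"
    and tens_inn_balanced: "tens_inn E M \<phi> w [(x, \<phi> b y)] = tens_inn E M \<phi> w [(mact E x b, y)]"
proof -
  show "tens_inn E M \<phi> w [(x, madd M y z)] = tens_inn E M \<phi> w [(x, y)] + tens_inn E M \<phi> w [(x, z)]"
    if "z \<in> car M"
    using w
  proof (induction w)
    case (Cons p w)
    obtain a b where "p = (a, b)" by (cases p)
    with Cons x y that show ?case
      by (simp add: tens_inn_Cons(1)[of "(a, b)" w] inn_phi_vec)
  qed simp
  show "tens_inn E M \<phi> w [(x, \<phi> b y)] = tens_inn E M \<phi> w [(mact E x b, y)]"
    using w
  proof (induction w)
    case (Cons p w)
    obtain a b where "p = (a, b)" by (cases p)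
    with Cons x y show ?case
      by (simp add: tens_inn_Cons(1)[of "(a, b)" w] E.inn_act \<phi>_mult)
  qed simp
qed (simp_all add: tens_scale_def tens_act_def)

text \<open>Allows second factors to be replaced by nearby ones from a dense set. The squared
  distance is the norm of \<langle>d, \<langle>x, x\<rangle> d\<rangle> with d = y - y', and
  unitality removes \<open>\<phi> 1\<close> from \<open>nrm_phi_le\<close>.\<close>

lemma tens_ds_elem_le:
  assumes x: "x \<in> car E" and y: "y \<in> car M" "y' \<in> car M" and unit: "\<And>z. z \<in> car M \<Longrightarrow> \<phi> 1 z = z"
  shows "t.ds [(x, y)] [(x, y')] \<le> E.si.nrm x * si.ds y y'"
proof (rule power2_le_imp_le)
  let ?d = "si.diff y y'" and ?a = "inn E x x"
  have "tens_inn E M \<phi> (t.diff [(x, y)] [(x, y')]) (t.diff [(x, y)] [(x, y')]) = inn M ?d (\<phi> ?a ?d)"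
    using x y
    by (simp add: t.form_diff t.form_diff_left si.form_diff_left inn_phi si.diff_def)
      (simp add: inn_phi_vec si.form_simps inn_phi_left scale_closed E.inn_star star_star)
  then have "(t.ds [(x, y)] [(x, y')])\<^sup>2 = norm (inn M ?d (\<phi> ?a ?d))"
    by (simp add: t.ds_def t.nrm_sq)
  also have "\<dots> \<le> si.nrm ?d * si.nrm (\<phi> ?a ?d)"
    using y by (intro si.cauchy_schwarz) simp_all
  also have "\<dots> \<le> si.nrm ?d * (norm ?a * si.nrm (\<phi> 1 ?d))"
    using y by (intro mult_left_mono nrm_phi_le[OF cstar_correspondence_axioms]) simp_all
  also have "\<dots> = (E.si.nrm x * si.ds y y')\<^sup>2"
    using y by (simp add: unit si.ds_def power_mult_distrib flip: E.si.nrm_sq) (simp add: power2_eq_square)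
  finally show "(t.ds [(x, y)] [(x, y')])\<^sup>2 \<le> (E.si.nrm x * si.ds y y')\<^sup>2" .
qed simp

end

locale kernel_family_data = E: hilbert_module E + F: hilbert_module F + cpd S \<KK>
  for E :: "('e,'b::{cstar_algebra,monoid_mult}) hmod" and F :: "('f,'c::cstar_algebra) hmod"
    and S :: "'s set" and \<KK> :: "'s \<Rightarrow> 's \<Rightarrow> 'b \<Rightarrow> 'c" +
  fixes K :: "'s \<Rightarrow> 'e \<Rightarrow> 'f"
  assumes K_in: "\<sigma> \<in> S \<Longrightarrow> x \<in> car E \<Longrightarrow> K \<sigma> x \<in> car F"
    and K_inn: "x \<in> car E \<Longrightarrow> x' \<in> car E \<Longrightarrow> \<sigma> \<in> S \<Longrightarrow> \<tau> \<in> S \<Longrightarrow>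
      inn F (K \<sigma> x) (K \<tau> x') = \<KK> \<sigma> \<tau> (inn E x x')"
begin

sublocale C: cstar_correspondence corr corr_act by (rule cstar_correspondence_corr)

sublocale T: tensor_pair E corr corr_act by unfold_locales

abbreviation TS where "TS \<equiv> tens_sums E corr"
abbreviation tinn where "tinn \<equiv> tens_inn E corr corr_act"

text \<open>The graph of the isometry on the algebraic span of the elements \<open>x \<odot> \<ii>(\<sigma>) c\<close>.\<close>

inductive graph :: "('e \<times> ('s \<Rightarrow> 'b \<Rightarrow> 'c)) list \<Rightarrow> 'f \<Rightarrow> bool" where
  graph_zero: "graph [] (mzero F)"
| graph_gen: "x \<in> car E \<Longrightarrow> \<sigma> \<in> S \<Longrightarrow> graph [(x, corr_gen \<sigma>)] (K \<sigma> x)"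
| graph_add: "graph u f \<Longrightarrow> graph v g \<Longrightarrow> graph (u @ v) (madd F f g)"
| graph_scale: "graph u f \<Longrightarrow> graph (tens_scale corr k u) (mscale F k f)"
| graph_act: "graph u f \<Longrightarrow> graph (tens_act corr u c) (mact F f c)"

lemma graph_in: "graph u f \<Longrightarrow> u \<in> TS \<and> f \<in> car F"
  by (induction rule: graph.induct)
    (simp_all add: F.zero_closed F.add_closed F.scale_closed F.act_closed K_in corr_gen_in)

text \<open>This is shown for the relation, before it is known to be single-valued: equality of
  inner products is exactly what forces equal images for sums at distance zero. The induction runs
  over the second sum against a fixed generator, then over the first.\<close>

lemma graph_inn:
  assumes "graph u f" "graph v g"
  shows "inn F f g = tinn u v"
proof -
  have F0: "inn F (mzero F) h = 0" if "h \<in> car F" for h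
    using F.inn_star[OF that F.zero_closed] that by simp
  have gen: "inn F (K \<sigma> x) g = tinn [(x, corr_gen \<sigma>)] v"
    if "graph v g" "x \<in> car E" "\<sigma> \<in> S" for x \<sigma> v g
    using that(1)
  proof (induction rule: graph.induct)
    case (graph_gen x' \<tau>)
    then show ?case using that(2,3) by (simp add: K_inn inn_corr_gen)
  qed (use that(2,3) graph_in in \<open>simp_all add: K_in corr_gen_in F.inn_add F.inn_scale F.inn_act
      T.t.form_smul T.t.form_act\<close>)
  show ?thesis using assms(1)
  proof (induction rule: graph.induct)
    case graph_zero
    then show ?case using graph_in[OF assms(2)] by (simp add: F0)
  next
    case (graph_gen x \<sigma>)
    then show ?case by (rule gen[OF assms(2)])
  qed (use graph_in graph_in[OF assms(2)] in \<open>simp_all add: F.si.form_simps T.t.form_smul_left T.t.form_act_left\<close>)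
qed

lemma graph_diff: "graph u f \<Longrightarrow> graph v g \<Longrightarrow> graph (T.t.diff u v) (F.si.diff f g)"
  unfolding T.t.diff_def F.si.diff_def by (intro graph_add graph_scale)

lemma graph_ds:
  assumes "graph u f" "graph v g"
  shows "F.si.ds f g = T.t.ds u v"
  using graph_inn[OF graph_diff[OF assms] graph_diff[OF assms]]
  by (simp add: F.si.ds_def T.t.ds_def F.si.nrm_def T.t.nrm_def)

text \<open>Up to null vectors, x \<odot> b \<ii>(\<sigma>) \<gamma> equals (x b \<odot>
  \<ii>(\<sigma>)) \<gamma>: balancing moves b onto x, and \<gamma> is split as in
  \<open>gev_Cons\<close>.\<close>

lemma graph_gev:
  assumes "L \<in> gsums" "x \<in> car E"
  shows "\<exists>v f. graph v f \<and> (\<forall>w\<in>TS. tinn w [(x, gev L)] = tinn w v)"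
  using assms(1)
proof (induction L)
  case Nil
  \<comment> \<open>Written as 0 times itself, the zero vector visibly gives a tensor that pairs to
    0 with everything.\<close>
  have "gev [] = mscale corr 0 (gev [])" by (simp add: ev.completion_simps ev.ev_nul fun_eq_iff)
  then have "tinn w [(x, gev [])] = 0" if "w \<in> TS" for w
    using T.tens_inn_right(2)[OF that assms(2), of "gev []" 0] T.t.form_smul[OF that, of "[(x, gev [])]" 0]
      assms(2) ev.ev_in[of "[]"] by simp
  then show ?case using graph_zero by fastforce
next
  case (Cons p L)
  obtain \<sigma> b \<gamma> where p: "p = (\<sigma>, b, \<gamma>)" by (cases p)
  then have \<sigma>: "\<sigma> \<in> S" and L: "L \<in> gsums" using Cons.prems by auto
  obtain v f where v: "graph v f" "\<And>w. w \<in> TS \<Longrightarrow> tinn w [(x, gev L)] = tinn w v"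
    using Cons.IH[OF L] by blast
  let ?y = "corr_gen \<sigma>" and ?x = "mact E x b"
  let ?u = "[(?x, ?y)]"
  have x': "?x \<in> car E" by (rule E.act_closed[OF assms(2)])
  have y: "?y \<in> car corr" by (rule corr_gen_in[OF \<sigma>])
  have gu: "graph ?u (K \<sigma> ?x)" by (rule graph_gen[OF x' \<sigma>])
  let ?v = "(tens_act corr ?u (alg \<gamma>) @ tens_scale corr (scal \<gamma>) ?u) @ v"
  have "graph ?v (madd F (madd F (mact F (K \<sigma> ?x) (alg \<gamma>)) (mscale F (scal \<gamma>) (K \<sigma> ?x))) f)"
    by (intro graph_add graph_act graph_scale gu v(1))
  moreover have "tinn w [(x, gev (p # L))] = tinn w ?v" if w: "w \<in> TS" for w
  proof -
    let ?z = "madd corr (mact corr ?y (alg \<gamma>)) (mscale corr (scal \<gamma>) ?y)"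
    have z: "?z \<in> car corr" by (simp add: y C.add_closed C.act_closed C.scale_closed)
    have "tinn w [(x, gev (p # L))] = tinn w [(x, corr_act b ?z)] + tinn w [(x, gev L)]"
      unfolding p gev_Cons[OF \<sigma> L]
      by (rule T.tens_inn_right(1)[OF w assms(2) C.phi_closed[OF z] ev.ev_in[OF L]])
    also have "tinn w [(x, corr_act b ?z)] = tinn w [(?x, ?z)]"
      by (rule T.tens_inn_balanced[OF w assms(2) z])
    also have "\<dots> = tinn w [(?x, mact corr ?y (alg \<gamma>))] + tinn w [(?x, mscale corr (scal \<gamma>) ?y)]"
      by (rule T.tens_inn_right(1)[OF w x' C.act_closed[OF y] C.scale_closed[OF y]])
    also have "\<dots> = tinn w (tens_act corr ?u (alg \<gamma>)) + tinn w (tens_scale corr (scal \<gamma>) ?u)"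
      by (simp only: T.tens_inn_right(2,3)[OF w x' y])
    finally show ?thesis by (simp add: v(2)[OF w])
  qed
  ultimately show ?case by blast
qed

lemma graph_dense:
  assumes "u \<in> TS" "\<epsilon> > 0"
  shows "\<exists>v f. graph v f \<and> T.t.ds u v < \<epsilon>"
  using assms
proof (induction u arbitrary: \<epsilon>)
  case Nil
  have "T.t.ds [] [] = 0" by simp
  then show ?case using graph_zero Nil by metis
next
  case (Cons p u)
  obtain x y where p: "p = (x, y)" by (cases p)
  then have x: "x \<in> car E" and y: "y \<in> car corr" and u: "u \<in> TS" using Cons.prems by auto
  obtain v f where v: "graph v f" "T.t.ds u v < \<epsilon>/2" using Cons.IH[OF u, of "\<epsilon>/2"] Cons.prems by auto
  \<comment> \<open>Half of \<epsilon> is left for the tail \<open>u\<close>; the summand 1 keeps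
    the quotient defined for a null \<open>x\<close>.\<close>
  define \<delta> where "\<delta> = \<epsilon> / 2 / (E.si.nrm x + 1)"
  have nx: "E.si.nrm x + 1 > 0" using E.si.nrm_nonneg[of x] by linarith
  have \<delta>: "\<delta> > 0" using Cons.prems nx by (simp add: \<delta>_def)
  obtain L where L: "L \<in> gsums" "ev.c.ds y (gev L) < \<delta>" using ev.ev_dense[OF y \<delta>] by blast
  have gL: "gev L \<in> car corr" by (rule ev.ev_in[OF L(1)])
  obtain v' f' where v': "graph v' f'" "\<And>w. w \<in> TS \<Longrightarrow> tinn w [(x, gev L)] = tinn w v'"
    using graph_gev[OF L(1) x] by blast
  have in': "[(x, y)] \<in> TS" "[(x, gev L)] \<in> TS" "v' \<in> TS" "v \<in> TS"
    using x y gL graph_in[OF v'(1)] graph_in[OF v(1)] by simp_all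
  have "T.t.ds [(x, y)] v' \<le> T.t.ds [(x, y)] [(x, gev L)] + T.t.ds [(x, gev L)] v'"
    by (rule T.t.ds_triangle) (fact in')+
  also have "T.t.ds [(x, gev L)] v' = 0" by (rule T.t.ds_eq_0) (use in' v'(2) in auto)
  also have "T.t.ds [(x, y)] [(x, gev L)] \<le> E.si.nrm x * ev.c.ds y (gev L)"
    by (rule T.tens_ds_elem_le[OF x y gL]) (rule corr_act_1)
  also have "\<dots> \<le> (E.si.nrm x + 1) * \<delta>"
    using L(2) by (intro mult_mono) simp_all
  also have "\<dots> = \<epsilon>/2"
    unfolding \<delta>_def
    using nonzero_mult_div_cancel_left[OF less_imp_neq[OF nx, symmetric], of "\<epsilon> / 2"]
    by (simp only: times_divide_eq_right)
  finally have 1: "T.t.ds [(x, y)] v' \<le> \<epsilon>/2" by simp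
  have "T.t.ds ([(x, y)] @ u) (v' @ v) \<le> T.t.ds [(x, y)] v' + T.t.ds u v"
    by (rule T.t.ds_add_le) (use in' u in auto)
  then have "T.t.ds (p # u) (v' @ v) < \<epsilon>" using 1 v(2) by (simp add: p)
  then show ?case using graph_add[OF v'(1) v(1)] by blast
qed

text \<open>The closure of \<open>graph\<close>, with classes of Cauchy sequences as arguments. Some
  representing sequence has to run inside the graph; \<open>graph_dense\<close> supplies one for
  every class.\<close>

definition realizes where
  "realizes U f \<longleftrightarrow> f \<in> car F \<and> (\<exists>v g. (\<forall>n. graph (v n) (g n)) \<and> T.t.cauchy v \<and> U = T.cls v
     \<and> (\<lambda>n. F.si.ds (g n) f) \<longlonglongrightarrow> 0)"

lemma graph_cauchy:
  assumes "\<And>n. graph (v n) (g n)" "T.t.cauchy v"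
  shows "F.si.cauchy g"
proof (rule F.si.cauchyI)
  show "g n \<in> car F" for n using graph_in[OF assms(1)] by blast
  have "F.si.ds (g m) (g n) = T.t.ds (v m) (v n)" for m n by (rule graph_ds[OF assms(1) assms(1)])
  then show "\<exists>N. \<forall>m\<ge>N. \<forall>n\<ge>N. F.si.ds (g m) (g n) < \<epsilon>" if "\<epsilon> > 0" for \<epsilon>
    using T.t.cauchyD[OF assms(2) that] by simp
qed

lemma realizes_exists:
  assumes "T.t.cauchy s"
  shows "\<exists>f. realizes (T.cls s) f"
proof -
  have "\<exists>v f. graph v f \<and> T.t.ds (s n) v < inverse (real (Suc n))" for n
    by (rule graph_dense[OF T.t.cauchy_in[OF assms]]) simp
  then obtain v g where g: "\<And>n. graph (v n) (g n)" and d: "\<And>n. T.t.ds (s n) (v n) < inverse (real (Suc n))"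
    by metis
  have lim: "(\<lambda>n. T.t.ds (s n) (v n)) \<longlonglongrightarrow> 0"
    by (rule tendsto_sandwich[OF _ _ tendsto_const LIMSEQ_inverse_real_of_nat])
      (use d in \<open>auto intro!: always_eventually less_imp_le\<close>)
  have cv: "T.t.cauchy v"
    by (rule T.t.cauchy_close[OF assms _ lim]) (use graph_in[OF g] in blast)
  obtain f where "f \<in> car F" "(\<lambda>n. F.si.ds (g n) f) \<longlonglongrightarrow> 0"
    by (rule F.ex_limit[OF graph_cauchy[OF g cv]])
  moreover have "T.cls s = T.cls v" by (rule T.cls_eqI[OF assms cv lim])
  ultimately show ?thesis using g cv unfolding realizes_def by blast
qed

lemma realizes_inn:
  assumes "realizes U f" "realizes U' f'"
  shows "inn F f f' = inn (interior_tensor E corr corr_act) U U'"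
proof -
  obtain v g where v: "\<And>n. graph (v n) (g n)" "T.t.cauchy v" "U = T.cls v" "(\<lambda>n. F.si.ds (g n) f) \<longlonglongrightarrow> 0"
    and f: "f \<in> car F" using assms(1) unfolding realizes_def by blast
  obtain v' g' where v': "\<And>n. graph (v' n) (g' n)" "T.t.cauchy v'" "U' = T.cls v'" "(\<lambda>n. F.si.ds (g' n) f') \<longlonglongrightarrow> 0"
    and f': "f' \<in> car F" using assms(2) unfolding realizes_def by blast
  note cg = graph_cauchy[OF v(1,2)] and cg' = graph_cauchy[OF v'(1,2)]
  obtain l where l: "(\<lambda>n. inn F (g n) (g' n)) \<longlonglongrightarrow> l"
    using F.si.form_convergent[OF cg cg'] by (auto simp: convergent_def)
  have "(\<lambda>n. inn F f f') \<longlonglongrightarrow> l"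
    by (rule F.si.form_limit_cong[OF cg F.si.cauchy_const[OF f] cg' F.si.cauchy_const[OF f'] v(4) v'(4) l])
  then have "inn F f f' = l" by (simp add: LIMSEQ_const_iff)
  moreover have "inn (interior_tensor E corr corr_act) U U' = l"
    unfolding v(3) v'(3) using l by (intro T.inn_interior v(2) v'(2)) (simp add: graph_inn[OF v(1) v'(1)])
  ultimately show ?thesis by simp
qed

lemma realizes_in: "realizes U f \<Longrightarrow> f \<in> car F" by (simp add: realizes_def)

text \<open>All four inner products among \<open>f\<close> and \<open>f'\<close> equal that of
  \<open>U\<close> with itself, so \<open>f - f'\<close> has norm 0.\<close>

lemma realizes_unique:
  assumes "realizes U f" "realizes U f'"
  shows "f = f'"
proof (rule F.eq_of_ds_0)
  show "f \<in> car F" "f' \<in> car F" using assms by (simp_all add: realizes_in)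
  then show "F.si.ds f f' = 0"
    using realizes_inn[OF assms(1,1)] realizes_inn[OF assms(1,2)] realizes_inn[OF assms(2,1)]
      realizes_inn[OF assms(2,2)]
    by (simp add: F.si.ds_def F.si.nrm_def F.si.form_diff F.si.form_diff_left)
qed

lemma realizes_add:
  assumes "realizes U f" "realizes U' f'"
  shows "realizes (madd (interior_tensor E corr corr_act) U U') (madd F f f')"
proof -
  obtain v g where v: "\<And>n. graph (v n) (g n)" "T.t.cauchy v" "U = T.cls v" "(\<lambda>n. F.si.ds (g n) f) \<longlonglongrightarrow> 0"
    and f: "f \<in> car F" using assms(1) unfolding realizes_def by blast
  obtain v' g' where v': "\<And>n. graph (v' n) (g' n)" "T.t.cauchy v'" "U' = T.cls v'" "(\<lambda>n. F.si.ds (g' n) f') \<longlonglongrightarrow> 0"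
    and f': "f' \<in> car F" using assms(2) unfolding realizes_def by blast
  have "(\<lambda>n. F.si.ds (madd F (g n) (g' n)) (madd F f f')) \<longlonglongrightarrow> 0"
    by (rule F.si.ds_limit_add[OF graph_cauchy[OF v(1,2)] graph_cauchy[OF v'(1,2)]
          F.si.cauchy_const[OF f] F.si.cauchy_const[OF f'] v(4) v'(4)])
  moreover have "madd (interior_tensor E corr corr_act) U U' = T.cls (\<lambda>n. v n @ v' n)"
    unfolding v(3) v'(3) by (rule T.madd_interior[OF v(2) v'(2)])
  ultimately show ?thesis
    unfolding realizes_def
    by (intro conjI exI[of _ "\<lambda>n. v n @ v' n"] exI[of _ "\<lambda>n. madd F (g n) (g' n)"] allI graph_add
        F.add_closed T.t.cauchy_add v v' f f')
qed

lemma realizes_scale: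
  assumes "realizes U f"
  shows "realizes (mscale (interior_tensor E corr corr_act) k U) (mscale F k f)"
proof -
  obtain v g where v: "\<And>n. graph (v n) (g n)" "T.t.cauchy v" "U = T.cls v" "(\<lambda>n. F.si.ds (g n) f) \<longlonglongrightarrow> 0"
    and f: "f \<in> car F" using assms(1) unfolding realizes_def by blast
  have "(\<lambda>n. F.si.ds (mscale F k (g n)) (mscale F k f)) \<longlonglongrightarrow> 0"
    by (rule F.si.ds_limit_smul[OF graph_cauchy[OF v(1,2)] F.si.cauchy_const[OF f] v(4)])
  moreover have "mscale (interior_tensor E corr corr_act) k U = T.cls (\<lambda>n. tens_scale corr k (v n))"
    unfolding v(3) by (rule T.mscale_interior[OF v(2)])
  ultimately show ?thesis
    unfolding realizes_def
    by (intro conjI exI[of _ "\<lambda>n. tens_scale corr k (v n)"] exI[of _ "\<lambda>n. mscale F k (g n)"] allI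
        graph_scale F.scale_closed T.t.cauchy_smul v f)
qed

lemma realizes_gen:
  assumes "x \<in> car E" "\<sigma> \<in> S"
  shows "realizes (elem_tensor E corr corr_act x (corr_gen \<sigma>)) (K \<sigma> x)"
proof -
  have "T.t.cauchy (\<lambda>n. [(x, corr_gen \<sigma>)])"
    using assms by (intro T.t.cauchy_const) (simp add: corr_gen_in)
  then show ?thesis
    unfolding realizes_def elem_tensor_def
    using K_in[OF assms(2,1)] graph_gen[OF assms]
    by (intro conjI exI[of _ "\<lambda>n. [(x, corr_gen \<sigma>)]"] exI[of _ "\<lambda>n. K \<sigma> x"]) simp_all
qed

definition isom where "isom U = (THE f. realizes U f)"

lemma isom_eq: "realizes U f \<Longrightarrow> isom U = f"
  unfolding isom_def by (rule the_equality) (auto intro: realizes_unique)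

theorem tensor_factorization_corr: "tensor_factorization E F S K corr corr_act corr_gen isom"
proof -
  let ?T = "interior_tensor E corr corr_act"
  have ex: "realizes U (isom U)" if "U \<in> car ?T" for U
    using that realizes_exists isom_eq by (fastforce simp: T.car_interior)
  have "hmod_isometry ?T F isom"
    unfolding hmod_isometry_def
    by (auto simp: ex realizes_in[OF ex] realizes_inn isom_eq[OF realizes_add] isom_eq[OF realizes_scale])
  then show ?thesis
    unfolding tensor_factorization_def
    by (auto simp: cstar_correspondence_corr corr_gen_in isom_eq[OF realizes_gen])
qed

end

theorem theorem2p2:
  fixes E :: "('e, 'b::{cstar_algebra, monoid_mult}) hmod"
    and F :: "('f, 'c::cstar_algebra) hmod"
    and S :: "'s set"
    and K :: "'s \<Rightarrow> 'e \<Rightarrow> 'f"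
  assumes "hilbert_module E"
    and "hilbert_module F"
    and "\<And>\<sigma>. \<sigma> \<in> S \<Longrightarrow> K \<sigma> \<in> car E \<rightarrow> car F"
  shows "((\<exists>\<KK>. cpd_kernel S \<KK> \<and> kernel_family E F S \<KK> K) \<longleftrightarrow>
          (\<exists>(M :: ('s \<Rightarrow> 'b \<Rightarrow> 'c, 'c) hmod) \<phi> \<ii> \<nu>. tensor_factorization E F S K M \<phi> \<ii> \<nu>))
       \<and> ((\<exists>(M :: ('m, 'c) hmod) \<phi> \<ii> \<nu>. tensor_factorization E F S K M \<phi> \<ii> \<nu>) \<longrightarrow>
          (\<exists>\<KK>. cpd_kernel S \<KK> \<and> kernel_family E F S \<KK> K))"
proof (intro conjI iffI impI)
  assume "\<exists>\<KK>. cpd_kernel S \<KK> \<and> kernel_family E F S \<KK> K"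
  then obtain \<KK> where \<KK>: "cpd_kernel S \<KK>" "kernel_family E F S \<KK> K" by blast
  interpret kernel_family_data E F S \<KK> K
    using assms \<KK> by (auto simp: kernel_family_data_def kernel_family_data_axioms_def cpd_def kernel_family_def)
  show "\<exists>(M :: ('s \<Rightarrow> 'b \<Rightarrow> 'c, 'c) hmod) \<phi> \<ii> \<nu>. tensor_factorization E F S K M \<phi> \<ii> \<nu>"
    using tensor_factorization_corr by blast
\<comment> \<open>\<open>kernel_of_factorization\<close> is polymorphic in the carrier type of the
  correspondence, so one fact covers both the function type and the arbitrary type
  \<open>'m\<close>.\<close>
qed (use kernel_of_factorization[OF assms(1)] in blast)+

end
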